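(* Let $L$ be an even lattice of rank $2$ and let $(n,m)$ be the invariant factor of $L\subset L^\vee$. Let $D_2$ be the $2$-component of the discriminant form $D_L$. (1) If $D_2$ is either trivial or $U_k$ or $V_k$, or equivalently if $L\simeq M(2^e)$ for an even lattice $M$ with $\det(M)$ odd, then $$|O(D_L)|=2^{\widetilde{\tau}(n)+\widetilde{\tau}(n^{-1}m)}\cdot n\cdot\prod_{p\mid n}\Bigl(1-\frac{\chi_p(\varepsilon_p)}{p}\Bigr).$$ (2) If $D_2\simeq A_{2,k}^{\theta,\theta'}$, or equivalently if $L\simeq M(2^e)$ for an odd lattice $M$ with $\det(M)$ odd, then $$|O(D_L)|=C\cdot2^{\widetilde{\tau}(2^{-1}n)+\widetilde{\tau}(n^{-1}m)}\cdot n\cdot\prod_{p\mid n,\ p\ne2}\Bigl(1-\frac{\chi_p(\varepsilon_p)}{p}\Bigr),$$ where $C=1$ if $\varepsilon_2\equiv-1\bmod4$ and $C=\frac12$ if $\varepsilon_2\equiv1\bmod4$. (3) If $D_2\simeq B_{2,l,k}^{\theta,\theta'}$, or equivalently if $L\simeq M(2^e)$ for an odd lattice $M$ with $\det(M)$ even, then $$|O(D_L)|=C\cdot2^{\widetilde{\tau}(2^{-1}n)+\widetilde{\tau}(n^{-1}m)}\cdot n\cdot\prod_{p\mid n,\ p\ne2}\Bigl(1-\frac{\chi_p(\varepsilon_p)}{p}\Bigr),$$ where $C=1$ if $l-k\ge3$ and $C=\frac12$ if $l-k\le2$.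
   Context: An even lattice $L$ is a free $\mathbb{Z}$-module of finite rank with a non-degenerate integral symmetric bilinear form such that $(l,l)\in2\mathbb{Z}$ for all $l$ (an odd lattice is an integral one that is not even). $M(c)$ denotes $M$ with its form multiplied by $c$. The discriminant form $D_L$ is the finite group $L^\vee/L$ with the quadratic form $q_L(x+L)=(x,x)+2\mathbb{Z}\in\mathbb{Q}/2\mathbb{Z}$; $O(D_L)$ is its isometry group, and $D_L=\bigoplus_pD_p$ is the orthogonal decomposition into $p$-components. The invariant factor $(n,m)$ of $L\subset L^\vee$: $n\mid m$ are positive integers such that there is a basis $\{v_1,v_2\}$ of $L^\vee$ with $L=\langle nv_1,mv_2\rangle$. For a natural number $N>1$, $\widetilde{\tau}(N)$ is the number of distinct prime divisors of $N$, and $\widetilde{\tau}(1):=0$. For a prime $p\mid n$: if $p$ divides $n$ and $m$ to the same exponent $e$, put $\varepsilon_p:=-p^{-2e}\det(L)$; if the exponent of $p$ in $m$ is strictly larger than in $n$, put $\varepsilon_p:=0$. For odd $p$, $\chi_p(\varepsilon)=\left(\frac{\varepsilon}{p}\right)$ is the Legendre symbol for $\varepsilon$ prime to $p$; $\chi_p(0):=0$; and for $a\equiv1\bmod4$, $\chi_2(a)=1$ if $a\equiv1\bmod8$ and $\chi_2(a)=-1$ if $a\equiv5\bmod8$. Finite quadratic forms on $2$-groups (given by Gram matrices with respect to the standard generators; quadratic form valued in $\mathbb{Q}/2\mathbb{Z}$): $A_{2,k}^{\theta,\theta'}=\begin{pmatrix}\theta2^{-k}&0\\0&\theta'2^{-k}\end{pmatrix}$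 on $(\mathbb{Z}/2^k\mathbb{Z})^2$; $B_{2,l,k}^{\theta,\theta'}=\begin{pmatrix}\theta2^{-l}&0\\0&\theta'2^{-k}\end{pmatrix}$ on $\mathbb{Z}/2^l\mathbb{Z}\oplus\mathbb{Z}/2^k\mathbb{Z}$ with $l>k$; $V_k=\begin{pmatrix}2^{1-k}&2^{-k}\\2^{-k}&2^{1-k}\end{pmatrix}$ and $U_k=\begin{pmatrix}0&2^{-k}\\2^{-k}&0\end{pmatrix}$ on $(\mathbb{Z}/2^k\mathbb{Z})^2$; here $k\ge1$ and $\theta,\theta'\in\mathbb{Z}_2^\times/(\mathbb{Z}_2^\times)^2$. *)

theory Defs
  imports
    "HOL-Analysis.Analysis"
    "HOL-Number_Theory.Number_Theory"
    "HOL-Algebra.Elementary_Groups"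
    "HOL-Algebra.Bij"
begin

section \<open>Integral lattices\<close>

text \<open>
  A lattice \<open>L\<close> is given inside the rational vector space spanned by it: the type \<open>'v\<close> with
  scalar multiplication \<open>smul L\<close> is \<open>L \<otimes> \<rat>\<close>, \<open>form L\<close> is the \<open>\<rat>\<close>-bilinear extension of the
  form, and \<open>points L\<close> is \<open>L\<close> itself. A free \<open>\<int>\<close>-module of finite rank is then the set of
  integral combinations of a finite \<open>\<rat>\<close>-basis. In particular every lattice of rank 2 is isometric to one in
  \<open>\<rat>\<^sup>2\<close> (with a suitable form), so ``there is a lattice \<open>M\<close> of rank 2'' may be stated for lattices
  in \<open>\<rat>\<^sup>2\<close>.
\<close>

record 'v zlattice =
  smul :: "rat \<Rightarrow> 'v \<Rightarrow> 'v"
  form :: "'v \<Rightarrow> 'v \<Rightarrow> rat"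
  points :: "'v set"

definition zspan :: "('v::ab_group_add) zlattice \<Rightarrow> 'v set \<Rightarrow> 'v set" where
  "zspan L B = range (\<lambda>c :: 'v \<Rightarrow> int. \<Sum>b\<in>B. smul L (of_int (c b)) b)"

definition lattice_basis :: "('v::ab_group_add) zlattice \<Rightarrow> 'v set \<Rightarrow> bool" where
  "lattice_basis L B \<longleftrightarrow>
     finite B \<and> \<not> module.dependent (smul L) B \<and> module.span (smul L) B = UNIV \<and>
     points L = zspan L B"

definition integral_lattice :: "('v::ab_group_add) zlattice \<Rightarrow> bool" where
  "integral_lattice L \<longleftrightarrow>
     vector_space (smul L) \<and>
     (\<exists>B. lattice_basis L B) \<and>
     (\<forall>x. Vector_Spaces.linear (smul L) (*) (form L x)) \<and>
     (\<forall>x y. form L x y = form L y x) \<and>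
     (\<forall>x. (\<forall>y. form L x y = 0) \<longrightarrow> x = 0) \<and>
     (\<forall>x\<in>points L. \<forall>y\<in>points L. form L x y \<in> \<int>)"

definition even_lattice :: "('v::ab_group_add) zlattice \<Rightarrow> bool" where
  "even_lattice L \<longleftrightarrow>
     integral_lattice L \<and> (\<forall>x\<in>points L. \<exists>k::int. form L x x = of_int (2 * k))"

definition odd_lattice :: "('v::ab_group_add) zlattice \<Rightarrow> bool" where
  "odd_lattice L \<longleftrightarrow> integral_lattice L \<and> \<not> even_lattice L"

definition lattice_rank :: "('v::ab_group_add) zlattice \<Rightarrow> nat" where
  "lattice_rank L = vector_space.dim (smul L) UNIV"

text \<open>The determinant of a Gram matrix of an integral lattice of rank 2.\<close>

definition lattice_det :: "('v::ab_group_add) zlattice \<Rightarrow> int" where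
  "lattice_det L =
     (THE d. \<exists>v :: 2 \<Rightarrow> 'v. inj v \<and> lattice_basis L (range v) \<and>
        of_int d = det (\<chi> i j. form L (v i) (v j)))"

definition rescale :: "('v::ab_group_add) zlattice \<Rightarrow> nat \<Rightarrow> 'v zlattice" where
  "rescale M c = M\<lparr>form := \<lambda>x y. of_nat c * form M x y\<rparr>"

definition lattice_isometric ::
    "('v::ab_group_add) zlattice \<Rightarrow> ('w::ab_group_add) zlattice \<Rightarrow> bool" where
  "lattice_isometric L M \<longleftrightarrow>
     (\<exists>f. bij_betw f (points L) (points M) \<and>
          (\<forall>x\<in>points L. \<forall>y\<in>points L. f (x + y) = f x + f y) \<and>
          (\<forall>x\<in>points L. \<forall>y\<in>points L. form M (f x) (f y) = form L x y))"

definition dual_lattice :: "('v::ab_group_add) zlattice \<Rightarrow> 'v zlattice" where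
  "dual_lattice L = L\<lparr>points := {x. \<forall>y\<in>points L. form L x y \<in> \<int>}\<rparr>"

definition invariant_factor :: "('v::ab_group_add) zlattice \<Rightarrow> nat \<Rightarrow> nat \<Rightarrow> bool" where
  "invariant_factor L n m \<longleftrightarrow>
     n > 0 \<and> m > 0 \<and> n dvd m \<and>
     (\<exists>v1 v2. v1 \<noteq> v2 \<and> lattice_basis (dual_lattice L) {v1, v2} \<and>
        points L = zspan L {smul L (of_nat n) v1, smul L (of_nat m) v2})"

section \<open>Finite quadratic forms\<close>

text \<open>Elements of \<open>\<rat>/2\<int>\<close> are represented as cosets of \<open>2\<int>\<close> in \<open>\<rat>\<close>.\<close>

definition mod2Z :: "rat \<Rightarrow> rat set" where
  "mod2Z r = range (\<lambda>k::int. r + of_int (2 * k))"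

record 'a quad_group = "'a monoid" +
  qform :: "'a \<Rightarrow> rat set"

definition quad_group :: "'a monoid \<Rightarrow> ('a \<Rightarrow> rat set) \<Rightarrow> 'a quad_group" where
  "quad_group G q =
     \<lparr>carrier = carrier G, monoid.mult = monoid.mult G, one = one G, qform = q\<rparr>"

definition quad_isomorphic :: "'a quad_group \<Rightarrow> 'b quad_group \<Rightarrow> bool" where
  "quad_isomorphic D E \<longleftrightarrow>
     (\<exists>f\<in>iso D E. \<forall>x\<in>carrier D. qform E (f x) = qform D x)"

text \<open>The elements of \<^const>\<open>auto\<close> are extensional on the carrier, so this set has the
  cardinality of the isometry group.\<close>

definition isometry_group :: "'a quad_group \<Rightarrow> ('a \<Rightarrow> 'a) set" where
  "isometry_group D = {f \<in> auto D. \<forall>x\<in>carrier D. qform D (f x) = qform D x}"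

definition p_component :: "nat \<Rightarrow> 'a quad_group \<Rightarrow> 'a quad_group" where
  "p_component p D =
     D\<lparr>carrier := {x \<in> carrier D. \<exists>k::nat. x [^]\<^bsub>D\<^esub> (p ^ k) = \<one>\<^bsub>D\<^esub>}\<rparr>"

text \<open>\<open>L\<^sup>\<or>/L\<close> with \<open>q(x + L) = (x, x) + 2\<int>\<close>. For even \<open>L\<close> the union below runs over equal sets.\<close>

definition discriminant_form :: "('v::ab_group_add) zlattice \<Rightarrow> 'v set quad_group" where
  "discriminant_form L =
     quad_group
       (\<lparr>carrier = points (dual_lattice L), monoid.mult = (+), one = 0\<rparr> Mod points L)
       (\<lambda>X. \<Union>x\<in>X. mod2Z (form L x x))"

text \<open>The form with Gram matrix \<open>((a, b), (b, c))\<close> on \<open>\<int>/N\<int> \<oplus> \<int>/N'\<int>\<close>, with residues represented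
  by \<open>{0..<N}\<close> and \<open>{0..<N'}\<close>.\<close>

definition gram_form :: "nat \<Rightarrow> nat \<Rightarrow> rat \<Rightarrow> rat \<Rightarrow> rat \<Rightarrow> (int \<times> int) quad_group" where
  "gram_form N N' a b c =
     quad_group (integer_mod_group N \<times>\<times> integer_mod_group N')
       (\<lambda>(x, y). mod2Z (a * of_int (x ^ 2) + 2 * b * of_int (x * y) + c * of_int (y ^ 2)))"

text \<open>The parameters \<open>\<theta>, \<theta>'\<close> are odd integers representing classes in
  \<open>\<int>\<^sub>2\<^sup>\<times>/(\<int>\<^sub>2\<^sup>\<times>)\<^sup>2\<close>, i.e. odd residues modulo 8; every class is so represented, and
  congruent parameters give isomorphic forms.\<close>

definition form_A :: "nat \<Rightarrow> int \<Rightarrow> int \<Rightarrow> (int \<times> int) quad_group" where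
  "form_A k \<theta> \<theta>' = gram_form (2^k) (2^k) (of_int \<theta> / 2^k) 0 (of_int \<theta>' / 2^k)"

definition form_B :: "nat \<Rightarrow> nat \<Rightarrow> int \<Rightarrow> int \<Rightarrow> (int \<times> int) quad_group" where
  "form_B l k \<theta> \<theta>' = gram_form (2^l) (2^k) (of_int \<theta> / 2^l) 0 (of_int \<theta>' / 2^k)"

definition form_V :: "nat \<Rightarrow> (int \<times> int) quad_group" where
  "form_V k = gram_form (2^k) (2^k) (2 / 2^k) (1 / 2^k) (2 / 2^k)"

definition form_U :: "nat \<Rightarrow> (int \<times> int) quad_group" where
  "form_U k = gram_form (2^k) (2^k) 0 (1 / 2^k) 0"

section \<open>Arithmetic functions\<close>

definition tau :: "nat \<Rightarrow> nat" where
  "tau N = card (prime_factors N)"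

text \<open>The division is exact: \<open>\<bar>det L\<bar> = |L\<^sup>\<or>/L| = n m\<close> for the invariant factor \<open>(n, m)\<close>.\<close>

definition eps :: "('v::ab_group_add) zlattice \<Rightarrow> nat \<Rightarrow> nat \<Rightarrow> nat \<Rightarrow> int" where
  "eps L n m p =
     (if multiplicity p n = multiplicity p m
      then (- lattice_det L) div int p ^ (2 * multiplicity p n) else 0)"

text \<open>For \<open>p = 2\<close> only arguments congruent to 1 modulo 4 are meaningful; other values are 0 by
  convention. For odd \<open>p\<close> the library symbol already has \<open>Legendre 0 p = 0\<close>.\<close>

definition chi :: "nat \<Rightarrow> int \<Rightarrow> int" where
  "chi p a =
     (if p = 2 then (if a mod 8 = 1 then 1 else if a mod 8 = 5 then -1 else 0)
      else Legendre a (int p))"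

end

theory Submission
  imports Defs
begin

text \<open>
  Let \<open>(n, m)\<close> be the invariant factor of \<open>L\<close> and write \<open>m = n r\<close>. In the basis of \<open>L\<close> adapted to
  \<open>L \<subseteq> L\<^sup>\<or>\<close> the Gram matrix has the entries \<open>n a\<close>, \<open>n r b\<close>, \<open>n r c\<close>, and the dual lattice is spanned by
  the two basis vectors divided by \<open>n\<close> and \<open>n r\<close> exactly when \<open>a c - r b^2 = \<plusminus>1\<close>
  (\<open>discriminant_data_exists\<close>). So the discriminant form lives on \<open>\<int>/nr \<oplus> \<int>/n\<close>, with the quadratic form
  \<open>(c x^2 + 2 r b x y + r a y^2) / (n r)\<close> modulo \<open>2\<close> (\<open>discriminant_form_isomorphic\<close>), and everything is a
  question about such binary forms.

  Torsion parts of coprime order are orthogonal, hence \<open>|O(D)|\<close> is the product of the orders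
  of the isometry groups of the \<open>p\<close>-parts (\<open>card_isometry_group_binary_product\<close>). If \<open>k\<close> and \<open>e\<close> are the
  exponents of \<open>p\<close> in \<open>n\<close> and \<open>r\<close>, the \<open>p\<close>-part is again a binary form, on \<open>\<int>/p^(k+e) \<oplus> \<int>/p^k\<close>
  (\<open>torsion_binary_quad_group\<close>).

  An isometry is the same thing as a pair \<open>(g, h)\<close> of vectors with the same lengths and the same
  inner product as the two standard generators (\<open>card_isometry_group_frames\<close>). If the form is
  diagonal, \<open>u x^2 + w p^e y^2\<close>, then \<open>g\<close> is a point of the conic \<open>u x^2 + w p^e y^2 = u\<close>, and for each \<open>g\<close> the
  admissible \<open>h\<close> are the multiples \<open>t g\<^sup>\<bottom>\<close> of one orthogonal vector with \<open>t^2 = 1\<close>. The order is therefore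
  the number of square roots of \<open>1\<close> times the number of points of a conic
  (\<open>card_isometry_group_diagonal\<close>). For odd \<open>p\<close> the form can always be diagonalized. The conic is
  counted by the slopes of the lines through \<open>(-1, 0)\<close> if \<open>e = 0\<close>, which gives \<open>p^(k-1) (p - \<chi>(-uw))\<close> points,
  and has \<open>2 p^k\<close> points if \<open>e > 0\<close>. This is the local factor at \<open>p\<close>, because \<open>-uw\<close> is \<open>\<epsilon>\<^sub>p\<close> up to a square.

  For \<open>p = 2\<close> the form can be diagonalized if \<open>e > 0\<close> or if one of \<open>a\<close>, \<open>c\<close> is odd. Coordinates then matter
  modulo \<open>2^(k+e)\<close> and \<open>2^k\<close>, but values modulo one further power of \<open>2\<close>. This leaves only
  one admissible \<open>t\<close> for \<open>k = 1\<close> and two for \<open>k > 1\<close>, which is why \<open>n/2\<close> replaces \<open>n\<close> in the exponent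
  of \<open>2\<close>; the constant \<open>C\<close> comes from the number of points on the conic (\<open>card_conic_two\<close>,
  \<open>card_binary_degenerate_two\<close>). In the remaining case \<open>e = 0\<close> and \<open>a\<close>, \<open>c\<close> are even. If \<open>k > 0\<close>, the form is
  then \<open>U\<close> or \<open>V\<close>, according to whether \<open>\<epsilon>\<^sub>2\<close> is \<open>1\<close> or \<open>5\<close> modulo \<open>8\<close>, with \<open>2^k\<close> hyperbolic pairs in the first case
  and \<open>3 * 2^k\<close> frames of the norm form of the Eisenstein integers in the second.

  The case distinction is intrinsic: the exponents \<open>k\<close>, \<open>e\<close> are read off from the group
  (\<open>quad_isomorphic_binary_orders\<close>), and diagonal forms differ from \<open>U\<close> and \<open>V\<close> in the
  parity of the numerators of their values (\<open>quad_isomorphic_parity\<close>). So the type of \<open>D\<^sub>2\<close> is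
  determined by the parities of \<open>r\<close>, \<open>a\<close>, \<open>c\<close>. The same parities decide the type of \<open>M\<close>: if \<open>L \<simeq> M(2^j)\<close> and \<open>M\<close> is
  odd or has odd determinant, then \<open>2^j\<close> is forced to be the exact power of \<open>2\<close> dividing \<open>n\<close>
  (\<open>rescaled_lattice_parity\<close>).
\<close>

section \<open>Quadratic congruences modulo prime powers\<close>

text \<open>Writing \<open>t = s D + (t mod D)\<close>, the quotient \<open>s\<close> takes \<open>q\<close> values, independently of the remainder.\<close>
lemma card_residue_predicate:
  fixes D q :: int
  assumes "D > 0" "q \<ge> 0"
  shows "card {t\<in>{0..<D*q}. P (t mod D)} = nat q * card {t\<in>{0..<D}. P t}"
proof -
  have "bij_betw (\<lambda>(s,t). s * D + t) ({0..<q} \<times> {t\<in>{0..<D}. P t}) {t\<in>{0..<D*q}. P (t mod D)}"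
  proof (rule bij_betw_byWitness[where f' = "\<lambda>t. (t div D, t mod D)"])
    show "(\<lambda>(s,t). s * D + t) ` ({0..<q} \<times> {t\<in>{0..<D}. P t}) \<subseteq> {t\<in>{0..<D*q}. P (t mod D)}"
    proof clarify
      fix s t assume h: "s \<in> {0..<q}" "t \<in> {0..<D}" "P t"
      have "s * D + t < s * D + D" using h by simp
      also have "\<dots> = (s + 1) * D" by (simp add: algebra_simps)
      also have "\<dots> \<le> q * D" using h assms by (intro mult_right_mono) auto
      finally show "s * D + t \<in> {0..<D * q} \<and> P ((s * D + t) mod D)"
        using h assms by (auto simp: mult.commute)
    qed
    show "(\<lambda>t. (t div D, t mod D)) ` {t\<in>{0..<D*q}. P (t mod D)} \<subseteq> {0..<q} \<times> {t\<in>{0..<D}. P t}"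
    proof clarify
      fix t assume h: "t \<in> {0..<D*q}" "P (t mod D)"
      have "t div D < q"
      proof (rule ccontr)
        assume "\<not> t div D < q"
        then have "D * q \<le> D * (t div D)" using assms by simp
        also have "\<dots> \<le> t" using assms by (metis le_add_same_cancel1 mult_div_mod_eq pos_mod_sign)
        finally show False using h by simp
      qed
      then show "(t div D \<in> {0..<q}) \<and> t mod D \<in> {t \<in> {0..<D}. P t}"
        using h assms by (auto simp: pos_imp_zdiv_nonneg_iff)
    qed
  qed (use assms in auto)
  then have "card {t\<in>{0..<D*q}. P (t mod D)} = card ({0..<q} \<times> {t\<in>{0..<D}. P t})"
    by (rule bij_betw_same_card[symmetric])
  then show ?thesis by (simp add: card_cartesian_product)
qed

lemma coprime_prime_power:
  fixes p a :: int
  assumes "prime p" "\<not> p dvd a"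
  shows "coprime a (p ^ k)"
proof -
  have "coprime p a" using assms by (rule prime_imp_coprime)
  then show ?thesis by (simp add: coprime_commute)
qed

lemma odd_prime_not_dvd_double:
  fixes p x :: int
  assumes "prime p" "odd p" "\<not> p dvd x"
  shows "\<not> p dvd 2 * x"
proof
  assume "p dvd 2 * x"
  then have "p dvd 2" using assms(1,3) prime_dvd_multD by blast
  then have "p \<le> 2" by (rule zdvd_imp_le) simp
  moreover have "p \<ge> 2" using assms(1) by (rule prime_ge_2_int)
  ultimately show False using assms(2) by simp
qed

lemma ex1_residue:
  fixes N :: int
  assumes "N > 0" "\<exists>t. P t" "\<And>t s. P t \<Longrightarrow> P s \<Longrightarrow> [t = s] (mod N)"
    "\<And>t s. P t \<Longrightarrow> [t = s] (mod N) \<Longrightarrow> P s"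
  shows "\<exists>!t. t \<in> {0..<N} \<and> P t"
proof -
  obtain t where "P t" using assms by blast
  then have "P (t mod N)" using assms(4)[of t "t mod N"] by (simp add: cong_def)
  show ?thesis
  proof (rule ex1I[of _ "t mod N"])
    show "t mod N \<in> {0..<N} \<and> P (t mod N)" using assms(1) \<open>P (t mod N)\<close> by simp
    fix s assume "s \<in> {0..<N} \<and> P s"
    then have s: "s mod N = s" and "[t = s] (mod N)" using assms(3)[OF \<open>P t\<close>] by simp_all
    then show "s = t mod N" unfolding cong_def by simp
  qed
qed

lemma card_ex1: "\<exists>!t. t \<in> A \<and> P t \<Longrightarrow> card {t\<in>A. P t} = 1"
proof -
  assume "\<exists>!t. t \<in> A \<and> P t"
  then obtain t where "{t\<in>A. P t} = {t}" by blast
  then show ?thesis by simp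
qed

text \<open>This and the next lemma are the form of Hensel's lemma behind all square roots below. The difference of two values
  is \<open>(t - s) (A (t + s) + B)\<close>, and the second factor is a unit because \<open>p\<close> divides \<open>A\<close> but not \<open>B\<close>.\<close>
lemma quadratic_cong_inj:
  fixes p A B :: int
  assumes p: "prime p" and A: "p dvd A" and B: "\<not> p dvd B"
    and eq: "[A * t^2 + B * t = A * s^2 + B * s] (mod p ^ k)"
  shows "[t = s] (mod p ^ k)"
proof -
  have "p ^ k dvd (t - s) * (A * (t + s) + B)"
    using eq by (simp add: cong_iff_dvd_diff algebra_simps power2_eq_square)
  moreover have "\<not> p dvd A * (t + s) + B"
    using A B by (meson dvd_add_right_iff dvd_mult2)
  then have "coprime (p ^ k) (A * (t + s) + B)"
    using coprime_prime_power[OF p] coprime_commute by blast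
  ultimately show ?thesis
    by (simp add: coprime_dvd_mult_left_iff cong_iff_dvd_diff)
qed

text \<open>An injective map of the finite set of residues to itself is surjective.\<close>
lemma quadratic_cong_solvable:
  fixes p A B c :: int
  assumes p: "prime p" and A: "p dvd A" and B: "\<not> p dvd B"
  shows "\<exists>t. [A * t^2 + B * t = c] (mod p ^ k)"
proof -
  let ?N = "p ^ k"
  let ?f = "\<lambda>t. (A * t^2 + B * t) mod ?N"
  have N: "?N > 0" using p by (simp add: prime_gt_0_int)
  have "inj_on ?f {0..<?N}"
  proof (rule inj_onI)
    fix t s assume "t \<in> {0..<?N}" "s \<in> {0..<?N}" "?f t = ?f s"
    then show "t = s"
      using quadratic_cong_inj[OF p A B, of t s k] by (auto simp: cong_def)
  qed
  moreover have "?f ` {0..<?N} \<subseteq> {0..<?N}" using N by auto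
  ultimately have "?f ` {0..<?N} = {0..<?N}"
    by (simp add: endo_inj_surj)
  moreover have "c mod ?N \<in> {0..<?N}" using N by auto
  ultimately have "c mod ?N \<in> ?f ` {0..<?N}" by simp
  then show ?thesis by (auto simp: cong_def)
qed

lemma quadratic_cong_card:
  fixes p A B c :: int
  assumes p: "prime p" and A: "p dvd A" and B: "\<not> p dvd B"
  shows "card {t\<in>{0..<p^k}. [A * t^2 + B * t = c] (mod p ^ k)} = 1"
proof (rule card_ex1, rule ex1_residue)
  show "p ^ k > 0" using p by (simp add: prime_gt_0_int)
  show "\<exists>t. [A * t^2 + B * t = c] (mod p ^ k)" by (rule quadratic_cong_solvable[OF assms])
next
  fix t s assume t: "[A * t^2 + B * t = c] (mod p ^ k)" and s: "[A * s^2 + B * s = c] (mod p ^ k)"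
  show "[t = s] (mod p ^ k)" by (rule quadratic_cong_inj[OF p A B cong_trans[OF t cong_sym[OF s]]])
next
  fix t s assume t: "[A * t^2 + B * t = c] (mod p ^ k)" and ts: "[t = s] (mod p ^ k)"
  have "[A * t^2 + B * t = A * s^2 + B * s] (mod p ^ k)"
    by (rule cong_add[OF cong_mult[OF cong_refl cong_pow[OF ts]] cong_mult[OF cong_refl ts]])
  then show "[A * s^2 + B * s = c] (mod p ^ k)" using t by (metis cong_sym cong_trans)
qed

text \<open>For \<open>x = x0 + p t\<close> and \<open>c = x0^2 + p e\<close> the congruence \<open>x^2 = c\<close> becomes \<open>p t^2 + 2 x0 t = e\<close> modulo
  \<open>p^(k-1)\<close>, with a unit as linear coefficient.\<close>
lemma sqrt_lift_odd:
  fixes p c x0 :: int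
  assumes p: "prime p" "odd p" and k: "k \<ge> 1" and x0: "\<not> p dvd x0" "[x0^2 = c] (mod p)"
  shows "\<exists>x. [x = x0] (mod p) \<and> [x^2 = c] (mod p ^ k)"
proof -
  obtain e where e: "c - x0^2 = p * e" using x0(2) by (metis cong_iff_dvd_diff cong_sym dvdE)
  obtain j where j: "k = Suc j" using k by (cases k) auto
  have "\<not> p dvd 2 * x0"
    using p x0 by (intro odd_prime_not_dvd_double)
  then obtain t where t: "[p * t^2 + (2 * x0) * t = e] (mod p ^ j)"
    using quadratic_cong_solvable[OF p(1), of p "2*x0" e j] by auto
  have "(x0 + p * t)^2 - c = p * ((p * t^2 + (2 * x0) * t) - e)"
    using e by (simp add: algebra_simps power2_eq_square)
  then have "p ^ k dvd (x0 + p * t)^2 - c"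
    using t j by (simp add: cong_iff_dvd_diff)
  then have "[(x0 + p * t)^2 = c] (mod p ^ k)" by (simp add: cong_iff_dvd_diff)
  moreover have "[x0 + p * t = x0] (mod p)" by (simp add: cong_iff_dvd_diff)
  ultimately show ?thesis by blast
qed

text \<open>A prime dividing both \<open>x - y\<close> and \<open>x + y\<close> would divide \<open>2 x\<close>, so one of these two factors of \<open>x^2 - y^2\<close> is a unit.\<close>
lemma sqrt_cong_odd:
  fixes p x y :: int
  assumes p: "prime p" "odd p" and x: "\<not> p dvd x" and eq: "[x^2 = y^2] (mod p ^ k)" and k: "k \<ge> 1"
  shows "[x = y] (mod p ^ k) \<or> [x = - y] (mod p ^ k)"
proof -
  have "p ^ k dvd (x - y) * (x + y)" using eq
    by (simp add: cong_iff_dvd_diff algebra_simps power2_eq_square)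
  moreover have "\<not> p dvd x - y \<or> \<not> p dvd x + y"
  proof (rule ccontr)
    assume "\<not> ?thesis"
    then have "p dvd x - y" "p dvd x + y" by blast+
    then have "p dvd (x - y) + (x + y)" by (rule dvd_add)
    then have "p dvd 2 * x" by simp
    then show False using p x odd_prime_not_dvd_double by blast
  qed
  ultimately show ?thesis
  proof (elim disjE)
    assume "p ^ k dvd (x - y) * (x + y)" "\<not> p dvd x - y"
    then have "p ^ k dvd x + y"
      using coprime_prime_power[OF p(1), of "x - y" k] coprime_dvd_mult_right_iff coprime_commute by blast
    then show ?thesis by (simp add: cong_iff_dvd_diff)
  next
    assume "p ^ k dvd (x - y) * (x + y)" "\<not> p dvd x + y"
    then have "p ^ k dvd x - y"
      using coprime_prime_power[OF p(1), of "x + y" k] coprime_dvd_mult_left_iff coprime_commute by blast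
    then show ?thesis by (simp add: cong_iff_dvd_diff)
  qed
qed

lemma card_plus_minus:
  fixes N y :: int
  assumes "N > 0" "\<not> N dvd 2 * y" "\<And>x. P x \<longleftrightarrow> [x = y] (mod N) \<or> [x = - y] (mod N)"
  shows "card {x\<in>{0..<N}. P x} = 2"
proof -
  have "{x\<in>{0..<N}. P x} = {y mod N, (- y) mod N}"
    using assms(1) by (auto simp: assms(3) cong_def)
  moreover have "y mod N \<noteq> (- y) mod N"
    using assms(2) by (metis mod_eq_dvd_iff diff_minus_eq_add mult_2)
  ultimately show ?thesis by simp
qed

lemma card_sqrt_odd:
  fixes p c :: int
  assumes p: "prime p" "odd p" and k: "k \<ge> 1" and c: "[c = x0^2] (mod p)" "\<not> p dvd x0"
  shows "card {y\<in>{0..<p^k}. [y^2 = c] (mod p^k)} = 2"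
proof -
  obtain x where x: "[x = x0] (mod p)" "[x^2 = c] (mod p ^ k)"
    using sqrt_lift_odd[OF p k c(2)] c(1) cong_sym by blast
  have px: "\<not> p dvd x" using x(1) c(2) cong_dvd_iff by blast
  show ?thesis
  proof (rule card_plus_minus)
    show "p ^ k > 0" using p by (simp add: prime_gt_0_int)
    have "\<not> p dvd 2 * x"
      using p px by (intro odd_prime_not_dvd_double)
    moreover have "p dvd p ^ k" using k by (simp add: dvd_power)
    ultimately show "\<not> p ^ k dvd 2 * x" using dvd_trans by blast
    fix y
    show "[y^2 = c] (mod p^k) \<longleftrightarrow> [y = x] (mod p^k) \<or> [y = - x] (mod p^k)"
    proof
      assume "[y^2 = c] (mod p^k)"
      then have "[x^2 = y^2] (mod p^k)" using cong_trans[OF x(2) cong_sym] by blast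
      then have "[x = y] (mod p^k) \<or> [x = - y] (mod p^k)" using sqrt_cong_odd[OF p px _ k] by blast
      then show "[y = x] (mod p^k) \<or> [y = - x] (mod p^k)"
        by (auto simp: cong_iff_dvd_diff dvd_diff_commute add.commute)
    next
      assume "[y = x] (mod p^k) \<or> [y = - x] (mod p^k)"
      then have "[y^2 = x^2] (mod p^k)" using cong_pow[of y x "p^k" 2] cong_pow[of y "-x" "p^k" 2] by auto
      then show "[y^2 = c] (mod p^k)" using x(2) by (rule cong_trans)
    qed
  qed
qed

text \<open>For a quadratic form modulo \<open>2\<close> the coordinates are residues modulo \<open>2^l\<close> and the values residues
  modulo \<open>2^(l+1)\<close>. Of the four square roots modulo \<open>2^(l+1)\<close>, two survive the reduction modulo \<open>2^l\<close>. Existence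
  follows from the substitution \<open>y = 1 + 4 t\<close>, which turns \<open>y^2 = c\<close> into a congruence \<open>2 t^2 + t = e\<close>.\<close>
lemma card_sqrt_two:
  fixes c :: int
  assumes "l \<ge> 2" "[c = 1] (mod 8)"
  shows "card {y\<in>{0..<2^l}. [y^2 = c] (mod 2^(l+1))} = 2"
proof -
  obtain j where j: "l = Suc (Suc j)" using assms(1) by (metis add_2_eq_Suc le_Suc_ex)
  obtain e where e: "c - 1 = 8 * e" using assms(2) by (metis cong_iff_dvd_diff dvdE)
  obtain t where t: "[2 * t^2 + 1 * t = e] (mod 2 ^ j)"
    using quadratic_cong_solvable[of 2 2 1 e j] by auto
  define y where "y = 1 + 4 * t"
  have "y^2 - c = 8 * ((2 * t^2 + 1 * t) - e)"
    using e by (simp add: y_def algebra_simps power2_eq_square)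
  moreover have "8 * 2^j dvd 8 * ((2 * t^2 + 1 * t) - e)"
    using t unfolding cong_iff_dvd_diff by (rule mult_dvd_mono[OF dvd_refl])
  ultimately have yc: "[y^2 = c] (mod 2^(l+1))" using j by (simp add: cong_iff_dvd_diff)
  have oy: "odd y" by (simp add: y_def)
  show ?thesis
  proof (rule card_plus_minus)
    have "\<not> 2 * (2 * 2 ^ j) dvd 2 * y" using oy by (metis dvd_mult_cancel_left dvd_triv_left dvd_trans zero_neq_numeral)
    then show "\<not> 2 ^ l dvd 2 * y" using j by simp
    fix x
    show "[x^2 = c] (mod 2^(l+1)) \<longleftrightarrow> [x = y] (mod 2^l) \<or> [x = - y] (mod 2^l)"
    proof
      assume "[x^2 = c] (mod 2^(l+1))"
      then have "[x^2 = y^2] (mod 2^(l+1))" using cong_sym[OF yc] by (rule cong_trans)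
      then have "2^(l+1) dvd x^2 - y^2" unfolding cong_iff_dvd_diff .
      then have d: "2^(l+1) dvd (x - y) * (x + y)" by (simp add: algebra_simps power2_eq_square)
      have "(2::int) dvd 2^(l+1)" by simp
      then have "even ((x - y) * (x + y))" using d dvd_trans by blast
      then have "even (x - y)" by auto
      then obtain a where "x - y = 2 * a" by (rule dvdE)
      then have a: "x = y + 2 * a" by simp
      \<comment> \<open>exactly one of a and y + a is odd, so the power of 2 divides the other one\<close>
      have "(x - y) * (x + y) = 4 * (a * (y + a))" using a by (simp add: algebra_simps)
      then have "4 * (2::int)^Suc j dvd 4 * (a * (y + a))" using d j by simp
      then have d2: "(2::int)^Suc j dvd a * (y + a)" unfolding dvd_mult_cancel_left by simp
      show "[x = y] (mod 2^l) \<or> [x = - y] (mod 2^l)"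
      proof (cases "even a")
        case True
        then have "coprime (2^Suc j) (y + a)" using oy by simp
        then have "2^Suc j dvd a" using d2 coprime_dvd_mult_left_iff by blast
        then have "2 * 2^Suc j dvd 2 * a" by (rule mult_dvd_mono[OF dvd_refl])
        then show ?thesis using a j by (simp add: cong_iff_dvd_diff)
      next
        case False
        then have "coprime (2^Suc j) a" by simp
        then have "2^Suc j dvd y + a" using d2 coprime_dvd_mult_right_iff by blast
        then have "2 * 2^Suc j dvd 2 * (y + a)" by (rule mult_dvd_mono[OF dvd_refl])
        then show ?thesis using a j by (simp add: cong_iff_dvd_diff algebra_simps)
      qed
    next
      assume "[x = y] (mod 2^l) \<or> [x = - y] (mod 2^l)"
      then have "\<exists>z. z^2 = y^2 \<and> [x = z] (mod 2^l)"
        by (elim disjE) (rule exI[of _ y], simp, rule exI[of _ "- y"], simp)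
      then obtain z where z0: "z^2 = y^2" "[x = z] (mod 2^l)" by blast
      then obtain a where "x - z = 2^l * a" by (auto simp: cong_iff_dvd_diff)
      then have z: "z^2 = y^2" "x = z + 2^l * a" using z0 by simp_all
      have "x^2 - y^2 = 2^(l+1) * (z * a) + 2^l * 2^l * a^2"
        using z by (simp add: algebra_simps power2_eq_square)
      also have "\<dots> = 2^(l+1) * (z * a + 2^(Suc j) * a^2)" using j by (simp add: algebra_simps)
      finally have "[x^2 = y^2] (mod 2^(l+1))" by (simp add: cong_iff_dvd_diff)
      then show "[x^2 = c] (mod 2^(l+1))" using yc by (rule cong_trans)
    qed
  qed simp
qed

section \<open>Points of a conic modulo an odd prime power\<close>

lemma card_pairs_by_snd:
  assumes "finite X" "finite Y"
  shows "card {(x,y)\<in>X\<times>Y. P x y} = (\<Sum>y\<in>Y. card {x\<in>X. P x y})"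
proof -
  have "{(x,y)\<in>X\<times>Y. P x y} = prod.swap ` (SIGMA y:Y. {x\<in>X. P x y})" by force
  then have "card {(x,y)\<in>X\<times>Y. P x y} = card (SIGMA y:Y. {x\<in>X. P x y})"
    by (simp add: card_image)
  then show ?thesis using assms by simp
qed

lemma card_pairs_by_fst:
  assumes "finite X" "finite Y"
  shows "card {(x,y)\<in>X\<times>Y. P x y} = (\<Sum>x\<in>X. card {y\<in>Y. P x y})"
proof -
  have "{(x,y)\<in>X\<times>Y. P x y} = (SIGMA x:X. {y\<in>Y. P x y})" by force
  then show ?thesis using assms by simp
qed

lemma cong_replace_left:
  fixes a b c N :: int
  assumes "[a = b] (mod N)"
  shows "[a = c] (mod N) \<longleftrightarrow> [b = c] (mod N)"
  using assms by (simp add: cong_def)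

lemma prime_power_inverse_ex:
  fixes p u :: int
  assumes "prime p" "\<not> p dvd u"
  shows "\<exists>v. [u * v = 1] (mod p ^ k)"
  using cong_solve_coprime_int[OF coprime_prime_power[OF assms]] .

lemma cong_divide_unit:
  fixes u v :: int
  assumes "[u * v = 1] (mod N)"
  shows "[u * a = b] (mod N) \<longleftrightarrow> [a = v * b] (mod N)"
proof
  assume h: "[u * a = b] (mod N)"
  have "[1 * a = u * v * a] (mod N)" by (rule cong_mult[OF cong_sym[OF assms] cong_refl])
  moreover have "[v * (u * a) = v * b] (mod N)" by (rule cong_mult[OF cong_refl h])
  ultimately show "[a = v * b] (mod N)" by (simp add: cong_def mult.commute mult.left_commute)
next
  assume h: "[a = v * b] (mod N)"
  have "[u * v * b = 1 * b] (mod N)" by (rule cong_mult[OF assms cong_refl])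
  moreover have "[u * a = u * (v * b)] (mod N)" by (rule cong_mult[OF cong_refl h])
  ultimately show "[u * a = b] (mod N)" by (simp add: cong_def mult.assoc)
qed

lemma card_square_roots_of_one_odd:
  fixes p :: int
  assumes p: "prime p" "odd p"
  shows "card {t\<in>{0..<p^k}. [t^2 = 1] (mod p^k)} = (if k = 0 then 1 else 2)"
proof (cases "k = 0")
  case True
  then have "{t\<in>{0..<p^k}. [t^2 = 1] (mod p^k)} = {0}" by auto
  then show ?thesis using True by simp
next
  case False
  moreover have "\<not> p dvd 1" using p(1) not_prime_unit by blast
  ultimately show ?thesis using card_sqrt_odd[OF p, of k 1 1] by simp
qed

text \<open>The exceptional value at \<open>k = 1\<close> is the reason for \<open>n/2\<close> in place of \<open>n\<close> in the order formulas for the odd types.\<close>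
lemma card_square_roots_of_one_two:
  assumes "k \<ge> 1"
  shows "card {t\<in>{0..<2^k::int}. [t^2 = 1] (mod 2*2^k)} = (if k = 1 then 1 else 2)"
proof (cases "k = 1")
  case True
  have "{t\<in>{0..<2^k::int}. [t^2 = 1] (mod 2*2^k)} = {1}"
  proof -
    have "t = 0 \<or> t = 1" if "t \<in> {0..<2^k}" for t :: int using that True by auto
    moreover have "[(1::int)^2 = 1] (mod 2*2^k)" "\<not> [(0::int)^2 = 1] (mod 2*2^k)"
      using True by (simp_all add: cong_def)
    ultimately show ?thesis using True by force
  qed
  then show ?thesis using True by simp
next
  case False
  then show ?thesis using card_sqrt_two[of k 1] assms by simp
qed

text \<open>The second term is divisible by \<open>p\<close>, so every \<open>y\<close> is admissible and leaves a square root of a square unit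
  to choose for \<open>x\<close>.\<close>
lemma card_binary_degenerate_odd:
  fixes p u w :: int
  assumes p: "prime p" "odd p" and kl: "k < l" and u: "\<not> p dvd u"
  shows "card {(x,y)\<in>{0..<p^l}\<times>{0..<p^k}. [u * x^2 + w * p^(l-k) * y^2 = u] (mod p^l)} = 2 * nat (p^k)"
proof -
  obtain v where v: "[u * v = 1] (mod p^l)"
    using prime_power_inverse_ex[OF p(1) u] by blast
  have "card {x\<in>{0..<p^l}. [u * x^2 + w * p^(l-k) * y^2 = u] (mod p^l)} = 2" for y
  proof -
    have "[u * x^2 + w * p^(l-k) * y^2 = u] (mod p^l) \<longleftrightarrow> [x^2 = v * (u - w * p^(l-k) * y^2)] (mod p^l)" for x
    proof -
      have "[u * x^2 + w * p^(l-k) * y^2 = u] (mod p^l) \<longleftrightarrow> [u * x^2 = u - w * p^(l-k) * y^2] (mod p^l)"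
        by (simp add: cong_iff_dvd_diff algebra_simps)
      then show ?thesis using cong_divide_unit[OF v] by simp
    qed
    moreover have "[v * (u - w * p^(l-k) * y^2) = 1^2] (mod p)"
    proof -
      have "p dvd p^(l-k)" "p dvd p^l" using kl by (auto simp: dvd_power)
      then have "p dvd (u * v - 1) - v * w * y^2 * p^(l-k)"
        using v by (meson cong_iff_dvd_diff dvd_diff dvd_mult dvd_trans)
      then show ?thesis by (simp add: cong_iff_dvd_diff algebra_simps)
    qed
    moreover have "\<not> p dvd 1" using p(1) not_prime_unit by blast
    moreover have "1 \<le> l" using kl by simp
    ultimately show ?thesis
      using card_sqrt_odd[OF p, of l "v * (u - w * p^(l-k) * y^2)" 1] by presburger
  qed
  note fib = this
  have "card {(x,y)\<in>{0..<p^l}\<times>{0..<p^k}. [u * x^2 + w * p^(l-k) * y^2 = u] (mod p^l)}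
    = (\<Sum>y\<in>{0..<p^k}. card {x\<in>{0..<p^l}. [u * x^2 + w * p^(l-k) * y^2 = u] (mod p^l)})"
    by (rule card_pairs_by_snd) simp_all
  also have "\<dots> = (\<Sum>y\<in>{0..<p^k}. 2)" by (intro sum.cong refl fib)
  finally show ?thesis by simp
qed

text \<open>Multiplying the congruence by \<open>a\<close> shows that it asks for a square root of \<open>a b\<close>.\<close>
lemma card_quadratic_roots_mod_prime:
  fixes p a b :: int
  assumes p: "prime p" "odd p" and a: "\<not> p dvd a"
  shows "int (card {t\<in>{0..<p}. [a * t^2 = b] (mod p)}) = 1 + Legendre (a * b) p"
proof -
  obtain c where c: "[a * c = 1] (mod p)"
    using prime_power_inverse_ex[OF p(1) a, of 1] by auto
  have p0: "p > 0" using p by (simp add: prime_gt_0_int)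
  have eq: "[a * t^2 = b] (mod p) \<longleftrightarrow> [(a * t)^2 = a * b] (mod p)" for t
  proof -
    have "(a * t)^2 - a * b = a * (a * t^2 - b)" by (simp add: algebra_simps power2_eq_square)
    then show ?thesis using prime_dvd_mult_iff[OF p(1), of a "a * t^2 - b"] a by (simp add: cong_iff_dvd_diff)
  qed
  show ?thesis
  proof (cases "p dvd b")
    case True
    have "[a * t^2 = b] (mod p) \<longleftrightarrow> p dvd t" for t
    proof -
      have "[a * t^2 = b] (mod p) \<longleftrightarrow> p dvd a * t^2"
        using True by (simp add: cong_iff_dvd_diff dvd_diff_left_iff)
      then show ?thesis using a p(1) by (simp add: prime_dvd_mult_iff prime_dvd_power_iff)
    qed
    then have "{t\<in>{0..<p}. [a * t^2 = b] (mod p)} = {t\<in>{0..<p}. p dvd t}" by simp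
    also have "\<dots> = {0}" using p0 by (auto simp: dvd_eq_mod_eq_0)
    finally have "{t\<in>{0..<p}. [a * t^2 = b] (mod p)} = {0}" .
    moreover have "Legendre (a * b) p = 0" using True by (simp add: Legendre_def cong_0_iff)
    ultimately show ?thesis by simp
  next
    case False
    have ab: "\<not> p dvd a * b" using a False p(1) by (simp add: prime_dvd_mult_iff)
    show ?thesis
    proof (cases "QuadRes p (a * b)")
      case True
      then obtain y where y: "[y^2 = a * b] (mod p)" by (auto simp: QuadRes_def)
      define s where "s = c * y"
      have "[a * s = 1 * y] (mod p)" unfolding s_def mult.assoc[symmetric] by (rule cong_mult[OF c cong_refl])
      then have "[(a * s)^2 = (1 * y)^2] (mod p)" by (rule cong_pow)
      then have "[(a * s)^2 = a * b] (mod p)" using cong_trans[OF _ y] by simp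
      then have s: "[a * s^2 = b] (mod p)" using eq by simp
      then have ps: "\<not> p dvd s" using False
        using cong_dvd_iff[OF s] by (auto simp: power2_eq_square)
      have "card {t\<in>{0..<p}. [a * t^2 = b] (mod p)} = 2"
      proof (rule card_plus_minus[OF p0])
        show "\<not> p dvd 2 * s" using odd_prime_not_dvd_double[OF p ps] .
        fix t
        have "[a * t^2 = b] (mod p) \<longleftrightarrow> [a * t^2 = a * s^2] (mod p)"
          by (metis cong_replace_left[OF s] cong_sym_eq)
        also have "\<dots> \<longleftrightarrow> p dvd a * ((t - s) * (t + s))"
          by (simp add: cong_iff_dvd_diff algebra_simps power2_eq_square)
        also have "\<dots> \<longleftrightarrow> [t = s] (mod p) \<or> [t = - s] (mod p)"
          using a p(1) by (simp add: prime_dvd_mult_iff cong_iff_dvd_diff)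
        finally show "[a * t^2 = b] (mod p) \<longleftrightarrow> [t = s] (mod p) \<or> [t = - s] (mod p)" .
      qed
      then show ?thesis using True ab by (simp add: Legendre_def cong_0_iff)
    next
      case F: False
      then have "{t\<in>{0..<p}. [a * t^2 = b] (mod p)} = {}" by (auto simp: eq QuadRes_def)
      then have "card {t\<in>{0..<p}. [a * t^2 = b] (mod p)} = 0" by (simp only: card.empty)
      then show ?thesis using F ab by (simp only: Legendre_def cong_0_iff) simp
    qed
  qed
qed

text \<open>The shape of the congruence is that of \<open>(u + w t^2) (1 + x) = 2 u\<close>, which links a point of the conic to its slope.\<close>
lemma unit_factor_of_cong_two:
  fixes p :: int
  assumes p: "prime p" "odd p" and k: "k \<ge> 1" and u: "\<not> p dvd u"
    and h: "[A * z = 2 * u] (mod p^k)"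
  shows "\<not> p dvd A" "\<not> p dvd z"
proof -
  have "p dvd p ^ k" using k by (simp add: dvd_power)
  then have "[A * z = 2 * u] (mod p)" using h cong_dvd_modulus by blast
  then have "\<not> p dvd A * z" using odd_prime_not_dvd_double[OF p u] cong_dvd_iff by blast
  then show "\<not> p dvd A" "\<not> p dvd z" by auto
qed

text \<open>The line of slope \<open>t\<close> through the point \<open>(-1, 0)\<close> meets the conic in one further point, namely the
  solution of \<open>(u + w t^2) (1 + x) = 2 u\<close>. It exists if \<open>u + w t^2\<close> is a unit, and then \<open>1 + x\<close> is a unit too.\<close>
lemma card_conic_points_away:
  fixes p u w :: int
  assumes p: "prime p" "odd p" and k: "k \<ge> 1" and u: "\<not> p dvd u"
  shows "card {(x,y)\<in>{0..<p^k}\<times>{0..<p^k}. [u * x^2 + w * y^2 = u] (mod p^k) \<and> \<not> p dvd 1 + x}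
    = card {t\<in>{0..<p^k}. \<not> p dvd u + w * t^2}" (is "card ?S = card ?T")
proof -
  let ?N = "p^k"
  have N: "?N > 0" using p by (simp add: prime_gt_0_int)
  have pN: "p dvd ?N" using k by (simp add: dvd_power)
  define R where "R = (\<lambda>(x,y) t. t \<in> {0..<?N} \<and> [t * (1 + x) = y] (mod ?N))"
  have slope: "\<exists>!t. R z t" if zS: "z \<in> ?S" for z
  proof -
    obtain x y where z: "z = (x,y)" "\<not> p dvd 1 + x" using zS by auto
    obtain b where b: "[(1 + x) * b = 1] (mod ?N)"
      using prime_power_inverse_ex[OF p(1) z(2)] by blast
    have iff: "[t * (1 + x) = y] (mod ?N) \<longleftrightarrow> [t = b * y] (mod ?N)" for t
      using cong_divide_unit[OF b] by (simp add: mult.commute)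
    show ?thesis unfolding R_def z(1) case_prod_conv iff
      by (rule ex1_residue[OF N]) (auto simp: cong_def)
  qed
  have key: "[(u + w * t^2) * (1 + x) = 2 * u] (mod ?N)" if "(x,y) \<in> ?S" "R (x,y) t" for x y t
  proof -
    have xy: "[u * x^2 + w * y^2 = u] (mod ?N)" "\<not> p dvd 1 + x" and t: "[t * (1 + x) = y] (mod ?N)"
      using that by (auto simp: R_def)
    have "[w * (t * (1 + x))^2 = w * y^2] (mod ?N)" by (rule cong_mult[OF cong_refl cong_pow[OF t]])
    moreover have "(1 + x) * ((u + w * t^2) * (1 + x) - 2 * u) = 
      (w * (t * (1 + x))^2 - w * y^2) + (u * x^2 + w * y^2 - u)"
      by (simp add: algebra_simps power2_eq_square)
    ultimately have "?N dvd (1 + x) * ((u + w * t^2) * (1 + x) - 2 * u)"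
      using xy(1) unfolding cong_iff_dvd_diff by (simp only: dvd_add)
    then show ?thesis
      using coprime_prime_power[OF p(1) xy(2), of k] coprime_dvd_mult_right_iff coprime_commute
      unfolding cong_iff_dvd_diff by blast
  qed
  define f where "f = (\<lambda>z. THE t. R z t)"
  have f: "R z (f z)" if "z \<in> ?S" for z unfolding f_def by (rule theI'[OF slope[OF that]])
  have "bij_betw f ?S ?T"
  proof (rule bij_betw_imageI)
    show "inj_on f ?S"
    proof (rule inj_onI)
      fix z z' assume zz: "z \<in> ?S" "z' \<in> ?S" "f z = f z'"
      obtain x y x' y' where xy: "z = (x,y)" "z' = (x',y')" by (metis surj_pair)
      define t where "t = f z"
      have Rt: "R (x,y) t" "R (x',y') t" using f[OF zz(1)] f[OF zz(2)] zz(3) xy t_def by simp_all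
      have in1: "(x,y) \<in> ?S" "(x',y') \<in> ?S" using zz xy by auto
      note k1 = key[OF in1(1) Rt(1)] and k2 = key[OF in1(2) Rt(2)]
      have "?N dvd (u + w * t^2) * (x - x')"
        using cong_trans[OF k1 cong_sym[OF k2]] by (simp add: cong_iff_dvd_diff algebra_simps)
      moreover have "coprime (u + w * t^2) ?N"
        using unit_factor_of_cong_two(1)[OF p k u k1] coprime_prime_power[OF p(1)] by blast
      ultimately have "?N dvd x - x'" using coprime_dvd_mult_right_iff coprime_commute by blast
      then have "x mod ?N = x' mod ?N" by (simp add: mod_eq_dvd_iff)
      then have x: "x = x'" using in1 by simp
      have "[y = y'] (mod ?N)" using Rt x by (simp add: R_def cong_def)
      then have "y = y'" using in1 by (simp add: cong_def)
      then show "z = z'" using x xy by simp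
    qed
    show "f ` ?S = ?T"
    proof
      show "f ` ?S \<subseteq> ?T"
      proof
        fix t assume "t \<in> f ` ?S"
        then obtain x y where "(x,y) \<in> ?S" "t = f (x,y)" by auto
        then show "t \<in> ?T" using f[of "(x,y)"] unit_factor_of_cong_two(1)[OF p k u key] by (auto simp: R_def)
      qed
      show "?T \<subseteq> f ` ?S"
      proof
        fix t assume t: "t \<in> ?T"
        then obtain b where b: "[(u + w * t^2) * b = 1] (mod ?N)"
          using prime_power_inverse_ex[OF p(1), of "u + w * t^2" k] by blast
        \<comment> \<open>the point on the line of slope t other than (-1, 0)\<close>
        define x where "x = (b * (2 * u) - 1) mod ?N"
        define y where "y = (t * (1 + x)) mod ?N"
        have "[1 + x = b * (2 * u)] (mod ?N)" unfolding x_def cong_def by (simp add: mod_simps)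
        then have k1: "[(u + w * t^2) * (1 + x) = 2 * u] (mod ?N)" using cong_divide_unit[OF b] by simp
        have ux: "\<not> p dvd 1 + x" using unit_factor_of_cong_two(2)[OF p k u k1] .
        have ty: "[t * (1 + x) = y] (mod ?N)" by (simp add: y_def cong_def)
        have a: "[w * (t * (1 + x))^2 = w * y^2] (mod ?N)" by (rule cong_mult[OF cong_refl cong_pow[OF ty]])
        have "u * x^2 + w * y^2 - u = (1 + x) * ((u + w * t^2) * (1 + x) - 2 * u) - (w * (t * (1 + x))^2 - w * y^2)"
          by (simp add: algebra_simps power2_eq_square)
        then have "[u * x^2 + w * y^2 = u] (mod ?N)"
          using k1 a unfolding cong_iff_dvd_diff by (simp only: dvd_diff dvd_mult)
        then have S: "(x,y) \<in> ?S" using ux N by (simp add: x_def y_def)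
        have "R (x,y) t" using t ty by (simp add: R_def)
        then have "f (x,y) = t" using slope[OF S] f[OF S] by blast
        then show "t \<in> f ` ?S" by (intro image_eqI[OF _ S]) simp
      qed
    qed
  qed
  then show ?thesis by (rule bij_betw_same_card)
qed

lemma dvd_residue_invariant:
  fixes p :: int
  shows "p dvd u + w * (t mod p)^2 \<longleftrightarrow> p dvd u + w * t^2"
proof -
  have "[t mod p = t] (mod p)" by (simp add: cong_def)
  then have "[u + w * (t mod p)^2 = u + w * t^2] (mod p)"
    by (intro cong_add[OF cong_refl cong_mult[OF cong_refl cong_pow]])
  then show ?thesis by (rule cong_dvd_iff)
qed

text \<open>Among the \<open>p\<close> slopes modulo \<open>p\<close>, the excluded ones are the roots of \<open>w t^2 = - u\<close>.\<close>
lemma card_unit_slopes: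
  fixes p u w :: int
  assumes p: "prime p" "odd p" and k: "k \<ge> 1" and w: "\<not> p dvd w"
  shows "int (card {t\<in>{0..<p^k}. \<not> p dvd u + w * t^2}) = p^(k-1) * (p - 1 - Legendre (- (u * w)) p)"
proof -
  have p0: "p > 0" using p by (simp add: prime_gt_0_int)
  have N: "p^k = p * p^(k-1)" using k by (cases k) auto
  have "card {t\<in>{0..<p^k}. \<not> p dvd u + w * t^2} = card {t\<in>{0..<p*p^(k-1)}. \<not> p dvd u + w * (t mod p)^2}"
    unfolding N dvd_residue_invariant ..
  then have 1: "card {t\<in>{0..<p^k}. \<not> p dvd u + w * t^2} = nat (p^(k-1)) * card {t\<in>{0..<p}. \<not> p dvd u + w * t^2}"
    using card_residue_predicate[of p "p^(k-1)" "\<lambda>t. \<not> p dvd u + w * t^2"] p0 by simp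
  let ?R = "{t\<in>{0..<p}. [w * t^2 = - u] (mod p)}"
  have sub: "?R \<subseteq> {0..<p}" by blast
  have eq1: "{t\<in>{0..<p}. \<not> p dvd u + w * t^2} = {0..<p} - ?R"
    by (auto simp: cong_iff_dvd_diff add.commute)
  have eq2: "card ({0..<p} - ?R) = card {0..<p} - card ?R"
    by (rule card_Diff_subset[OF finite_subset[OF sub] sub]) simp
  have "card ?R \<le> card {0..<p}" by (rule card_mono[OF _ sub]) simp
  then have "int (card {t\<in>{0..<p}. \<not> p dvd u + w * t^2}) = int (card {0..<p}) - int (card ?R)"
    unfolding eq1 eq2 by (rule of_nat_diff)
  then have "int (card {t\<in>{0..<p}. \<not> p dvd u + w * t^2}) = p - int (card ?R)"
    using p0 by (simp only: card_atLeastLessThan_int)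
  then have 2: "int (card {t\<in>{0..<p}. \<not> p dvd u + w * t^2}) = p - 1 - Legendre (- (u * w)) p"
    unfolding card_quadratic_roots_mod_prime[OF p w, of "- u"] by (simp add: mult.commute[of w])
  show ?thesis unfolding 1 of_nat_mult 2 using p0 by simp
qed

text \<open>Modulo \<open>p\<close> such a point is \<open>(-1, 0)\<close>. Conversely any \<open>y\<close> divisible by \<open>p\<close> determines \<open>x\<close> as the
  square root of \<open>1 - w y^2 / u\<close> congruent to \<open>-1\<close>, so that \<open>y\<close> runs through \<open>p^(k-1)\<close> residues.\<close>
lemma card_conic_points_near:
  fixes p u w :: int
  assumes p: "prime p" "odd p" and k: "k \<ge> 1" and u: "\<not> p dvd u" and w: "\<not> p dvd w"
  shows "card {(x,y)\<in>{0..<p^k}\<times>{0..<p^k}. [u * x^2 + w * y^2 = u] (mod p^k) \<and> p dvd 1 + x} = nat (p^(k-1))"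
proof -
  let ?N = "p^k" and ?X = "{0..<p^k}"
  let ?P = "\<lambda>x y. [u * x^2 + w * y^2 = u] (mod ?N)"
  have p0: "p > 0" using p by (simp add: prime_gt_0_int)
  have N: "?N = p * p^(k-1)" using k by (cases k) auto
  have pN: "p dvd ?N" unfolding N by simp
  have p1: "\<not> p dvd 1" using p(1) not_prime_unit by blast
  obtain v where v: "[u * v = 1] (mod p^k)" using prime_power_inverse_ex[OF p(1) u] by blast
  have fib: "card {x\<in>?X. ?P x y \<and> p dvd 1 + x} = (if p dvd y then 1 else 0)" for y
  proof (cases "p dvd y")
    case True
    have iff: "?P x y \<longleftrightarrow> [x^2 = v * (u - w * y^2)] (mod ?N)" for x
    proof -
      have "?P x y \<longleftrightarrow> [u * x^2 = u - w * y^2] (mod ?N)"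
        by (simp add: cong_iff_dvd_diff algebra_simps)
      then show ?thesis using cong_divide_unit[OF v] by simp
    qed
    have "p dvd u * v - 1" using v pN dvd_trans unfolding cong_iff_dvd_diff by blast
    moreover have "p dvd v * w * y * y" using True by simp
    ultimately have "p dvd (u * v - 1) - v * w * y * y" by (rule dvd_diff)
    then have "[v * (u - w * y^2) = (-1)^2] (mod p)"
      by (simp add: cong_iff_dvd_diff algebra_simps power2_eq_square)
    then have "[(-1)^2 = v * (u - w * y^2)] (mod p)" by (rule cong_sym)
    moreover have "\<not> p dvd -1" using p1 by simp
    ultimately obtain x where x: "[x = -1] (mod p)" "[x^2 = v * (u - w * y^2)] (mod ?N)"
      using sqrt_lift_odd[OF p k] by blast
    have "\<exists>!x. x \<in> ?X \<and> (?P x y \<and> p dvd 1 + x)"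
    proof (rule ex1_residue)
      show "?N > 0" using p0 by simp
      show "\<exists>x. ?P x y \<and> p dvd 1 + x" unfolding iff using x by (auto simp: cong_iff_dvd_diff add.commute)
    next
      fix s t assume s: "?P s y \<and> p dvd 1 + s" and t: "?P t y \<and> p dvd 1 + t"
      have ps: "\<not> p dvd s" using s p1 dvd_add_left_iff by blast
      have "[s^2 = t^2] (mod ?N)" using s t unfolding iff by (simp add: cong_def)
      moreover have "\<not> [s = - t] (mod ?N)"
      proof
        assume "[s = - t] (mod ?N)"
        then have "?N dvd s + t" by (simp add: cong_iff_dvd_diff)
        then have "p dvd s + t" using pN dvd_trans by blast
        moreover have "p dvd (1 + s) + (1 + t)" using s t dvd_add[of p "1 + s" "1 + t"] by blast
        ultimately have "p dvd ((1 + s) + (1 + t)) - (s + t)" by (rule dvd_diff[rotated])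
        then have "p dvd 2 * 1" by simp
        then show False using odd_prime_not_dvd_double[OF p p1] by blast
      qed
      ultimately show "[s = t] (mod ?N)" using sqrt_cong_odd[OF p ps _ k] by blast
    next
      fix s t assume s: "?P s y \<and> p dvd 1 + s" and st: "[s = t] (mod ?N)"
      have "[s^2 = t^2] (mod ?N)" by (rule cong_pow[OF st])
      then have "?P t y" using s unfolding iff by (simp add: cong_def)
      moreover have "[1 + s = 1 + t] (mod p)"
        using cong_dvd_modulus[OF st pN] by (rule cong_add[OF cong_refl])
      ultimately show "?P t y \<and> p dvd 1 + t" using s cong_dvd_iff by blast
    qed
    from card_ex1[OF this] show ?thesis using True by simp
  next
    case False
    have "\<not> ?P x y" if px: "p dvd 1 + x" for x
    proof
      assume "?P x y"
      then have "p dvd u * x^2 + w * y^2 - u" using pN dvd_trans unfolding cong_iff_dvd_diff by blast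
      moreover have "u * x^2 + w * y^2 - u = w * y^2 + (1 + x) * (u * (x - 1))"
        by (simp add: algebra_simps power2_eq_square)
      moreover have "p dvd (1 + x) * (u * (x - 1))" using px by simp
      ultimately have "p dvd w * y^2" using dvd_add_left_iff by metis
      then show False using False w p(1) by (simp add: prime_dvd_mult_iff prime_dvd_power_iff)
    qed
    then have "{x\<in>?X. ?P x y \<and> p dvd 1 + x} = {}" by blast
    then show ?thesis using False by (simp only: card.empty if_False)
  qed
  have "card {(x,y)\<in>?X\<times>?X. ?P x y \<and> p dvd 1 + x} = (\<Sum>y\<in>?X. card {x\<in>?X. ?P x y \<and> p dvd 1 + x})"
    by (rule card_pairs_by_snd) simp_all
  also have "\<dots> = card {y\<in>?X. p dvd y}" unfolding fib by (simp add: sum.If_cases Int_def)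
  also have "{y\<in>?X. p dvd y} = {y\<in>{0..<p*p^(k-1)}. y mod p = 0}" unfolding N by (simp add: dvd_eq_mod_eq_0)
  also have "card \<dots> = nat (p^(k-1)) * card {y\<in>{0..<p}. y = 0}"
    using card_residue_predicate[of p "p^(k-1)" "\<lambda>t. t = 0"] p0 by simp
  also have "{y\<in>{0..<p}. y = 0} = {0}" using p0 by auto
  finally show ?thesis by simp
qed

lemma card_conic_odd:
  fixes p u w :: int
  assumes p: "prime p" "odd p" and k: "k \<ge> 1" and u: "\<not> p dvd u" and w: "\<not> p dvd w"
  shows "int (card {(x,y)\<in>{0..<p^k}\<times>{0..<p^k}. [u * x^2 + w * y^2 = u] (mod p^k)})
    = p^(k-1) * (p - Legendre (- (u * w)) p)"
proof -
  let ?S = "\<lambda>Q. {(x,y)\<in>{0..<p^k}\<times>{0..<p^k}. [u * x^2 + w * y^2 = u] (mod p^k) \<and> Q (p dvd 1 + x)}"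
  have p0: "p > 0" using p by (simp add: prime_gt_0_int)
  have fin: "finite (?S Q)" for Q by (rule finite_subset[of _ "{0..<p^k}\<times>{0..<p^k}"]) auto
  have "{(x,y)\<in>{0..<p^k}\<times>{0..<p^k}. [u * x^2 + w * y^2 = u] (mod p^k)} = ?S Not \<union> ?S (\<lambda>b. b)"
    by blast
  moreover have "card (?S Not \<union> ?S (\<lambda>b. b)) = card (?S Not) + card (?S (\<lambda>b. b))"
    by (rule card_Un_disjoint[OF fin fin]) blast
  ultimately have "int (card {(x,y)\<in>{0..<p^k}\<times>{0..<p^k}. [u * x^2 + w * y^2 = u] (mod p^k)}) =
      int (card (?S Not)) + int (card (?S (\<lambda>b. b)))" by (simp only: of_nat_add)
  also have "\<dots> = p^(k-1) * (p - 1 - Legendre (- (u * w)) p) + p^(k-1)"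
    unfolding card_conic_points_away[OF p k u] card_unit_slopes[OF p k w] card_conic_points_near[OF p k u w]
    using p0 by simp
  finally show ?thesis by (simp add: algebra_simps)
qed

section \<open>Conics, hyperbolic pairs and Eisenstein pairs modulo a power of two\<close>

lemma card_residues_dvd:
  fixes D :: int
  assumes "D > 0" "q \<ge> 0" "s \<in> {0..<D}"
  shows "card {t\<in>{0..<D*q}. t mod D = s} = nat q"
proof -
  have "{t\<in>{0..<D}. t = s} = {s}" using assms by auto
  then show ?thesis using card_residue_predicate[OF assms(1,2), of "\<lambda>t. t = s"] by simp
qed

lemma card_even_residues:
  assumes "k \<ge> 1"
  shows "card {y\<in>{0..<2^k::int}. even y} = 2^(k-1)"
    and "card {y\<in>{0..<2^k::int}. odd y} = 2^(k-1)"
proof -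
  have N: "(2::int)^k = 2 * 2^(k-1)" using assms by (cases k) auto
  have e: "{y\<in>{0..<2^k::int}. even y} = {t\<in>{0..<2*2^(k-1)}. t mod 2 = 0}"
    unfolding N by (simp add: even_iff_mod_2_eq_zero)
  have o: "{y\<in>{0..<2^k::int}. odd y} = {t\<in>{0..<2*2^(k-1)}. t mod 2 = 1}"
    unfolding N by (simp add: odd_iff_mod_2_eq_one)
  show "card {y\<in>{0..<2^k::int}. even y} = 2^(k-1)"
    unfolding e using card_residues_dvd[of 2 "2^(k-1)" 0] by (simp add: nat_power_eq)
  show "card {y\<in>{0..<2^k::int}. odd y} = 2^(k-1)"
    unfolding o using card_residues_dvd[of 2 "2^(k-1)" 1] by (simp add: nat_power_eq)
qed

lemma odd_square_cong_one: "odd (x::int) \<Longrightarrow> [x^2 = 1] (mod 8)"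
proof -
  assume "odd x"
  then obtain t where t: "x = 2 * t + 1" by (rule oddE)
  have "even (t * (t + 1))" by simp
  then obtain s where s: "t * (t + 1) = 2 * s" by (rule evenE)
  have "x^2 - 1 = 4 * (t * (t + 1))" by (simp add: t power2_eq_square algebra_simps)
  also have "\<dots> = 8 * s" unfolding s by simp
  finally show ?thesis by (simp add: cong_iff_dvd_diff)
qed

text \<open>Any solution \<open>x\<close> is odd, so \<open>x^2 = 1\<close> modulo \<open>8\<close> and \<open>8\<close> has to divide \<open>c\<close>. If it does, the congruence
  asks for the square root of a number congruent to \<open>1\<close> modulo \<open>8\<close>.\<close>
lemma card_shifted_square_two:
  fixes u c :: int
  assumes u: "odd u" and c: "even c" and l: "l \<ge> 2"
  shows "card {x\<in>{0..<2^l}. [u * x^2 + c = u] (mod 2 * 2^l)} = (if 8 dvd c then 2 else 0)"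
proof -
  have e8: "(8::int) dvd 2 * 2^l"
  proof -
    obtain j where "l = Suc (Suc j)" using l by (metis add_2_eq_Suc le_Suc_ex)
    then show ?thesis by simp
  qed
  obtain v where v: "[u * v = 1] (mod 2^(l+1))" using prime_power_inverse_ex[of 2 u "l+1"] u by auto
  have iff: "[u * x^2 + c = u] (mod 2 * 2^l) \<longleftrightarrow> [x^2 = v * (u - c)] (mod 2^(l+1))" for x
  proof -
    have "[u * x^2 + c = u] (mod 2 * 2^l) \<longleftrightarrow> [u * x^2 = u - c] (mod 2^(l+1))"
      by (simp add: cong_iff_dvd_diff algebra_simps)
    then show ?thesis using cong_divide_unit[OF v] by simp
  qed
  show ?thesis
  proof (cases "8 dvd c")
    case True
    have "8 dvd u * v - 1" using v e8 dvd_trans unfolding cong_iff_dvd_diff by fastforce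
    moreover have "8 dvd v * c" using True by simp
    ultimately have "8 dvd (u * v - 1) - v * c" by (rule dvd_diff)
    then have "[v * (u - c) = 1] (mod 8)" by (simp add: cong_iff_dvd_diff algebra_simps)
    then show ?thesis unfolding iff using card_sqrt_two[OF l] True by simp
  next
    case False
    have "\<not> [u * x^2 + c = u] (mod 2 * 2^l)" for x
    proof
      assume h: "[u * x^2 + c = u] (mod 2 * 2^l)"
      then have h8: "8 dvd u * x^2 + c - u" using e8 dvd_trans unfolding cong_iff_dvd_diff by blast
      then have "even (u * x^2 + c - u)" by (metis dvd_trans even_numeral)
      then have "odd x" using u c by auto
      then have "8 dvd u * (x^2 - 1)" using odd_square_cong_one by (simp add: cong_iff_dvd_diff)
      then have "8 dvd (u * x^2 + c - u) - u * (x^2 - 1)" using h8 dvd_diff by blast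
      then show False using False by (simp add: algebra_simps)
    qed
    then have "{x\<in>{0..<2^l}. [u * x^2 + c = u] (mod 2 * 2^l)} = {}" by blast
    then show ?thesis using False by (simp only: card.empty if_False)
  qed
qed

lemma sum_if_const_card:
  "finite A \<Longrightarrow> (\<Sum>y\<in>A. if Q y then c else 0) = (c::nat) * card {y\<in>A. Q y}"
  by (simp add: sum.If_cases Int_def)

text \<open>For fixed \<open>y\<close> a solution \<open>x\<close> exists iff \<open>8\<close> divides \<open>2^r y^2\<close>. For \<open>r \<ge> 3\<close> this holds for all \<open>y\<close>, and for
  \<open>r = 1, 2\<close> for even \<open>y\<close> only. This is the origin of the constant \<open>C\<close> in the case of even determinant.\<close>
lemma card_binary_degenerate_two:
  fixes u w :: int
  assumes u: "odd u" and w: "odd w" and k: "k \<ge> 1" and r: "r \<ge> 1"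
  shows "card {(x,y)\<in>{0..<2^(k+r)}\<times>{0..<2^k}. [u * x^2 + w * 2^r * y^2 = u] (mod 2 * 2^(k+r))}
    = (if r \<ge> 3 then 2 * 2^k else 2^k)"
proof -
  have "card {(x,y)\<in>{0..<2^(k+r)}\<times>{0..<2^k}. [u * x^2 + w * 2^r * y^2 = u] (mod 2 * 2^(k+r))}
    = (\<Sum>y\<in>{0..<2^k}. card {x\<in>{0..<2^(k+r)}. [u * x^2 + w * 2^r * y^2 = u] (mod 2 * 2^(k+r))})"
    by (rule card_pairs_by_snd) simp_all
  also have "\<dots> = (\<Sum>y\<in>{0..<2^k}. if 8 dvd w * 2^r * y^2 then 2 else 0)"
    by (intro sum.cong refl card_shifted_square_two[OF u]) (use r k in auto)
  also have "\<dots> = 2 * card {y\<in>{0..<2^k}. 8 dvd w * 2^r * y^2}"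
    by (rule sum_if_const_card) simp
  also have "\<dots> = (if r \<ge> 3 then 2 * 2^k else 2^k)"
  proof (cases "r \<ge> 3")
    case True
    then obtain j where "r = 3 + j" using le_Suc_ex by blast
    then have "(8::int) dvd 2^r" by (simp add: power_add)
    then have "{y\<in>{0..<2^k}. 8 dvd w * 2^r * y^2} = {0..<2^k}" by auto
    then show ?thesis using True by (simp add: nat_power_eq)
  next
    case False
    then have r12: "r = 1 \<or> r = 2" using r by auto
    have "8 dvd w * 2^r * y^2 \<longleftrightarrow> even y" for y
    proof
      assume h: "8 dvd w * 2^r * y^2"
      show "even y"
      proof (rule ccontr)
        assume "odd y"
        then have o: "odd (w * y^2)" using w by simp
        have "8 dvd 2^r * (w * y^2)" using h by (simp add: mult.left_commute mult.commute)
        moreover have "2^r dvd (4::int)" using r12 by auto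
        then obtain z where z: "4 = 2^r * (z::int)" by (rule dvdE)
        ultimately have "8 dvd z * (2^r * (w * y^2))" by simp
        moreover have "z * (2^r * (w * y^2)) = 4 * (w * y^2)" unfolding z by (simp only: mult_ac)
        ultimately have "4 * 2 dvd 4 * (w * y^2)" by simp
        then have "2 dvd w * y^2" unfolding dvd_mult_cancel_left by simp
        then show False using o by blast
      qed
    next
      assume "even y"
      then obtain z where "y = 2 * z" by (rule evenE)
      then have "w * 2^r * y^2 = 8 * (w * 2^(r-1) * z^2)" using r by (cases r) (simp_all add: power2_eq_square)
      then show "8 dvd w * 2^r * y^2" by (simp only: dvd_triv_left)
    qed
    then show ?thesis using False card_even_residues(1)[OF k] k by (cases k) simp_all
  qed
  finally show ?thesis .
qed

text \<open>Exactly one of \<open>x\<close>, \<open>y\<close> is odd. Let \<open>k \<ge> 2\<close>. The points with \<open>x\<close> odd always exist, and need \<open>y\<close> divisible by \<open>4\<close>. Those with \<open>y\<close> odd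
  need \<open>w - u + u x^2\<close> divisible by \<open>8\<close> with \<open>x\<close> even, hence \<open>u = w\<close> modulo \<open>4\<close>. This is the origin of the constant \<open>C\<close>
  in the case of odd determinant.\<close>
lemma card_conic_two:
  fixes u w :: int
  assumes u: "odd u" and w: "odd w" and k: "k \<ge> 1"
  shows "card {(x,y)\<in>{0..<2^k}\<times>{0..<2^k}. [u * x^2 + w * y^2 = u] (mod 2 * 2^k)}
    = 2^(k-1) * (if [u = w] (mod 4) then 2 else 1)"
proof (cases "k = 1")
  case True
  have X: "{0..<2^k} = {0,1::int}" using True by auto
  have p10: "[u * 1^2 + w * 0^2 = u] (mod 2 * 2^k)" by simp
  have p00: "\<not> [u * 0^2 + w * 0^2 = u] (mod 2 * 2^k)"
    using u True by (simp add: cong_iff_dvd_diff) presburger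
  have p11: "\<not> [u * 1^2 + w * 1^2 = u] (mod 2 * 2^k)"
    using w True by (simp add: cong_iff_dvd_diff) presburger
  have p01: "[u * 0^2 + w * 1^2 = u] (mod 2 * 2^k) \<longleftrightarrow> [u = w] (mod 4)"
    using True by (simp add: cong_sym_eq)
  have "{(x,y)\<in>{0..<2^k}\<times>{0..<2^k}. [u * x^2 + w * y^2 = u] (mod 2 * 2^k)}
    = insert (1,0) (if [u = w] (mod 4) then {(0,1)} else {})"
    unfolding X using p10 p00 p11 p01 by (auto split: if_splits)
  then show ?thesis using True by simp
next
  case False
  then have k2: "k \<ge> 2" using k by simp
  let ?X = "{0..<2^k::int}"
  let ?P = "\<lambda>x y. [u * x^2 + w * y^2 = u] (mod 2 * 2^k)"
  obtain j where j: "k = Suc (Suc j)" using k2 by (metis add_2_eq_Suc le_Suc_ex)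
  have N: "(2::int)^k = 4 * 2^(k-2)" and N': "2 * 2^(k-2) = (2::nat)^(k-1)" using j by simp_all
  have c4: "card {y\<in>?X. y mod 4 = s} = 2^(k-2)" if "s \<in> {0..<4}" for s
    unfolding N using card_residues_dvd[of 4 "2^(k-2)" s] that by (simp add: nat_power_eq)
  have fin: "finite {(x,y)\<in>?X\<times>?X. Q x y}" for Q
    by (rule finite_subset[of _ "?X\<times>?X"]) auto
  \<comment> \<open>x is odd: the residue of y modulo 4 is 0, and there are two choices of x for each y\<close>
  have A: "card {(x,y)\<in>?X\<times>?X. ?P x y \<and> even y} = 2^(k-1)"
  proof -
    have "card {(x,y)\<in>?X\<times>?X. ?P x y \<and> even y} = (\<Sum>y\<in>?X. card {x\<in>?X. ?P x y \<and> even y})"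
      by (rule card_pairs_by_snd) simp_all
    also have "\<dots> = (\<Sum>y\<in>?X. if y mod 4 = 0 then 2 else 0)"
    proof (intro sum.cong refl)
      fix y :: int
      show "card {x\<in>?X. ?P x y \<and> even y} = (if y mod 4 = 0 then 2 else 0)"
      proof (cases "even y")
        case True
        then obtain z where z: "y = 2 * z" by (rule evenE)
        have "8 dvd w * y^2 \<longleftrightarrow> 4 * 2 dvd 4 * (w * z^2)" using z by (simp add: power2_eq_square mult.left_commute)
        also have "\<dots> \<longleftrightarrow> even z" unfolding dvd_mult_cancel_left using w by simp
        also have "\<dots> \<longleftrightarrow> y mod 4 = 0" using z by presburger
        finally show ?thesis using card_shifted_square_two[OF u, of "w * y^2" k] True k2 by simp
      next
        case False
        then have "y mod 4 \<noteq> 0" by presburger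
        then show ?thesis using False by simp
      qed
    qed
    also have "\<dots> = 2 * card {y\<in>?X. y mod 4 = 0}" by (rule sum_if_const_card) simp
    also have "\<dots> = 2 * 2^(k-2)" using c4[of 0] by simp
    also have "\<dots> = 2^(k-1)" by (rule N')
    finally show ?thesis .
  qed
  \<comment> \<open>y is odd: x is even, with one residue modulo 4 if the congruence modulo 4 holds, and two choices of y for each x\<close>
  have B: "card {(x,y)\<in>?X\<times>?X. ?P x y \<and> odd y} = (if [u = w] (mod 4) then 2^(k-1) else 0)"
  proof -
    have "card {(x,y)\<in>?X\<times>?X. ?P x y \<and> odd y} = (\<Sum>x\<in>?X. card {y\<in>?X. ?P x y \<and> odd y})"
      by (rule card_pairs_by_fst) simp_all
    also have "\<dots> = (\<Sum>x\<in>?X. if even x \<and> 8 dvd u * x^2 - u + w then 2 else 0)"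
    proof (intro sum.cong refl)
      fix x :: int
      have par: "even x \<longleftrightarrow> odd y" if "?P x y" for y
      proof -
        have "2 dvd u * x^2 + w * y^2 - u" using that unfolding cong_iff_dvd_diff
          by (rule dvd_trans[rotated]) simp
        then show ?thesis using u w by auto
      qed
      show "card {y\<in>?X. ?P x y \<and> odd y} = (if even x \<and> 8 dvd u * x^2 - u + w then 2 else 0)"
      proof (cases "even x")
        case True
        have "{y\<in>?X. ?P x y \<and> odd y} = {y\<in>?X. ?P x y}" using par True by blast
        also have "\<dots> = {y\<in>?X. [w * y^2 + (u * x^2 - u + w) = w] (mod 2 * 2^k)}"
          by (simp add: cong_iff_dvd_diff algebra_simps)
        also have "card \<dots> = (if 8 dvd u * x^2 - u + w then 2 else 0)"
          by (rule card_shifted_square_two[OF w _ k2]) (use u w True in simp)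
        finally show ?thesis using True by simp
      next
        case False
        then have "{y\<in>?X. ?P x y \<and> odd y} = {}" using par by blast
        then show ?thesis using False by (simp only: card.empty) simp
      qed
    qed
    also have "\<dots> = 2 * card {x\<in>?X. even x \<and> 8 dvd u * x^2 - u + w}" by (rule sum_if_const_card) simp
    also have "\<dots> = (if [u = w] (mod 4) then 2^(k-1) else 0)"
    proof -
      have key: "8 dvd u * (2 * z)^2 - u + w \<longleftrightarrow> 8 dvd w - u + 4 * z^2" for z
      proof -
        obtain u' where "u = 2 * u' + 1" using u by (rule oddE)
        then have "u * (2 * z)^2 - u + w = (w - u + 4 * z^2) + 8 * (u' * z^2)"
          by (simp add: power2_eq_square algebra_simps)
        moreover have "8 dvd 8 * (u' * z^2)" by simp
        ultimately show ?thesis using dvd_add_left_iff by metis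
      qed
      show ?thesis
      proof (cases "[u = w] (mod 4)")
        case True
        then obtain g where g: "w - u = 4 * g" by (metis cong_iff_dvd_diff cong_sym dvdE)
        define s where "s = 2 * (g mod 2)"
        have "even x \<and> 8 dvd u * x^2 - u + w \<longleftrightarrow> x mod 4 = s" for x
        proof (cases "even x")
          case True
          then obtain z where z: "x = 2 * z" by (rule evenE)
          have "8 dvd u * x^2 - u + w \<longleftrightarrow> 4 * 2 dvd 4 * (g + z^2)" unfolding z key g by (simp add: algebra_simps)
          also have "\<dots> \<longleftrightarrow> even (g + z)" unfolding dvd_mult_cancel_left by simp
          also have "\<dots> \<longleftrightarrow> x mod 4 = s" unfolding z s_def by presburger
          finally show ?thesis using True by simp
        next
          case False
          then show ?thesis unfolding s_def by presburger
        qed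
        moreover have "s \<in> {0..<4}" unfolding s_def by auto
        ultimately have "2 * card {x\<in>?X. even x \<and> 8 dvd u * x^2 - u + w} = 2 * 2^(k-2)" using c4[of s] by simp
        also have "\<dots> = 2^(k-1)" by (rule N')
        finally show ?thesis using True by simp
      next
        case False
        have "\<not> (even x \<and> 8 dvd u * x^2 - u + w)" for x
        proof
          assume h: "even x \<and> 8 dvd u * x^2 - u + w"
          then obtain z where z: "x = 2 * z" by blast
          then have "8 dvd w - u + 4 * z^2" using h key by blast
          then have "4 dvd w - u + 4 * z^2" by (rule dvd_trans[rotated]) simp
          moreover have "4 dvd 4 * z^2" by simp
          ultimately have "4 dvd w - u" using dvd_add_left_iff by blast
          then show False using False by (simp add: cong_iff_dvd_diff dvd_diff_commute)
        qed
        then have "{x\<in>?X. even x \<and> 8 dvd u * x^2 - u + w} = {}" by blast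
        then show ?thesis using False by (simp only: card.empty) simp
      qed
    qed
    finally show ?thesis .
  qed
  have "{(x,y)\<in>?X\<times>?X. ?P x y} = {(x,y)\<in>?X\<times>?X. ?P x y \<and> even y} \<union> {(x,y)\<in>?X\<times>?X. ?P x y \<and> odd y}"
    by blast
  moreover have "card ({(x,y)\<in>?X\<times>?X. ?P x y \<and> even y} \<union> {(x,y)\<in>?X\<times>?X. ?P x y \<and> odd y})
    = card {(x,y)\<in>?X\<times>?X. ?P x y \<and> even y} + card {(x,y)\<in>?X\<times>?X. ?P x y \<and> odd y}"
    by (rule card_Un_disjoint[OF fin fin]) blast
  ultimately have "card {(x,y)\<in>?X\<times>?X. ?P x y} = 2^(k-1) + (if [u = w] (mod 4) then 2^(k-1) else 0)"
    unfolding A B by simp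
  then show ?thesis by simp
qed

lemma card_Sigma_const_fibre:
  assumes "finite A" "finite B" "\<And>g. g \<in> A \<Longrightarrow> card {h\<in>B. R g h} = (if Q g then c else 0)"
  shows "card {(g,h)\<in>A\<times>B. R g h} = c * card {g\<in>A. Q g}"
proof -
  have "card {(g,h)\<in>A\<times>B. R g h} = (\<Sum>g\<in>A. card {h\<in>B. R g h})"
    by (rule card_pairs_by_fst[OF assms(1,2)])
  also have "\<dots> = (\<Sum>g\<in>A. if Q g then c else 0)" by (intro sum.cong refl assms(3))
  finally show ?thesis by (simp only: sum_if_const_card[OF assms(1)])
qed

text \<open>Since \<open>\<int>/2^k\<close> is local, the first vector of a hyperbolic pair has a unit as one coordinate, and then the other coordinate is
  zero because the vector is isotropic. The same holds for the second vector with the coordinates exchanged, so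
  the pair is \<open>(u, 0), (0, 1/u)\<close> or \<open>(0, u), (1/u, 0)\<close> for a unit \<open>u\<close>.\<close>
lemma card_hyperbolic_pairs:
  assumes k: "k \<ge> 1"
  defines "X \<equiv> {0..<2^k::int}"
  shows "card {(g,h)\<in>(X\<times>X)\<times>(X\<times>X). [fst g * snd g = 0] (mod 2^k) \<and> [fst h * snd h = 0] (mod 2^k) \<and>
      [fst g * snd h + snd g * fst h = 1] (mod 2^k)} = 2^k"
proof -
  let ?Z = "\<lambda>g::int\<times>int. [fst g * snd g = 0] (mod 2^k)"
  let ?B = "\<lambda>g h::int\<times>int. [fst g * snd h + snd g * fst h = 1] (mod 2^k)"
  let ?N = "(2::int)^k"
  have fX: "finite X" by (simp add: X_def)
  have N1: "?N > 1" using k by simp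
  have even_N: "(2::int) dvd ?N" using k by simp
  have zero: "z = 0" if "z \<in> X" "odd y" "[y * z = 0] (mod ?N)" for y z :: int
  proof -
    have "?N dvd y * z" using that(3) by (simp add: cong_0_iff)
    moreover have "coprime ?N y" using that(2) by simp
    ultimately have "?N dvd z" using coprime_dvd_mult_right_iff by blast
    then show ?thesis using that(1) unfolding X_def by (auto simp: dvd_eq_mod_eq_0)
  qed
  have unit: "odd (fst g * snd h + snd g * fst h)" if "?B g h" for g h :: "int\<times>int"
  proof -
    have "2 dvd fst g * snd h + snd g * fst h - 1" using that even_N dvd_trans unfolding cong_iff_dvd_diff by blast
    then show ?thesis by simp
  qed
  have inv: "card {z\<in>X. [y * z = 1] (mod ?N)} = 1" if "odd y" for y
  proof (unfold X_def, rule card_ex1, rule ex1_residue)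
    show "?N > 0" by simp
    have "coprime y ?N" using that by simp
    then show "\<exists>t. [y * t = 1] (mod ?N)" using cong_solve_coprime_int by blast
    fix t s assume "[y * t = 1] (mod ?N)" "[y * s = 1] (mod ?N)"
    then have "[y * t = y * s] (mod ?N)" by (simp add: cong_def)
    then show "[t = s] (mod ?N)" using cong_mult_lcancel[of y ?N t s] that by simp
  next
    fix t s assume "[y * t = 1] (mod ?N)" and ts: "[t = s] (mod ?N)"
    moreover have "[y * t = y * s] (mod ?N)" by (rule cong_mult[OF cong_refl ts])
    ultimately show "[y * s = 1] (mod ?N)" by (simp add: cong_def)
  qed
  have fib: "card {h\<in>X\<times>X. ?Z g \<and> ?Z h \<and> ?B g h} = (if (odd (fst g) \<and> snd g = 0) \<or> (odd (snd g) \<and> fst g = 0) then 1 else 0)"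
    if "g \<in> X\<times>X" for g
  proof -
    obtain x y where g: "g = (x,y)" "x \<in> X" "y \<in> X" using \<open>g \<in> X\<times>X\<close> by blast
    have 0: "0 \<in> X" using N1 by (simp add: X_def)
    consider (a) "odd x" "y = 0" | (b) "odd y" "x = 0" | (c) "\<not> ((odd x \<and> y = 0) \<or> (odd y \<and> x = 0))" by blast
    then show ?thesis
    proof cases
      case a
      have "{h\<in>X\<times>X. ?Z g \<and> ?Z h \<and> ?B g h} = (\<lambda>z. (0, z)) ` {z\<in>X. [x * z = 1] (mod ?N)}"
      proof (intro equalityI subsetI)
        fix h assume h: "h \<in> {h\<in>X\<times>X. ?Z g \<and> ?Z h \<and> ?B g h}"
        obtain z w where hzw: "h = (z,w)" "z \<in> X" "w \<in> X" using h by blast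
        have "odd w" using unit[of g h] h a g hzw by auto
        then have "z = 0" using zero[of z w] h hzw by (simp add: mult.commute)
        then show "h \<in> (\<lambda>z. (0, z)) ` {z\<in>X. [x * z = 1] (mod ?N)}" using h hzw a g by auto
      qed (use a g 0 in auto)
      then show ?thesis using inv[OF a(1)] a g by (simp add: card_image inj_on_def)
    next
      case b
      have "{h\<in>X\<times>X. ?Z g \<and> ?Z h \<and> ?B g h} = (\<lambda>z. (z, 0)) ` {z\<in>X. [y * z = 1] (mod ?N)}"
      proof (intro equalityI subsetI)
        fix h assume h: "h \<in> {h\<in>X\<times>X. ?Z g \<and> ?Z h \<and> ?B g h}"
        obtain z w where hzw: "h = (z,w)" "z \<in> X" "w \<in> X" using h by blast
        have "odd z" using unit[of g h] h b g hzw by auto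
        then have "w = 0" using zero[of w z] h hzw by simp
        then show "h \<in> (\<lambda>z. (z, 0)) ` {z\<in>X. [y * z = 1] (mod ?N)}" using h hzw b g by auto
      qed (use b g 0 in auto)
      then show ?thesis using inv[OF b(1)] b g by (simp add: card_image inj_on_def)
    next
      case c
      have "False" if h: "h \<in> {h\<in>X\<times>X. ?Z g \<and> ?Z h \<and> ?B g h}" for h
      proof -
        have "odd x \<or> odd y" using unit[of g h] h g by auto
        moreover have "[x * y = 0] (mod ?N)" using h g by simp
        ultimately show False using c zero[OF g(3), of x] zero[OF g(2), of y] by (metis mult.commute)
      qed
      then have "{h\<in>X\<times>X. ?Z g \<and> ?Z h \<and> ?B g h} = {}" by blast
      then show ?thesis using c g by (simp only: card.empty) simp
    qed
  qed
  have "card {(g,h)\<in>(X\<times>X)\<times>(X\<times>X). ?Z g \<and> ?Z h \<and> ?B g h}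
     = 1 * card {g\<in>X\<times>X. (odd (fst g) \<and> snd g = 0) \<or> (odd (snd g) \<and> fst g = 0)}"
    by (rule card_Sigma_const_fibre[OF _ _ fib]) (simp_all add: fX)
  also have "{g\<in>X\<times>X. (odd (fst g) \<and> snd g = 0) \<or> (odd (snd g) \<and> fst g = 0)}
     = (\<lambda>x. (x,0)) ` {x\<in>X. odd x} \<union> (\<lambda>x. (0,x)) ` {x\<in>X. odd x}"
    using N1 by (auto simp: X_def image_iff)
  also have "card \<dots> = card ((\<lambda>x. (x,0::int)) ` {x\<in>X. odd x}) + card ((\<lambda>x. (0::int,x)) ` {x\<in>X. odd x})"
    by (rule card_Un_disjoint) (use fX in auto)
  also have "\<dots> = 2^(k-1) + 2^(k-1)"
    using card_even_residues(2)[OF k] unfolding X_def by (simp add: card_image inj_on_def)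
  also have "1 * \<dots> = 2^k" using k by (cases k) auto
  finally show ?thesis .
qed

text \<open>By parity the solutions fall into three classes: \<open>x\<close> odd and \<open>y\<close> even, both odd, \<open>x\<close> even and \<open>y\<close> odd. For a fixed odd \<open>x\<close>
  and a fixed parity of \<open>y\<close>, the substitution \<open>y = s + 2 t\<close> leads to a quadratic congruence with a unique
  root \<open>t\<close>. The third class is the mirror image of the first.\<close>
lemma card_norm_one_pairs:
  assumes k: "k \<ge> 1"
  defines "X \<equiv> {0..<2^k::int}" and "F \<equiv> \<lambda>x y::int. x^2 + x * y + y^2"
  shows "card {(x,y)\<in>X\<times>X. [F x y = 1] (mod 2^k)} = 3 * 2^(k-1)"
proof -
  let ?N = "(2::int)^k"
  obtain j where j: "k = Suc j" using k by (cases k) auto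
  have fX: "finite X" by (simp add: X_def)
  have even_N: "(2::int) dvd ?N" using k by simp
  have N: "?N = 2 * 2^j" using j by simp
  have par: "odd (F x y)" if "[F x y = 1] (mod ?N)" for x y
  proof -
    have "2 dvd F x y - 1" using that even_N dvd_trans unfolding cong_iff_dvd_diff by blast
    then show ?thesis by simp
  qed
  \<comment> \<open>y = s + 2 t; the linear coefficient x + 2 s of the congruence for t is odd\<close>
  have one: "card {y\<in>X. y mod 2 = s \<and> [F x y = 1] (mod ?N)} = 1" if x: "odd x" and s: "s = 0 \<or> s = 1" for x s :: int
  proof -
    have "even (1 - x^2 - s * x - s)" using x s by auto
    then obtain e where e: "1 - x^2 - s * x - s = 2 * e" by (rule evenE)
    have ss: "s^2 = s" using s by auto
    have sh: "[F x (s + 2 * t) = 1] (mod ?N) \<longleftrightarrow> [2 * t^2 + (x + 2 * s) * t = e] (mod 2^j)" for t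
    proof -
      have "F x (s + 2 * t) - 1 = 2 * ((2 * t^2 + (x + 2 * s) * t) - e)"
        using s e unfolding F_def by (elim disjE) (simp_all add: power2_eq_square algebra_simps)
      then show ?thesis unfolding cong_iff_dvd_diff N by (simp only: dvd_mult_cancel_left) simp
    qed
    have "{y\<in>X. y mod 2 = s \<and> [F x y = 1] (mod ?N)} = (\<lambda>t. s + 2 * t) ` {t\<in>{0..<2^j}. [2 * t^2 + (x + 2 * s) * t = e] (mod 2^j)}"
    proof (intro equalityI subsetI)
      fix y assume y: "y \<in> {y\<in>X. y mod 2 = s \<and> [F x y = 1] (mod ?N)}"
      define t where "t = y div 2"
      have yt: "y = s + 2 * t" using y unfolding t_def by auto
      have "t \<in> {0..<2^j}" using y yt s unfolding X_def N by auto
      then show "y \<in> (\<lambda>t. s + 2 * t) ` {t\<in>{0..<2^j}. [2 * t^2 + (x + 2 * s) * t = e] (mod 2^j)}"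
        using y yt sh[of t] by (intro image_eqI[of _ _ t]) simp_all
    next
      fix y assume "y \<in> (\<lambda>t. s + 2 * t) ` {t\<in>{0..<2^j}. [2 * t^2 + (x + 2 * s) * t = e] (mod 2^j)}"
      then obtain t where t: "y = s + 2 * t" "t \<in> {0..<2^j}" "[2 * t^2 + (x + 2 * s) * t = e] (mod 2^j)" by blast
      have "[F x y = 1] (mod ?N)" unfolding t(1) sh by (rule t(3))
      moreover have "y \<in> X" "y mod 2 = s" using t s unfolding X_def N by auto
      ultimately show "y \<in> {y\<in>X. y mod 2 = s \<and> [F x y = 1] (mod ?N)}" by blast
    qed
    moreover have "inj_on (\<lambda>t. s + 2 * t) A" for A by (simp add: inj_on_def)
    ultimately have "card {y\<in>X. y mod 2 = s \<and> [F x y = 1] (mod ?N)} = card {t\<in>{0..<2^j}. [2 * t^2 + (x + 2 * s) * t = e] (mod 2^j)}"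
      by (simp only: card_image)
    also have "\<dots> = 1" by (rule quadratic_cong_card) (use x in auto)
    finally show ?thesis .
  qed
  have sym: "F x y = F y x" for x y by (simp add: F_def)
  have fin: "finite {(x,y)\<in>X\<times>X. Q x y}" for Q
    by (rule finite_subset[of _ "X\<times>X"]) (use fX in auto)
  let ?P = "\<lambda>x y. [F x y = 1] (mod ?N)"
  have A: "card {(x,y)\<in>X\<times>X. odd x \<and> y mod 2 = s \<and> ?P x y} = 2^(k-1)" if "s = 0 \<or> s = 1" for s
  proof -
    have "card {(x,y)\<in>X\<times>X. odd x \<and> y mod 2 = s \<and> ?P x y} = 1 * card {x\<in>X. odd x}"
    proof (rule card_Sigma_const_fibre[OF fX fX])
      fix x assume "x \<in> X"
      show "card {y\<in>X. odd x \<and> y mod 2 = s \<and> ?P x y} = (if odd x then 1 else 0)"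
        using one[of x, OF _ that] by (cases "odd x") simp_all
    qed
    then show ?thesis using card_even_residues(2)[OF k] unfolding X_def by simp
  qed
  have B: "card {(x,y)\<in>X\<times>X. even x \<and> ?P x y} = 2^(k-1)"
  proof -
    have "{(x,y)\<in>X\<times>X. even x \<and> ?P x y} = prod.swap ` {(x,y)\<in>X\<times>X. odd x \<and> y mod 2 = 0 \<and> ?P x y}"
    proof (intro equalityI subsetI)
      fix g assume "g \<in> {(x,y)\<in>X\<times>X. even x \<and> ?P x y}"
      then obtain x y where g: "g = (x,y)" "x \<in> X" "y \<in> X" "even x" "?P x y" by blast
      have "odd y" using par[OF g(5)] g(4) unfolding F_def by auto
      then have "(y,x) \<in> {(x,y)\<in>X\<times>X. odd x \<and> y mod 2 = 0 \<and> ?P x y}" using g sym[of x y] by auto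
      then show "g \<in> prod.swap ` {(x,y)\<in>X\<times>X. odd x \<and> y mod 2 = 0 \<and> ?P x y}"
        unfolding g(1) by (rule rev_image_eqI) simp
    next
      fix g assume "g \<in> prod.swap ` {(x,y)\<in>X\<times>X. odd x \<and> y mod 2 = 0 \<and> ?P x y}"
      then obtain x y where g: "g = (y,x)" "x \<in> X" "y \<in> X" "y mod 2 = 0" "?P x y" by auto
      then show "g \<in> {(x,y)\<in>X\<times>X. even x \<and> ?P x y}" using sym[of x y] by auto
    qed
    then have "card {(x,y)\<in>X\<times>X. even x \<and> ?P x y} = card {(x,y)\<in>X\<times>X. odd x \<and> y mod 2 = 0 \<and> ?P x y}"
      by (simp only: card_image[OF inj_on_subset[OF inj_swap subset_UNIV]])
    then show ?thesis using A[of 0] by simp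
  qed
  let ?A = "\<lambda>s. {(x,y)\<in>X\<times>X. odd x \<and> y mod 2 = s \<and> ?P x y}"
  have "{(x,y)\<in>X\<times>X. ?P x y} = (?A 0 \<union> ?A 1) \<union> {(x,y)\<in>X\<times>X. even x \<and> ?P x y}"
  proof (intro equalityI subsetI)
    fix g assume "g \<in> {(x,y)\<in>X\<times>X. ?P x y}"
    then obtain x y where g: "g = (x,y)" "x \<in> X" "y \<in> X" "?P x y" by blast
    have "y mod 2 = 0 \<or> y mod 2 = 1" by presburger
    then show "g \<in> (?A 0 \<union> ?A 1) \<union> {(x,y)\<in>X\<times>X. even x \<and> ?P x y}" using g by blast
  qed blast
  moreover have "card ((?A 0 \<union> ?A 1) \<union> {(x,y)\<in>X\<times>X. even x \<and> ?P x y}) = card (?A 0 \<union> ?A 1) + card {(x,y)\<in>X\<times>X. even x \<and> ?P x y}"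
    by (rule card_Un_disjoint[OF finite_UnI[OF fin fin] fin]) blast
  moreover have "card (?A 0 \<union> ?A 1) = card (?A 0) + card (?A 1)"
    by (rule card_Un_disjoint[OF fin fin]) force
  ultimately show ?thesis using A[of 0] A[of 1] B by simp
qed

lemma dvd_shift:
  fixes N A B C :: int
  assumes "N dvd A" "A = B + N * C"
  shows "N dvd B"
  using assms dvd_add_left_iff[of N "N * C" B] by simp

text \<open>Read \<open>(x, y)\<close> as \<open>x + y \<zeta>\<close> with \<open>\<zeta>^2 = \<zeta> - 1\<close>, so that \<open>F\<close> is the norm. Two vectors \<open>g\<close>, \<open>h\<close> of norm \<open>1\<close> have inner product
  \<open>tr(conj(g) h)\<close>, and norm \<open>1\<close> and trace \<open>1\<close> mean that \<open>conj(g) h\<close> is a root of \<open>z^2 - z + 1\<close>. So \<open>h\<close> is \<open>g \<zeta>\<close> or \<open>g (1 - \<zeta>)\<close>,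
  and each of the \<open>3 * 2^(k-1)\<close> vectors \<open>g\<close> has two partners.\<close>
lemma card_eisenstein_pairs:
  assumes k: "k \<ge> 1"
  defines "X \<equiv> {0..<2^k::int}" and "F \<equiv> \<lambda>x y::int. x^2 + x * y + y^2"
  shows "card {(g,h)\<in>(X\<times>X)\<times>(X\<times>X). [F (fst g) (snd g) = 1] (mod 2^k) \<and> [F (fst h) (snd h) = 1] (mod 2^k) \<and>
      [2 * fst g * fst h + (fst g * snd h + snd g * fst h) + 2 * snd g * snd h = 1] (mod 2^k)} = 3 * 2^k"
proof -
  let ?N = "(2::int)^k"
  let ?Z = "\<lambda>g::int\<times>int. [F (fst g) (snd g) = 1] (mod ?N)"
  let ?B = "\<lambda>g h::int\<times>int. [2 * fst g * fst h + (fst g * snd h + snd g * fst h) + 2 * snd g * snd h = 1] (mod ?N)"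
  have fX: "finite X" by (simp add: X_def)
  have even_N: "(2::int) dvd ?N" using k by simp
  have fib: "card {h\<in>X\<times>X. ?Z g \<and> ?Z h \<and> ?B g h} = (if ?Z g then 2 else 0)" for g
  proof (cases "?Z g")
    case True
    obtain x y where g: "g = (x,y)" by (cases g)
    let ?h1 = "((- y) mod ?N, (x + y) mod ?N)" and ?h2 = "((x + y) mod ?N, (- x) mod ?N)"
    have F1: "[F x y = 1] (mod ?N)" using True g by simp
    then obtain q where q: "F x y = 1 + ?N * q" by (metis cong_iff_lin cong_sym)
    have "{h\<in>X\<times>X. ?Z g \<and> ?Z h \<and> ?B g h} = {?h1, ?h2}"
    proof (intro equalityI subsetI)
      fix h assume h: "h \<in> {h\<in>X\<times>X. ?Z g \<and> ?Z h \<and> ?B g h}"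
      then obtain z w where hh: "h = (z,w)" "z \<in> X" "w \<in> X" by blast
      have H1: "?N dvd F z w - 1" and H2: "?N dvd 2*x*z + (x*w + y*z) + 2*y*w - 1"
        using h hh g by (auto simp: cong_iff_dvd_diff)
      \<comment> \<open>conj(g) h = i + l \<zeta>; multiplying by g and using the norm 1 of g recovers h\<close>
      define i where "i = (x + y) * z + y * w"
      define l where "l = x * w - y * z"
      have z: "?N dvd (i * x - l * y) - z"
      proof -
        have "(i * x - l * y) - z = (F x y - 1) * z" unfolding i_def l_def F_def by (simp add: algebra_simps power2_eq_square)
        then show ?thesis using q by simp
      qed
      have w: "?N dvd (i * y + l * (x + y)) - w"
      proof -
        have "(i * y + l * (x + y)) - w = (F x y - 1) * w" unfolding i_def l_def F_def by (simp add: algebra_simps power2_eq_square)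
        then show ?thesis using q by simp
      qed
      have b: "?N dvd 2 * i + l - 1" using H2 unfolding i_def l_def by (simp add: algebra_simps)
      then obtain c where "2 * i + l - 1 = ?N * c" by (rule dvdE)
      then have c: "l = 1 - 2 * i + ?N * c" by (simp add: algebra_simps)
      have "F i l = F x y * F z w" unfolding i_def l_def F_def by (simp add: algebra_simps power2_eq_square)
      then have "F i l - 1 = (F x y - 1) * F z w + (F z w - 1)" by (simp add: algebra_simps)
      moreover have "?N dvd (F x y - 1) * F z w" using q by simp
      ultimately have n: "?N dvd F i l - 1" using H1 dvd_add by metis
      \<comment> \<open>trace 1 turns the norm equation into 3 i (i - 1) = 0, and 2^k is coprime to 3\<close>
      have "F i l - 1 = 3 * (i * (i - 1)) + ?N * (c * (2 * (1 - 2 * i) + ?N * c + i))"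
        unfolding c F_def by (simp add: algebra_simps power2_eq_square)
      then have "?N dvd 3 * (i * (i - 1))" by (rule dvd_shift[OF n])
      moreover have "coprime ?N 3" by simp
      ultimately have ii: "?N dvd i * (i - 1)" using coprime_dvd_mult_right_iff by blast
      show "h \<in> {?h1, ?h2}"
      proof (cases "even i")
        case True
        then have "coprime ?N (i - 1)" by simp
        then have "?N dvd i" using ii coprime_dvd_mult_left_iff by blast
        then obtain a where a: "i = ?N * a" by (rule dvdE)
        have "[z = - y] (mod ?N)"
        proof -
          have "(i * x - l * y) - z = (- y - z) + ?N * (a * x + 2 * a * y - c * y)" unfolding c a by (simp add: algebra_simps)
          then have "?N dvd - y - z" by (rule dvd_shift[OF z])
          then show ?thesis by (simp add: cong_iff_dvd_diff dvd_diff_commute)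
        qed
        moreover have "[w = x + y] (mod ?N)"
        proof -
          have "(i * y + l * (x + y)) - w = ((x + y) - w) + ?N * (a * y + (c - 2 * a) * (x + y))" unfolding c a by (simp add: algebra_simps)
          then have "?N dvd (x + y) - w" by (rule dvd_shift[OF w])
          then show ?thesis by (simp add: cong_iff_dvd_diff dvd_diff_commute)
        qed
        ultimately show ?thesis using hh unfolding X_def cong_def by auto
      next
        case False
        then have "coprime ?N i" by simp
        then have "?N dvd i - 1" using ii coprime_dvd_mult_right_iff by blast
        then obtain a where "i - 1 = ?N * a" by (rule dvdE)
        then have a: "i = 1 + ?N * a" by simp
        have "[z = x + y] (mod ?N)"
        proof -
          have "(i * x - l * y) - z = ((x + y) - z) + ?N * (a * x + 2 * a * y - c * y)" unfolding c a by (simp add: algebra_simps)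
          then have "?N dvd (x + y) - z" by (rule dvd_shift[OF z])
          then show ?thesis by (simp add: cong_iff_dvd_diff dvd_diff_commute)
        qed
        moreover have "[w = - x] (mod ?N)"
        proof -
          have "(i * y + l * (x + y)) - w = (- x - w) + ?N * (a * y + (c - 2 * a) * (x + y))" unfolding c a by (simp add: algebra_simps)
          then have "?N dvd - x - w" by (rule dvd_shift[OF w])
          then show ?thesis by (simp add: cong_iff_dvd_diff dvd_diff_commute)
        qed
        ultimately show ?thesis using hh unfolding X_def cong_def by auto
      qed
    next
      have m: "[z mod ?N = z] (mod ?N)" for z by (simp add: cong_def)
      have red: "[F (z mod ?N) (w mod ?N) = F z w] (mod ?N)" for z w
        unfolding F_def by (rule cong_add[OF cong_add[OF cong_pow[OF m] cong_mult[OF m m]] cong_pow[OF m]])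
      have redB: "[2 * x * (z mod ?N) + (x * (w mod ?N) + y * (z mod ?N)) + 2 * y * (w mod ?N) = 2 * x * z + (x * w + y * z) + 2 * y * w] (mod ?N)" for z w
        by (rule cong_add[OF cong_add[OF cong_mult[OF cong_refl m] cong_add[OF cong_mult[OF cong_refl m] cong_mult[OF cong_refl m]]] cong_mult[OF cong_refl m]])
      fix h assume "h \<in> {?h1, ?h2}"
      then obtain z w where h: "h = (z mod ?N, w mod ?N)" and zw: "(z,w) = (- y, x + y) \<or> (z,w) = (x + y, - x)" by blast
      have "F z w = F x y" and "2 * x * z + (x * w + y * z) + 2 * y * w = F x y" using zw unfolding F_def by (auto simp: power2_eq_square algebra_simps)
      then have "?Z h" "?B g h" using red[of z w] redB[of z w] F1 h g by (auto simp: cong_def)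
      moreover have "h \<in> X \<times> X" unfolding h X_def by simp
      ultimately show "h \<in> {h\<in>X\<times>X. ?Z g \<and> ?Z h \<and> ?B g h}" using True by blast
    qed
    moreover have "?h1 \<noteq> ?h2"
    proof
      assume "?h1 = ?h2"
      then have "?N dvd - y - (x + y)" "?N dvd (x + y) - (- x)" by (auto simp: mod_eq_dvd_iff)
      then have "2 dvd - y - (x + y)" "2 dvd (x + y) - (- x)" using even_N dvd_trans by blast+
      then have "even x" "even y" by auto
      moreover have "2 dvd F x y - 1" using F1 even_N dvd_trans unfolding cong_iff_dvd_diff by blast
      ultimately show False unfolding F_def by simp
    qed
    ultimately have "card {h\<in>X\<times>X. ?Z g \<and> ?Z h \<and> ?B g h} = 2" by (simp only: card_2_iff) blast
    then show ?thesis using True by simp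
  next
    case False
    then show ?thesis by simp
  qed
  have "card {(g,h)\<in>(X\<times>X)\<times>(X\<times>X). ?Z g \<and> ?Z h \<and> ?B g h} = 2 * card {g\<in>X\<times>X. ?Z g}"
    by (rule card_Sigma_const_fibre[OF _ _ fib]) (simp_all add: fX)
  also have "{g\<in>X\<times>X. ?Z g} = {(x,y)\<in>X\<times>X. [F x y = 1] (mod ?N)}" by auto
  also have "card \<dots> = 3 * 2^(k-1)" unfolding X_def F_def by (rule card_norm_one_pairs[OF k])
  also have "2 * (3 * 2^(k-1)) = (3::nat) * 2^k" using k by (cases k) auto
  finally show ?thesis .
qed

section \<open>Isometry groups and coprime torsion\<close>

lemma isometry_group_iff:
  "f \<in> isometry_group D \<longleftrightarrow> f \<in> iso D D \<and> f \<in> extensional (carrier D) \<and> (\<forall>x\<in>carrier D. qform D (f x) = qform D x)"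
  by (auto simp: isometry_group_def auto_def iso_def Bij_def)

text \<open>On a finite group injectivity suffices for bijectivity.\<close>
lemma isometry_group_iff_inj:
  assumes "finite (carrier D)"
  shows "f \<in> isometry_group D \<longleftrightarrow> f \<in> extensional (carrier D) \<and> f \<in> carrier D \<rightarrow> carrier D \<and>
    (\<forall>x\<in>carrier D. \<forall>y\<in>carrier D. f (x \<otimes>\<^bsub>D\<^esub> y) = f x \<otimes>\<^bsub>D\<^esub> f y) \<and> inj_on f (carrier D) \<and>
    (\<forall>x\<in>carrier D. qform D (f x) = qform D x)"
proof -
  have "f \<in> iso D D \<longleftrightarrow> f \<in> carrier D \<rightarrow> carrier D \<and>
    (\<forall>x\<in>carrier D. \<forall>y\<in>carrier D. f (x \<otimes>\<^bsub>D\<^esub> y) = f x \<otimes>\<^bsub>D\<^esub> f y) \<and> inj_on f (carrier D)"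
    using endo_inj_surj[OF assms, of f] by (auto simp: iso_def hom_def bij_betw_def)
  then show ?thesis by (auto simp: isometry_group_iff)
qed

lemma finite_isometry_group: "finite (carrier D) \<Longrightarrow> finite (isometry_group D)"
  by (rule finite_subset[of _ "carrier D \<rightarrow>\<^sub>E carrier D"])
     (auto simp: isometry_group_iff iso_def hom_def PiE_def intro!: finite_PiE[unfolded PiE_def])

lemma quad_isomorphic_sym:
  assumes "group D" "quad_isomorphic D E"
  shows "quad_isomorphic E D"
proof -
  obtain f where f: "f \<in> iso D E" "\<forall>x\<in>carrier D. qform E (f x) = qform D x"
    using assms(2) by (auto simp: quad_isomorphic_def)
  have bij: "bij_betw f (carrier D) (carrier E)" using f(1) by (simp add: iso_def)
  have "inv_into (carrier D) f \<in> iso E D" by (rule group.iso_set_sym[OF assms(1) f(1)])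
  moreover have "qform D (inv_into (carrier D) f x) = qform E x" if "x \<in> carrier E" for x
    using f(2) bij_betw_inv_into_right[OF bij that] bij_betwE[OF bij_betw_inv_into[OF bij]] that by metis
  ultimately show ?thesis by (auto simp: quad_isomorphic_def)
qed

lemma quad_isomorphic_trans:
  assumes "quad_isomorphic D E" "quad_isomorphic E F"
  shows "quad_isomorphic D F"
proof -
  obtain f where f: "f \<in> iso D E" "\<forall>x\<in>carrier D. qform E (f x) = qform D x"
    using assms(1) by (auto simp: quad_isomorphic_def)
  obtain g where g: "g \<in> iso E F" "\<forall>x\<in>carrier E. qform F (g x) = qform E x"
    using assms(2) by (auto simp: quad_isomorphic_def)
  have "g \<circ> f \<in> iso D F" using iso_set_trans[OF f(1) g(1)] .
  moreover have "qform F ((g \<circ> f) x) = qform D x" if "x \<in> carrier D" for x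
  proof -
    have "f x \<in> carrier E" using f(1) that by (auto simp: iso_def hom_def)
    then show ?thesis using f(2) g(2) that by simp
  qed
  ultimately show ?thesis unfolding quad_isomorphic_def by blast
qed

text \<open>Conjugation by an isometry \<open>D \<rightarrow> E\<close> is injective on isometry groups.\<close>
lemma card_isometry_group_le:
  assumes "group D" "group E" "finite (carrier E)" "quad_isomorphic D E"
  shows "card (isometry_group D) \<le> card (isometry_group E)"
proof -
  obtain f where f: "f \<in> iso D E" "\<forall>x\<in>carrier D. qform E (f x) = qform D x"
    using assms(4) by (auto simp: quad_isomorphic_def)
  define g where "g = inv_into (carrier D) f"
  have bij: "bij_betw f (carrier D) (carrier E)" using f(1) by (simp add: iso_def)
  have g: "g \<in> iso E D" unfolding g_def by (rule group.iso_set_sym[OF assms(1) f(1)])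
  have gf: "g (f x) = x" if "x \<in> carrier D" for x
    unfolding g_def using bij that by (simp add: bij_betw_def)
  have fg: "f (g x) = x" if "x \<in> carrier E" for x
    unfolding g_def using bij_betw_inv_into_right[OF bij that] .
  have fc: "f x \<in> carrier E" if "x \<in> carrier D" for x using bij that bij_betwE by blast
  have gc: "g x \<in> carrier D" if "x \<in> carrier E" for x using g that by (auto simp: iso_def hom_def)
  let ?\<Phi> = "\<lambda>h. restrict (f \<circ> (h \<circ> g)) (carrier E)"
  have hc: "h x \<in> carrier D" if "h \<in> isometry_group D" "x \<in> carrier D" for h x
    using that by (auto simp: isometry_group_iff iso_def hom_def)
  have "?\<Phi> h \<in> isometry_group E" if h: "h \<in> isometry_group D" for h
  proof -
    have h1: "h \<in> iso D D" "\<forall>x\<in>carrier D. qform D (h x) = qform D x" using h by (auto simp: isometry_group_iff)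
    have "f \<circ> (h \<circ> g) \<in> iso E E" by (rule iso_set_trans[OF iso_set_trans[OF g h1(1)] f(1)])
    then have "?\<Phi> h \<in> iso E E" by (rule group.iso_eq[OF assms(2)]) simp
    moreover have "qform E (f (h (g x))) = qform E x" if "x \<in> carrier E" for x
    proof -
      have "qform E (f (h (g x))) = qform D (g x)" using f(2) h1(2) hc[OF h] gc[OF that] by simp
      also have "\<dots> = qform E (f (g x))" using f(2) gc[OF that] by simp
      finally show ?thesis using fg[OF that] by simp
    qed
    ultimately show ?thesis by (auto simp: isometry_group_iff)
  qed
  moreover have "inj_on ?\<Phi> (isometry_group D)"
  proof (rule inj_onI)
    fix h k assume h: "h \<in> isometry_group D" and k: "k \<in> isometry_group D" and eq: "?\<Phi> h = ?\<Phi> k"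
    show "h = k"
    proof (rule extensionalityI[of _ "carrier D"])
      show "h \<in> extensional (carrier D)" "k \<in> extensional (carrier D)" using h k by (auto simp: isometry_group_iff)
      fix x assume x: "x \<in> carrier D"
      have "?\<Phi> h (f x) = ?\<Phi> k (f x)" using eq by simp
      then have "f (h x) = f (k x)" using fc[OF x] gf[OF x] by simp
      then have "g (f (h x)) = g (f (k x))" by simp
      then show "h x = k x" using gf[OF hc[OF h x]] gf[OF hc[OF k x]] by simp
    qed
  qed
  ultimately show ?thesis
    using card_inj_on_le[of ?\<Phi> "isometry_group D" "isometry_group E"] finite_isometry_group[OF assms(3)] by blast
qed

lemma card_isometry_group_cong:
  assumes "group D" "group E" "finite (carrier E)" "quad_isomorphic D E"
  shows "card (isometry_group D) = card (isometry_group E)"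
proof -
  have "finite (carrier D)"
    using assms(3,4) bij_betw_finite unfolding quad_isomorphic_def iso_def by blast
  then show ?thesis
    using card_isometry_group_le[OF assms] card_isometry_group_le[OF assms(2,1) _ quad_isomorphic_sym[OF assms(1,4)]] by simp
qed

text \<open>For a finite abelian group and the full power \<open>N\<close> of \<open>p\<close> dividing its exponent this is the \<open>p\<close>-component.
  Unlike the \<open>p\<close>-component, it makes sense for composite \<open>N\<close>, which allows an induction over coprime factors.\<close>
definition torsion :: "nat \<Rightarrow> 'a quad_group \<Rightarrow> 'a quad_group" where
  "torsion N D = D\<lparr>carrier := {x \<in> carrier D. x [^]\<^bsub>D\<^esub> N = \<one>\<^bsub>D\<^esub>}\<rparr>"

lemma torsion_simps [simp]:
  "monoid.mult (torsion N D) = monoid.mult D" "one (torsion N D) = one D" "qform (torsion N D) = qform D"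
  by (simp_all add: torsion_def)

lemma carrier_torsion: "x \<in> carrier (torsion N D) \<longleftrightarrow> x \<in> carrier D \<and> x [^]\<^bsub>D\<^esub> N = \<one>\<^bsub>D\<^esub>"
  by (simp add: torsion_def)

lemma (in comm_group) pow_eq_of_cong:
  assumes "x \<in> carrier G" "x [^] (N::nat) = \<one>" "[i = j] (mod N)"
  shows "x [^] i = x [^] j"
proof -
  have red: "x [^] i = x [^] (i mod N)" for i
  proof -
    have "x [^] i = x [^] (N * (i div N) + i mod N)" by simp
    also have "\<dots> = (x [^] N) [^] (i div N) \<otimes> x [^] (i mod N)"
      using assms(1) by (simp only: nat_pow_mult[symmetric] nat_pow_pow)
    finally show ?thesis using assms by simp
  qed
  show ?thesis using red[of i] red[of j] assms(3) by (simp add: cong_def)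
qed

lemma comm_group_torsion:
  assumes "comm_group D"
  shows "comm_group (torsion N D)"
proof -
  interpret comm_group D by fact
  have "subgroup {x \<in> carrier D. x [^]\<^bsub>D\<^esub> N = \<one>\<^bsub>D\<^esub>} D"
    by (rule subgroupI) (auto simp: nat_pow_distrib nat_pow_inv)
  then have "group (torsion N D)" unfolding torsion_def by (rule subgroup_imp_group)
  then show ?thesis
    by (rule group.group_comm_groupI) (simp add: carrier_torsion m_comm)
qed

text \<open>The \<open>A B\<close>-torsion is the direct sum of the \<open>A\<close>-torsion and the \<open>B\<close>-torsion, and every homomorphism respects
  the summands. So an isometry is a pair of isometries; conversely a pair
  glues to an isometry because the value of the form at a sum is determined by the values at the summands.
  The dependence is left abstract as a function \<open>Q\<close>, since the values of the form are cosets of \<open>2\<int>\<close> without an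
  addition of their own.\<close>
lemma card_isometry_group_torsion_mult:
  fixes D :: "'a quad_group"
  assumes D: "comm_group D" and fin: "finite (carrier D)" and cop: "coprime A B"
    and orth: "\<And>x y. x \<in> carrier (torsion A D) \<Longrightarrow> y \<in> carrier (torsion B D) \<Longrightarrow>
      qform D (x \<otimes>\<^bsub>D\<^esub> y) = Q (qform D x) (qform D y)"
  shows "card (isometry_group (torsion (A * B) D)) =
    card (isometry_group (torsion A D)) * card (isometry_group (torsion B D))"
proof -
  interpret comm_group D by fact
  \<comment> \<open>x^u and x^w are the components of x in the A-torsion and in the B-torsion\<close>
  obtain u where u: "[u = 1] (mod A)" "[u = 0] (mod B)" using binary_chinese_remainder_nat[OF cop] by blast
  obtain w where w: "[w = 0] (mod A)" "[w = 1] (mod B)" using binary_chinese_remainder_nat[OF cop] by blast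
  have uw: "[u + w = 1] (mod A * B)"
  proof (rule coprime_cong_mult_nat[OF _ _ cop])
    show "[u + w = 1] (mod A)" using cong_add[OF u(1) w(1)] by simp
    show "[u + w = 1] (mod B)" using cong_add[OF u(2) w(2)] by simp
  qed
  let ?T = "\<lambda>N. carrier (torsion N D)"
  have finT: "finite (?T N)" for N using fin by (simp add: torsion_def)
  have TC: "x \<in> carrier D" if "x \<in> ?T N" for x N using that by (simp add: carrier_torsion)
  have TA: "x \<in> ?T (A * B)" if "x \<in> ?T A" for x
    using that by (simp add: carrier_torsion nat_pow_pow[symmetric])
  have TB: "x \<in> ?T (A * B)" if "x \<in> ?T B" for x
    using that by (simp add: carrier_torsion mult.commute[of A] nat_pow_pow[symmetric])
  have Tm: "x \<otimes>\<^bsub>D\<^esub> y \<in> ?T N" if "x \<in> ?T N" "y \<in> ?T N" for x y N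
    using that by (simp add: carrier_torsion nat_pow_distrib)
  have T1: "\<one>\<^bsub>D\<^esub> \<in> ?T N" for N by (simp add: carrier_torsion)
  have pu: "x [^]\<^bsub>D\<^esub> u \<in> ?T A" if "x \<in> ?T (A * B)" for x
  proof -
    have "x [^]\<^bsub>D\<^esub> (u * A) = x [^]\<^bsub>D\<^esub> (0::nat)"
    proof (rule pow_eq_of_cong)
      obtain c where "u = B * c" using u(2) by (auto simp: cong_0_iff)
      then show "[u * A = 0] (mod A * B)" by (simp add: cong_0_iff)
    qed (use that in \<open>auto simp: carrier_torsion\<close>)
    then show ?thesis using that by (simp add: carrier_torsion nat_pow_pow)
  qed
  have pw: "x [^]\<^bsub>D\<^esub> w \<in> ?T B" if "x \<in> ?T (A * B)" for x
  proof -
    have "x [^]\<^bsub>D\<^esub> (w * B) = x [^]\<^bsub>D\<^esub> (0::nat)"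
    proof (rule pow_eq_of_cong)
      obtain c where "w = A * c" using w(1) by (auto simp: cong_0_iff)
      then show "[w * B = 0] (mod A * B)" by (simp add: cong_0_iff)
    qed (use that in \<open>auto simp: carrier_torsion\<close>)
    then show ?thesis using that by (simp add: carrier_torsion nat_pow_pow)
  qed
  have split: "x [^]\<^bsub>D\<^esub> u \<otimes>\<^bsub>D\<^esub> x [^]\<^bsub>D\<^esub> w = x" if "x \<in> ?T (A * B)" for x
    using pow_eq_of_cong[of x "A * B" "u + w" 1] that uw by (simp add: carrier_torsion nat_pow_mult)
  have Au: "x [^]\<^bsub>D\<^esub> u = x" "x [^]\<^bsub>D\<^esub> w = \<one>\<^bsub>D\<^esub>" if "x \<in> ?T A" for x
    using pow_eq_of_cong[of x A u 1] pow_eq_of_cong[of x A w 0] that u w by (simp_all add: carrier_torsion)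
  have Bw: "x [^]\<^bsub>D\<^esub> u = \<one>\<^bsub>D\<^esub>" "x [^]\<^bsub>D\<^esub> w = x" if "x \<in> ?T B" for x
    using pow_eq_of_cong[of x B u 0] pow_eq_of_cong[of x B w 1] that u w by (simp_all add: carrier_torsion)
  have Oiff: "f \<in> isometry_group (torsion N D) \<longleftrightarrow> f \<in> extensional (?T N) \<and> f \<in> ?T N \<rightarrow> ?T N \<and>
    (\<forall>x\<in>?T N. \<forall>y\<in>?T N. f (x \<otimes>\<^bsub>D\<^esub> y) = f x \<otimes>\<^bsub>D\<^esub> f y) \<and> inj_on f (?T N) \<and>
    (\<forall>x\<in>?T N. qform D (f x) = qform D x)" for f N
    using isometry_group_iff_inj[OF finT] by simp
  have O1: "f \<one>\<^bsub>D\<^esub> = \<one>\<^bsub>D\<^esub>" if "f \<in> isometry_group (torsion N D)" for f N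
  proof -
    have "f (\<one>\<^bsub>D\<^esub> \<otimes>\<^bsub>D\<^esub> \<one>\<^bsub>D\<^esub>) = f \<one>\<^bsub>D\<^esub> \<otimes>\<^bsub>D\<^esub> f \<one>\<^bsub>D\<^esub>"
      using that T1[of N] unfolding Oiff by blast
    moreover have "f \<one>\<^bsub>D\<^esub> \<in> ?T N" using that T1[of N] unfolding Oiff by blast
    then have "f \<one>\<^bsub>D\<^esub> \<in> carrier D" by (rule TC)
    ultimately show ?thesis by simp
  qed
  have Opow: "f (x [^]\<^bsub>D\<^esub> (j::nat)) = f x [^]\<^bsub>D\<^esub> j \<and> x [^]\<^bsub>D\<^esub> j \<in> ?T N"
    if f: "f \<in> isometry_group (torsion N D)" and x: "x \<in> ?T N" for f x N j
  proof (induction j)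
    case 0
    then show ?case using O1[OF f] T1 by simp
  next
    case (Suc j)
    have "f (x [^]\<^bsub>D\<^esub> j \<otimes>\<^bsub>D\<^esub> x) = f (x [^]\<^bsub>D\<^esub> j) \<otimes>\<^bsub>D\<^esub> f x" using f x Suc unfolding Oiff by blast
    then show ?case using Suc Tm x by simp
  qed
  let ?\<Phi> = "\<lambda>f. (restrict f (?T A), restrict f (?T B))"
  let ?\<Psi> = "\<lambda>(g, h). \<lambda>x\<in>?T (A * B). g (x [^]\<^bsub>D\<^esub> u) \<otimes>\<^bsub>D\<^esub> h (x [^]\<^bsub>D\<^esub> w)"
  have restr: "restrict f (?T N) \<in> isometry_group (torsion N D)"
    if f: "f \<in> isometry_group (torsion (A * B) D)" and sub: "?T N \<subseteq> ?T (A * B)" for f N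
  proof -
    have "f x \<in> ?T N" if x: "x \<in> ?T N" for x
    proof -
      have "f (x [^]\<^bsub>D\<^esub> N) = f x [^]\<^bsub>D\<^esub> N" using Opow[OF f] sub x by blast
      moreover have "f x \<in> ?T (A * B)" using f sub x unfolding Oiff by blast
      ultimately show ?thesis using x O1[OF f] by (simp add: carrier_torsion)
    qed
    moreover have "inj_on f (?T N)" using f sub inj_on_subset unfolding Oiff by blast
    moreover have "f (x \<otimes>\<^bsub>D\<^esub> y) = f x \<otimes>\<^bsub>D\<^esub> f y" if "x \<in> ?T N" "y \<in> ?T N" for x y
      using f sub that unfolding Oiff by blast
    moreover have "qform D (f x) = qform D x" if "x \<in> ?T N" for x
      using f sub that unfolding Oiff by blast
    ultimately show ?thesis unfolding Oiff using Tm by (simp add: inj_on_def)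
  qed
  have "bij_betw ?\<Phi> (isometry_group (torsion (A * B) D)) (isometry_group (torsion A D) \<times> isometry_group (torsion B D))"
  proof (rule bij_betw_byWitness[where f' = ?\<Psi>])
    show "?\<Phi> ` isometry_group (torsion (A * B) D) \<subseteq> isometry_group (torsion A D) \<times> isometry_group (torsion B D)"
      using restr TA TB by blast
    show "\<forall>f\<in>isometry_group (torsion (A * B) D). ?\<Psi> (?\<Phi> f) = f"
    proof
      fix f assume f: "f \<in> isometry_group (torsion (A * B) D)"
      show "?\<Psi> (?\<Phi> f) = f"
      proof (rule extensionalityI[of _ "?T (A * B)"])
        show "f \<in> extensional (?T (A * B))" using f unfolding Oiff by blast
        fix x assume x: "x \<in> ?T (A * B)"
        have "f (x [^]\<^bsub>D\<^esub> u) \<otimes>\<^bsub>D\<^esub> f (x [^]\<^bsub>D\<^esub> w) = f (x [^]\<^bsub>D\<^esub> u \<otimes>\<^bsub>D\<^esub> x [^]\<^bsub>D\<^esub> w)"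
          using f TA[OF pu[OF x]] TB[OF pw[OF x]] unfolding Oiff by simp
        then show "?\<Psi> (?\<Phi> f) x = f x" using x pu[OF x] pw[OF x] split[OF x] by simp
      qed simp
    qed
    show "\<forall>gh\<in>isometry_group (torsion A D) \<times> isometry_group (torsion B D). ?\<Phi> (?\<Psi> gh) = gh"
    proof
      fix gh assume "gh \<in> isometry_group (torsion A D) \<times> isometry_group (torsion B D)"
      then obtain g h where gh: "gh = (g, h)"
        and g: "g \<in> isometry_group (torsion A D)" and h: "h \<in> isometry_group (torsion B D)" by blast
      have "restrict (?\<Psi> (g, h)) (?T A) = g"
      proof (rule extensionalityI[of _ "?T A"])
        show "g \<in> extensional (?T A)" using g unfolding Oiff by blast
        fix x assume x: "x \<in> ?T A"
        have "g x \<in> carrier D" using g x TC unfolding Oiff by blast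
        then show "restrict (?\<Psi> (g, h)) (?T A) x = g x" using x TA[OF x] Au[OF x] O1[OF h] by simp
      qed (rule restrict_extensional)
      moreover have "restrict (?\<Psi> (g, h)) (?T B) = h"
      proof (rule extensionalityI[of _ "?T B"])
        show "h \<in> extensional (?T B)" using h unfolding Oiff by blast
        fix x assume x: "x \<in> ?T B"
        have "h x \<in> carrier D" using h x TC unfolding Oiff by blast
        then show "restrict (?\<Psi> (g, h)) (?T B) x = h x" using x TB[OF x] Bw[OF x] O1[OF g] by simp
      qed (rule restrict_extensional)
      ultimately show "?\<Phi> (?\<Psi> gh) = gh" unfolding gh by simp
    qed
    show "?\<Psi> ` (isometry_group (torsion A D) \<times> isometry_group (torsion B D)) \<subseteq> isometry_group (torsion (A * B) D)"
    proof (rule image_subsetI)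
      fix gh assume "gh \<in> isometry_group (torsion A D) \<times> isometry_group (torsion B D)"
      then obtain g h where gh: "gh = (g, h)"
        and g: "g \<in> isometry_group (torsion A D)" and h: "h \<in> isometry_group (torsion B D)" by blast
      define k where "k = ?\<Psi> (g, h)"
      have gT: "g x \<in> ?T A" if "x \<in> ?T A" for x using g that unfolding Oiff by blast
      have hT: "h x \<in> ?T B" if "x \<in> ?T B" for x using h that unfolding Oiff by blast
      have k: "k x = g (x [^]\<^bsub>D\<^esub> u) \<otimes>\<^bsub>D\<^esub> h (x [^]\<^bsub>D\<^esub> w)" if "x \<in> ?T (A * B)" for x
        using that by (simp add: k_def)
      have gx: "g (x [^]\<^bsub>D\<^esub> u) \<in> ?T A" if "x \<in> ?T (A * B)" for x using gT[OF pu[OF that]] .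
      have hx: "h (x [^]\<^bsub>D\<^esub> w) \<in> ?T B" if "x \<in> ?T (A * B)" for x using hT[OF pw[OF that]] .
      have "k \<in> extensional (?T (A * B))" by (simp add: k_def)
      moreover have "k x \<in> ?T (A * B)" if x: "x \<in> ?T (A * B)" for x
        unfolding k[OF x] by (rule Tm[OF TA[OF gx[OF x]] TB[OF hx[OF x]]])
      moreover have "k (x \<otimes>\<^bsub>D\<^esub> y) = k x \<otimes>\<^bsub>D\<^esub> k y" if x: "x \<in> ?T (A * B)" and y: "y \<in> ?T (A * B)" for x y
      proof -
        have "g ((x \<otimes>\<^bsub>D\<^esub> y) [^]\<^bsub>D\<^esub> u) = g (x [^]\<^bsub>D\<^esub> u) \<otimes>\<^bsub>D\<^esub> g (y [^]\<^bsub>D\<^esub> u)"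
          using g pu[OF x] pu[OF y] TC[OF x] TC[OF y] unfolding Oiff by (simp add: nat_pow_distrib)
        moreover have "h ((x \<otimes>\<^bsub>D\<^esub> y) [^]\<^bsub>D\<^esub> w) = h (x [^]\<^bsub>D\<^esub> w) \<otimes>\<^bsub>D\<^esub> h (y [^]\<^bsub>D\<^esub> w)"
          using h pw[OF x] pw[OF y] TC[OF x] TC[OF y] unfolding Oiff by (simp add: nat_pow_distrib)
        ultimately show ?thesis
          using k[OF x] k[OF y] k[OF Tm[OF x y]] TC[OF gx[OF x]] TC[OF gx[OF y]] TC[OF hx[OF x]] TC[OF hx[OF y]]
          by (simp add: m_ac)
      qed
      moreover have "inj_on k (?T (A * B))"
      proof (rule inj_onI)
        have rec: "k x [^]\<^bsub>D\<^esub> u = g (x [^]\<^bsub>D\<^esub> u)" "k x [^]\<^bsub>D\<^esub> w = h (x [^]\<^bsub>D\<^esub> w)" if x: "x \<in> ?T (A * B)" for x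
          using k[OF x] Au[OF gx[OF x]] Bw[OF hx[OF x]] TC[OF gx[OF x]] TC[OF hx[OF x]]
          by (simp_all add: nat_pow_distrib)
        fix x y assume x: "x \<in> ?T (A * B)" and y: "y \<in> ?T (A * B)" and eq: "k x = k y"
        have eqs: "g (x [^]\<^bsub>D\<^esub> u) = g (y [^]\<^bsub>D\<^esub> u)" "h (x [^]\<^bsub>D\<^esub> w) = h (y [^]\<^bsub>D\<^esub> w)"
          using rec[OF x] rec[OF y] eq by simp_all
        have ig: "inj_on g (?T A)" and ih: "inj_on h (?T B)" using g h unfolding Oiff by blast+
        have "x [^]\<^bsub>D\<^esub> u = y [^]\<^bsub>D\<^esub> u" by (rule inj_onD[OF ig eqs(1) pu[OF x] pu[OF y]])
        moreover have "x [^]\<^bsub>D\<^esub> w = y [^]\<^bsub>D\<^esub> w" by (rule inj_onD[OF ih eqs(2) pw[OF x] pw[OF y]])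
        ultimately have "x [^]\<^bsub>D\<^esub> u \<otimes>\<^bsub>D\<^esub> x [^]\<^bsub>D\<^esub> w = y [^]\<^bsub>D\<^esub> u \<otimes>\<^bsub>D\<^esub> y [^]\<^bsub>D\<^esub> w" by (simp only:)
        then show "x = y" unfolding split[OF x] split[OF y] .
      qed
      moreover have "qform D (k x) = qform D x" if x: "x \<in> ?T (A * B)" for x
      proof -
        have "qform D (k x) = Q (qform D (g (x [^]\<^bsub>D\<^esub> u))) (qform D (h (x [^]\<^bsub>D\<^esub> w)))"
          unfolding k[OF x] by (rule orth[OF gx[OF x] hx[OF x]])
        also have "\<dots> = Q (qform D (x [^]\<^bsub>D\<^esub> u)) (qform D (x [^]\<^bsub>D\<^esub> w))"
          using g h pu[OF x] pw[OF x] unfolding Oiff by simp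
        also have "\<dots> = qform D (x [^]\<^bsub>D\<^esub> u \<otimes>\<^bsub>D\<^esub> x [^]\<^bsub>D\<^esub> w)" by (rule orth[OF pu[OF x] pw[OF x], symmetric])
        finally show ?thesis using split[OF x] by simp
      qed
      ultimately have "k \<in> isometry_group (torsion (A * B) D)" unfolding Oiff by blast
      then show "?\<Psi> gh \<in> isometry_group (torsion (A * B) D)" unfolding gh k_def .
    qed
  qed
  then show ?thesis by (simp only: bij_betw_same_card card_cartesian_product)
qed

lemma card_isometry_group_trivial:
  assumes "group D" "carrier D = {\<one>\<^bsub>D\<^esub>}"
  shows "card (isometry_group D) = 1"
proof -
  interpret group D by fact
  have "isometry_group D = {\<lambda>x\<in>carrier D. x}"
  proof (intro equalityI subsetI)
    fix f assume "f \<in> isometry_group D"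
    then have "f \<in> extensional (carrier D)" "f \<in> carrier D \<rightarrow> carrier D"
      by (auto simp: isometry_group_iff iso_def hom_def)
    then have "f = (\<lambda>x\<in>carrier D. x)"
      by (intro extensionalityI[of _ "carrier D"]) (auto simp: assms(2))
    then show "f \<in> {\<lambda>x\<in>carrier D. x}" by simp
  next
    fix f assume "f \<in> {\<lambda>x\<in>carrier D. x}"
    then show "f \<in> isometry_group D"
      using id_in_auto by (auto simp: isometry_group_def)
  qed
  then show ?thesis by simp
qed

lemma card_isometry_group_prime_product:
  fixes D :: "'a quad_group"
  assumes D: "comm_group D" and fin: "finite (carrier D)"
    and orth: "\<And>A B x y. coprime A B \<Longrightarrow> A > 0 \<Longrightarrow> B > 0 \<Longrightarrow> x \<in> carrier (torsion A D) \<Longrightarrow> y \<in> carrier (torsion B D) \<Longrightarrow>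
      qform D (x \<otimes>\<^bsub>D\<^esub> y) = Q (qform D x) (qform D y)"
    and P: "finite P" "\<And>p. p \<in> P \<Longrightarrow> prime p"
  shows "card (isometry_group (torsion (\<Prod>p\<in>P. p ^ e p) D)) = (\<Prod>p\<in>P. card (isometry_group (torsion (p ^ e p) D)))"
  using P
proof (induction P rule: finite_induct)
  case empty
  interpret comm_group D by fact
  have "carrier (torsion 1 D) = {\<one>\<^bsub>torsion 1 D\<^esub>}" by (auto simp: carrier_torsion)
  then show ?case using card_isometry_group_trivial[OF comm_group.axioms(2)[OF comm_group_torsion[OF D]]] by simp
next
  case (insert p P)
  have "coprime (p ^ e p) (\<Prod>q\<in>P. q ^ e q)"
  proof (rule prod_coprime_right)
    fix q assume "q \<in> P"
    then have "coprime p q" using insert by (intro primes_coprime) auto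
    then show "coprime (p ^ e p) (q ^ e q)" by simp
  qed
  note cop = this
  have pos: "p ^ e p > 0" "(\<Prod>q\<in>P. q ^ e q) > 0"
    using insert.prems by (auto intro!: prod_pos simp: prime_gt_0_nat)
  have "card (isometry_group (torsion (p ^ e p * (\<Prod>q\<in>P. q ^ e q)) D)) =
      card (isometry_group (torsion (p ^ e p) D)) * card (isometry_group (torsion (\<Prod>q\<in>P. q ^ e q) D))"
    by (rule card_isometry_group_torsion_mult[OF D fin cop, where Q = Q]) (rule orth[OF cop pos])
  then show ?case using insert by simp
qed

section \<open>Binary forms on a sum of two cyclic groups\<close>

lemma mod2Z_eq: "mod2Z r = mod2Z s \<longleftrightarrow> (\<exists>k::int. r - s = of_int (2 * k))"
proof
  assume "mod2Z r = mod2Z s"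
  moreover have "r \<in> mod2Z r" unfolding mod2Z_def by (rule range_eqI[of _ _ 0]) simp
  ultimately have "r \<in> mod2Z s" by simp
  then obtain k :: int where "r = s + of_int (2 * k)" unfolding mod2Z_def by blast
  then show "\<exists>k::int. r - s = of_int (2 * k)" by (intro exI[of _ k]) simp
next
  assume "\<exists>k::int. r - s = of_int (2 * k)"
  then obtain k :: int where "r - s = of_int (2 * k)" by blast
  then have k: "r = s + of_int (2 * k)" by (simp add: algebra_simps)
  show "mod2Z r = mod2Z s"
  proof (intro equalityI subsetI)
    fix x assume "x \<in> mod2Z r"
    then obtain j :: int where "x = r + of_int (2 * j)" unfolding mod2Z_def by blast
    then have "x = s + of_int (2 * (j + k))" using k by simp
    then show "x \<in> mod2Z s" unfolding mod2Z_def by blast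
  next
    fix x assume "x \<in> mod2Z s"
    then obtain j :: int where "x = s + of_int (2 * j)" unfolding mod2Z_def by blast
    then have "x = r + of_int (2 * (j - k))" using k by simp
    then show "x \<in> mod2Z r" unfolding mod2Z_def by blast
  qed
qed

lemma mod2Z_eq_iff:
  assumes "N > 0"
  shows "mod2Z (of_int a / of_nat N) = mod2Z (of_int b / of_nat N) \<longleftrightarrow> [a = b] (mod 2 * int N)"
proof -
  have N: "(of_nat N :: rat) \<noteq> 0" using assms by simp
  have "of_int a / of_nat N - of_int b / of_nat N = (of_int (2 * k) :: rat) \<longleftrightarrow> a - b = 2 * int N * k" for k
  proof -
    have "of_int a / of_nat N - of_int b / of_nat N = (of_int (2 * k) :: rat) \<longleftrightarrow>
        of_int (a - b) = (of_int (2 * int N * k) :: rat)"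
      using N by (simp add: field_simps)
    then show ?thesis by (simp only: of_int_eq_iff)
  qed
  then show ?thesis unfolding mod2Z_eq cong_iff_dvd_diff dvd_def by simp
qed

lemma quad_group_simps [simp]:
  "carrier (quad_group G q) = carrier G" "monoid.mult (quad_group G q) = monoid.mult G"
  "one (quad_group G q) = one G" "qform (quad_group G q) = q"
  by (simp_all add: quad_group_def)

lemma comm_group_quad_group:
  assumes "comm_group G"
  shows "comm_group (quad_group G q)"
proof -
  interpret comm_group G by fact
  show ?thesis
    by (rule comm_groupI) (auto simp: m_ac intro: l_inv_ex)
qed

text \<open>The form \<open>(A x^2 + 2 B d x y + C d y^2) / (K d)\<close> on \<open>\<int>/Kd \<oplus> \<int>/K\<close>. The factor \<open>d\<close> in the last two
  terms is what any form on this group must have in order that \<open>y\<close> matters modulo \<open>K\<close> only.\<close>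
definition binary_quad_group :: "nat \<Rightarrow> nat \<Rightarrow> int \<Rightarrow> int \<Rightarrow> int \<Rightarrow> (int \<times> int) quad_group" where
  "binary_quad_group K d A B C =
     gram_form (K * d) K (of_int A / of_nat (K * d)) (of_int B / of_nat K) (of_int C / of_nat K)"

text \<open>Numerator over the denominator \<open>K d\<close> of the quadratic form of \<open>binary_quad_group\<close>; \<open>bpol\<close> is the numerator of its
  bilinear form. Working with numerators replaces values modulo \<open>2\<close> by congruences modulo \<open>2 K d\<close>.\<close>
definition bval :: "nat \<Rightarrow> int \<Rightarrow> int \<Rightarrow> int \<Rightarrow> int \<times> int \<Rightarrow> int" where
  "bval d A B C z = A * (fst z)^2 + 2 * B * int d * fst z * snd z + C * int d * (snd z)^2"

definition bpol :: "nat \<Rightarrow> int \<Rightarrow> int \<Rightarrow> int \<Rightarrow> int \<times> int \<Rightarrow> int \<times> int \<Rightarrow> int" where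
  "bpol d A B C z w = A * fst z * fst w + B * int d * (fst z * snd w + snd z * fst w) + C * int d * snd z * snd w"

definition red :: "nat \<Rightarrow> nat \<Rightarrow> int \<times> int \<Rightarrow> int \<times> int" where
  "red K d z = (fst z mod int (K * d), snd z mod int K)"

definition comb :: "int \<times> int \<Rightarrow> int \<times> int \<Rightarrow> int \<times> int \<Rightarrow> int \<times> int" where
  "comb g h z = (fst z * fst g + snd z * fst h, fst z * snd g + snd z * snd h)"

text \<open>The parity conditions make the numerator well defined modulo \<open>2 K d\<close> (and not only modulo \<open>K d\<close>) when \<open>x\<close> is changed by
  a multiple of \<open>K d\<close> or \<open>y\<close> by a multiple of \<open>K\<close>.\<close>
definition well_defined_form :: "nat \<Rightarrow> nat \<Rightarrow> int \<Rightarrow> int \<Rightarrow> bool" where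
  "well_defined_form K d A C \<longleftrightarrow> K > 0 \<and> d > 0 \<and> even (A * int (K * d)) \<and> even (C * int K)"

text \<open>The Gram matrix \<open>(A, B d; B d, C d)\<close> has determinant \<open>d (A C - d B^2)\<close>. The factor \<open>d\<close> is inherent in the group, and
  the condition concerns the rest only.\<close>
definition nondegenerate_form :: "nat \<Rightarrow> nat \<Rightarrow> int \<Rightarrow> int \<Rightarrow> int \<Rightarrow> bool" where
  "nondegenerate_form K d A B C \<longleftrightarrow> coprime (A * C - int d * B^2) (int (K * d))"

lemma carrier_binary_quad_group:
  "K > 0 \<Longrightarrow> d > 0 \<Longrightarrow> carrier (binary_quad_group K d A B C) = {0..<int (K * d)} \<times> {0..<int K}"
  by (simp add: binary_quad_group_def gram_form_def carrier_integer_mod_group)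

lemma mult_binary_quad_group:
  "z \<otimes>\<^bsub>binary_quad_group K d A B C\<^esub> w = red K d (fst z + fst w, snd z + snd w)"
  by (simp add: binary_quad_group_def gram_form_def DirProd_def red_def split: prod.split)

lemma one_binary_quad_group: "\<one>\<^bsub>binary_quad_group K d A B C\<^esub> = (0, 0)"
  by (simp add: binary_quad_group_def gram_form_def DirProd_def)

lemma qform_binary_quad_group:
  assumes "K > 0" "d > 0"
  shows "qform (binary_quad_group K d A B C) z = mod2Z (of_int (bval d A B C z) / of_nat (K * d))"
proof -
  obtain x y where z: "z = (x, y)" by (cases z)
  have "of_int A / of_nat (K * d) * of_int (x ^ 2) + 2 * (of_int B / of_nat K) * of_int (x * y) + of_int C / of_nat K * of_int (y ^ 2)
    = (of_int (bval d A B C z) / of_nat (K * d) :: rat)"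
    using assms unfolding bval_def z by (simp add: field_simps)
  then show ?thesis unfolding binary_quad_group_def gram_form_def z by simp
qed

lemma qform_binary_quad_group_eq_iff:
  assumes "K > 0" "d > 0"
  shows "qform (binary_quad_group K d A B C) z = qform (binary_quad_group K d A' B' C') w \<longleftrightarrow>
    [bval d A B C z = bval d A' B' C' w] (mod 2 * int (K * d))"
  unfolding qform_binary_quad_group[OF assms] by (rule mod2Z_eq_iff) (use assms in simp)

lemma comm_group_binary_quad_group: "comm_group (binary_quad_group K d A B C)"
proof -
  interpret G: comm_group "integer_mod_group (K * d)" by simp
  interpret H: comm_group "integer_mod_group K" by simp
  have "comm_group (integer_mod_group (K * d) \<times>\<times> integer_mod_group K)"
    by (rule group.group_comm_groupI[OF DirProd_group]) (auto simp: add.commute)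
  then show ?thesis unfolding binary_quad_group_def gram_form_def by (rule comm_group_quad_group)
qed

lemma finite_binary_quad_group: "K > 0 \<Longrightarrow> d > 0 \<Longrightarrow> finite (carrier (binary_quad_group K d A B C))"
  by (simp add: carrier_binary_quad_group)

lemma red_in_carrier: "K > 0 \<Longrightarrow> d > 0 \<Longrightarrow> red K d z \<in> carrier (binary_quad_group K d A B C)"
  by (simp add: carrier_binary_quad_group red_def)

lemma red_id: "K > 0 \<Longrightarrow> d > 0 \<Longrightarrow> z \<in> carrier (binary_quad_group K d A B C) \<Longrightarrow> red K d z = z"
  by (cases z) (simp add: carrier_binary_quad_group red_def)

lemma red_eq_iff:
  "red K d z = red K d w \<longleftrightarrow> int (K * d) dvd fst z - fst w \<and> int K dvd snd z - snd w"
  by (simp add: red_def mod_eq_dvd_iff)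

lemma red_cong_obtain:
  assumes "red K d z = red K d w"
  obtains a b where "z = (fst w + int (K * d) * a, snd w + int K * b)"
proof -
  have dv: "int (K * d) dvd fst z - fst w" "int K dvd snd z - snd w" using assms unfolding red_eq_iff by blast+
  obtain a where "fst z - fst w = int (K * d) * a" using dv(1) by (rule dvdE)
  moreover obtain b where "snd z - snd w = int K * b" using dv(2) by (rule dvdE)
  ultimately have "z = (fst w + int (K * d) * a, snd w + int K * b)" by (simp add: prod_eq_iff)
  then show ?thesis by (rule that)
qed

lemma red_red [simp]: "red K d (red K d z) = red K d z"
  by (simp add: red_def)

lemma red_add_red:
  "red K d (fst (red K d z) + fst (red K d w), snd (red K d z) + snd (red K d w)) = red K d (fst z + fst w, snd z + snd w)"
  by (simp add: red_def mod_add_eq)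

lemma pow_binary_quad_group:
  assumes "K > 0" "d > 0"
  shows "z [^]\<^bsub>binary_quad_group K d A B C\<^esub> (j::nat) = (if j = 0 then (0,0) else red K d (int j * fst z, int j * snd z))"
proof (induction j)
  case 0
  then show ?case by (simp add: nat_pow_def one_binary_quad_group)
next
  case (Suc j)
  interpret comm_group "binary_quad_group K d A B C" by (rule comm_group_binary_quad_group)
  show ?case
    using Suc by (simp add: mult_binary_quad_group red_def mod_simps algebra_simps)
qed

lemma bval_red:
  assumes "well_defined_form K d A C" "red K d z = red K d w"
  shows "[bval d A B C z = bval d A B C w] (mod 2 * int (K * d))"
proof -
  obtain a b where z: "z = (fst w + int (K * d) * a, snd w + int K * b)"
    using red_cong_obtain[OF assms(2)] .
  have ev: "2 dvd A * int (K * d)" "2 dvd C * int K" using assms(1) unfolding well_defined_form_def by blast+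
  obtain e where e: "A * int (K * d) = 2 * e" using ev(1) by (rule dvdE)
  obtain f where f: "C * int K = 2 * f" using ev(2) by (rule dvdE)
  have "bval d A B C z - bval d A B C w =
      2 * int (K * d) * (A * fst w * a + B * int d * snd w * a + B * fst w * b + B * int d * int K * a * b + C * snd w * b)
      + (A * int (K * d)) * int (K * d) * a^2 + (C * int K) * int (K * d) * b^2"
    unfolding z bval_def by (simp add: algebra_simps power2_eq_square)
  also have "\<dots> = 2 * int (K * d) * (A * fst w * a + B * int d * snd w * a + B * fst w * b
      + B * int d * int K * a * b + C * snd w * b + e * a^2 + f * b^2)"
    unfolding e f by (simp add: algebra_simps power2_eq_square)
  finally show ?thesis by (simp add: cong_iff_dvd_diff)
qed

lemma bval_comb:
  "bval d A B C (comb g h z) = (fst z)^2 * bval d A B C g + 2 * fst z * snd z * bpol d A B C g h + (snd z)^2 * bval d A B C h"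
  unfolding bval_def bpol_def comb_def by (simp add: algebra_simps power2_eq_square)

text \<open>The vectors \<open>g\<close>, \<open>h\<close> have the lengths and the inner product of the standard generators of the form with coefficients
  \<open>A'\<close>, \<open>B'\<close>, \<open>C'\<close>. Divisibility of the first coordinate of \<open>h\<close> by \<open>d\<close> means that \<open>h\<close> has order dividing \<open>K\<close>, like
  the second generator.\<close>
definition frame :: "nat \<Rightarrow> nat \<Rightarrow> int \<Rightarrow> int \<Rightarrow> int \<Rightarrow> int \<Rightarrow> int \<Rightarrow> int \<Rightarrow> int \<times> int \<Rightarrow> int \<times> int \<Rightarrow> bool" where
  "frame K d A B C A' B' C' g h \<longleftrightarrow> int d dvd fst h \<and>
     [bval d A B C g = A'] (mod 2 * int (K * d)) \<and>
     [bpol d A B C g h = B' * int d] (mod int (K * d)) \<and>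
     [bval d A B C h = C' * int d] (mod 2 * int (K * d))"

lemma red_comb_red:
  assumes "int d dvd fst h" "red K d z = red K d w"
  shows "red K d (comb g h z) = red K d (comb g h w)"
proof -
  obtain a b where z: "z = (fst w + int (K * d) * a, snd w + int K * b)"
    using red_cong_obtain[OF assms(2)] .
  obtain e where e: "fst h = int d * e" using assms(1) by (rule dvdE)
  have "fst (comb g h z) - fst (comb g h w) = int (K * d) * (a * fst g + b * e)"
    unfolding z comb_def by (simp add: e algebra_simps)
  moreover have "snd (comb g h z) - snd (comb g h w) = int K * (int d * a * snd g + b * snd h)"
    unfolding z comb_def by (simp add: algebra_simps)
  ultimately show ?thesis unfolding red_eq_iff by simp
qed

text \<open>Cramer's rule: suitable combinations of the two congruences isolate \<open>i\<close> and \<open>j\<close>, multiplied by the unit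
  \<open>A C - d B^2\<close>.\<close>
lemma nondegenerate_kernel:
  assumes nd: "nondegenerate_form K d A B C" and d: "d > 0"
    and 1: "int (K * d) dvd i * A + j * (B * int d)" and 2: "int (K * d) dvd i * (B * int d) + j * (C * int d)"
  shows "int (K * d) dvd i \<and> int K dvd j"
proof -
  have "int d * int K dvd int d * (i * B + j * C)" using 2 by (simp add: algebra_simps)
  then have 3: "int K dvd i * B + j * C" using d by (simp add: dvd_mult_cancel_left)
  have cop: "coprime (int (K * d)) (A * C - int d * B^2)"
    using nd by (simp only: nondegenerate_form_def coprime_commute)
  then have copK: "coprime (int K) (A * C - int d * B^2)" by simp
  have "int (K * d) dvd C * (i * A + j * (B * int d)) - B * (i * (B * int d) + j * (C * int d))"
    by (rule dvd_diff[OF dvd_mult[OF 1] dvd_mult[OF 2]])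
  moreover have "C * (i * A + j * (B * int d)) - B * (i * (B * int d) + j * (C * int d)) = (A * C - int d * B^2) * i"
    by (simp add: algebra_simps power2_eq_square)
  ultimately have "int (K * d) dvd i" using coprime_dvd_mult_right_iff[OF cop] by metis
  moreover have "int K dvd i * A + j * (B * int d)" using 1 dvd_trans[of "int K" "int (K * d)"] by simp
  then have "int K dvd A * (i * B + j * C) - B * (i * A + j * (B * int d))"
    by (intro dvd_diff dvd_mult 3)
  moreover have "A * (i * B + j * C) - B * (i * A + j * (B * int d)) = (A * C - int d * B^2) * j"
    by (simp add: algebra_simps power2_eq_square)
  ultimately show ?thesis using coprime_dvd_mult_right_iff[OF copK] by metis
qed

text \<open>A map that preserves a nondegenerate form has trivial kernel, so on a finite group it is an isomorphism.\<close>
lemma frame_isometry: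
  assumes wd: "well_defined_form K d A C" and nd: "nondegenerate_form K d A' B' C'"
    and fr: "frame K d A B C A' B' C' g h"
  defines "f \<equiv> \<lambda>z. red K d (comb g h z)"
  shows "f \<in> iso (binary_quad_group K d A' B' C') (binary_quad_group K d A B C)"
    and "qform (binary_quad_group K d A B C) (f z) = qform (binary_quad_group K d A' B' C') z"
proof -
  have K: "K > 0" and d: "d > 0" using wd by (simp_all add: well_defined_form_def)
  have dh: "int d dvd fst h" and gg: "[bval d A B C g = A'] (mod 2 * int (K * d))"
    and gh: "[bpol d A B C g h = B' * int d] (mod int (K * d))"
    and hh: "[bval d A B C h = C' * int d] (mod 2 * int (K * d))"
    using fr by (simp_all add: frame_def)
  let ?C = "carrier (binary_quad_group K d A B C)"
  have C': "carrier (binary_quad_group K d A' B' C') = ?C" by (simp add: carrier_binary_quad_group[OF K d])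
  have fC: "f z \<in> ?C" for z unfolding f_def by (rule red_in_carrier[OF K d])
  have hom: "f (x \<otimes>\<^bsub>binary_quad_group K d A' B' C'\<^esub> y) = f x \<otimes>\<^bsub>binary_quad_group K d A B C\<^esub> f y" for x y
  proof -
    have "f (x \<otimes>\<^bsub>binary_quad_group K d A' B' C'\<^esub> y) = f (fst x + fst y, snd x + snd y)"
      unfolding mult_binary_quad_group f_def by (rule red_comb_red[OF dh]) simp
    also have "\<dots> = f x \<otimes>\<^bsub>binary_quad_group K d A B C\<^esub> f y"
      unfolding mult_binary_quad_group f_def red_add_red by (simp add: comb_def algebra_simps)
    finally show ?thesis .
  qed
  have inj: "inj_on f ?C"
  proof (rule inj_onI)
    fix x y assume x: "x \<in> ?C" and y: "y \<in> ?C" and eq: "f x = f y"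
    define i where "i = fst x - fst y"
    define j where "j = snd x - snd y"
    obtain a b where "comb g h x = (fst (comb g h y) + int (K * d) * a, snd (comb g h y) + int K * b)"
      using red_cong_obtain[OF eq[unfolded f_def]] .
    then have a: "i * fst g + j * fst h = int (K * d) * a" and b: "i * snd g + j * snd h = int K * b"
      by (simp_all add: comb_def i_def j_def algebra_simps)
    obtain e where e: "fst h = int d * e" using dh by (rule dvdE)
    \<comment> \<open>a vector in the kernel is orthogonal to the images g and h\<close>
    have "i * bval d A B C g + j * bpol d A B C g h =
        A * fst g * (i * fst g + j * fst h) + B * int d * (fst g * (i * snd g + j * snd h) + snd g * (i * fst g + j * fst h))
        + C * int d * snd g * (i * snd g + j * snd h)"
      by (simp add: bval_def bpol_def algebra_simps power2_eq_square)
    also have "\<dots> = int (K * d) * (A * fst g * a + B * fst g * b + B * int d * snd g * a + C * snd g * b)"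
      unfolding a b by (simp add: algebra_simps)
    finally have "int (K * d) dvd i * bval d A B C g + j * bpol d A B C g h" by simp
    moreover have "[i * bval d A B C g + j * bpol d A B C g h = i * A' + j * (B' * int d)] (mod int (K * d))"
      by (rule cong_add[OF cong_mult[OF cong_refl cong_dvd_modulus[OF gg]] cong_mult[OF cong_refl gh]]) simp
    ultimately have 1: "int (K * d) dvd i * A' + j * (B' * int d)" using cong_dvd_iff by blast
    have "i * bpol d A B C g h + j * bval d A B C h =
        A * fst h * (i * fst g + j * fst h) + B * int d * (fst h * (i * snd g + j * snd h) + snd h * (i * fst g + j * fst h))
        + C * int d * snd h * (i * snd g + j * snd h)"
      by (simp add: bval_def bpol_def algebra_simps power2_eq_square)
    also have "\<dots> = int (K * d) * (A * fst h * a + B * fst h * b + B * int d * snd h * a + C * snd h * b)"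
      unfolding a b by (simp add: algebra_simps)
    finally have "int (K * d) dvd i * bpol d A B C g h + j * bval d A B C h" by simp
    moreover have "[i * bpol d A B C g h + j * bval d A B C h = i * (B' * int d) + j * (C' * int d)] (mod int (K * d))"
      by (rule cong_add[OF cong_mult[OF cong_refl gh] cong_mult[OF cong_refl cong_dvd_modulus[OF hh]]]) simp
    ultimately have 2: "int (K * d) dvd i * (B' * int d) + j * (C' * int d)" using cong_dvd_iff by blast
    have "red K d x = red K d y"
      using nondegenerate_kernel[OF nd d 1 2] unfolding red_eq_iff i_def j_def .
    then show "x = y" using red_id[OF K d x] red_id[OF K d y] by simp
  qed
  have "f ` ?C = ?C" by (rule endo_inj_surj[OF finite_binary_quad_group[OF K d] _ inj]) (use fC in blast)
  then have "bij_betw f ?C ?C" using inj by (simp add: bij_betw_def)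
  then show "f \<in> iso (binary_quad_group K d A' B' C') (binary_quad_group K d A B C)"
    unfolding iso_def hom_def C' using fC hom by blast
  show "qform (binary_quad_group K d A B C) (f z) = qform (binary_quad_group K d A' B' C') z"
    unfolding qform_binary_quad_group_eq_iff[OF K d]
  proof -
    have "[bval d A B C (f z) = bval d A B C (comb g h z)] (mod 2 * int (K * d))"
      unfolding f_def by (rule bval_red[OF wd]) simp
    also have "[bval d A B C (comb g h z) = (fst z)^2 * A' + 2 * fst z * snd z * (B' * int d) + (snd z)^2 * (C' * int d)] (mod 2 * int (K * d))"
      unfolding bval_comb
    proof (intro cong_add cong_mult[OF cong_refl gg] cong_mult[OF cong_refl hh])
      have "2 * int (K * d) dvd 2 * (bpol d A B C g h - B' * int d)"
        using gh unfolding cong_iff_dvd_diff by (rule mult_dvd_mono[OF dvd_refl])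
      then have "2 * int (K * d) dvd (fst z * snd z) * (2 * (bpol d A B C g h - B' * int d))" by (rule dvd_mult)
      then show "[2 * fst z * snd z * bpol d A B C g h = 2 * fst z * snd z * (B' * int d)] (mod 2 * int (K * d))"
        unfolding cong_iff_dvd_diff by (simp add: algebra_simps)
    qed
    finally show "[bval d A B C (f z) = bval d A' B' C' z] (mod 2 * int (K * d))"
      by (simp add: bval_def algebra_simps)
  qed
qed

lemma quad_isomorphic_of_frame:
  assumes "well_defined_form K d A C" "nondegenerate_form K d A' B' C'" "frame K d A B C A' B' C' g h"
  shows "quad_isomorphic (binary_quad_group K d A' B' C') (binary_quad_group K d A B C)"
  unfolding quad_isomorphic_def
  by (rule bexI[OF _ frame_isometry(1)[OF assms]]) (simp add: frame_isometry(2)[OF assms])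

text \<open>An isometry is determined by the images of the standard generators. These form a frame: the inner product is
  recovered from the value of the form at the sum of the two generators.\<close>
lemma card_isometry_group_frames:
  assumes wd: "well_defined_form K d A C" and nd: "nondegenerate_form K d A B C"
  defines "X \<equiv> {0..<int (K * d)} \<times> {0..<int K}"
  shows "card (isometry_group (binary_quad_group K d A B C)) = card {(g,h)\<in>X\<times>X. frame K d A B C A B C g h}"
proof -
  let ?G = "binary_quad_group K d A B C"
  have K: "K > 0" and d: "d > 0" using wd by (simp_all add: well_defined_form_def)
  have X: "carrier ?G = X" unfolding X_def by (rule carrier_binary_quad_group[OF K d])
  interpret G: comm_group ?G by (rule comm_group_binary_quad_group)
  let ?F = "\<lambda>(g,h). restrict (\<lambda>z. red K d (comb g h z)) X"
  let ?S = "{(g,h)\<in>X\<times>X. frame K d A B C A B C g h}"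
  \<comment> \<open>for K = 1 the generator (0, 1) is not reduced, and for K d = 1 neither is (1, 0)\<close>
  define e1 where "e1 = red K d (1, 0)"
  define e2 where "e2 = red K d (0, 1)"
  have eX: "e1 \<in> X" "e2 \<in> X" unfolding e1_def e2_def X[symmetric] by (rule red_in_carrier[OF K d])+
  have redX: "red K d z = z" if "z \<in> X" for z using red_id[OF K d, of z A B C] that X by simp
  have "bij_betw ?F ?S (isometry_group ?G)"
  proof (rule bij_betw_imageI)
    show "inj_on ?F ?S"
    proof (rule inj_onI)
      fix s t assume s: "s \<in> ?S" and t: "t \<in> ?S" and eq: "?F s = ?F t"
      obtain g h g' h' where gh: "s = (g,h)" "t = (g',h')" by (metis surj_pair)
      have m: "g \<in> X" "h \<in> X" "g' \<in> X" "h' \<in> X" and dh: "int d dvd fst h" "int d dvd fst h'"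
        using s t gh by (auto simp: frame_def)
      have ev1: "red K d (comb g h e1) = g" if "int d dvd fst h" "g \<in> X" for g h
      proof -
        have "red K d (comb g h e1) = red K d (comb g h (1,0))"
          by (rule red_comb_red[OF that(1)]) (simp add: e1_def)
        then show ?thesis using redX[OF that(2)] by (simp add: comb_def)
      qed
      have ev2: "red K d (comb g h e2) = h" if "int d dvd fst h" "h \<in> X" for g h
      proof -
        have "red K d (comb g h e2) = red K d (comb g h (0,1))"
          by (rule red_comb_red[OF that(1)]) (simp add: e2_def)
        then show ?thesis using redX[OF that(2)] by (simp add: comb_def)
      qed
      have eqz: "red K d (comb g h z) = red K d (comb g' h' z)" if "z \<in> X" for z
        using fun_cong[OF eq, of z] that gh by simp
      have "g = g'" using eqz[OF eX(1)] ev1[OF dh(1) m(1)] ev1[OF dh(2) m(3)] by simp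
      moreover have "h = h'" using eqz[OF eX(2)] ev2[OF dh(1) m(2)] ev2[OF dh(2) m(4)] by simp
      ultimately show "s = t" using gh by simp
    qed
    show "?F ` ?S = isometry_group ?G"
    proof (intro equalityI subsetI)
      fix f assume "f \<in> ?F ` ?S"
      then obtain g h where gh: "frame K d A B C A B C g h" "f = restrict (\<lambda>z. red K d (comb g h z)) X" by auto
      have "f \<in> iso ?G ?G"
        by (rule G.iso_eq[OF frame_isometry(1)[OF wd nd gh(1)]]) (simp add: gh(2) X)
      then show "f \<in> isometry_group ?G"
        using frame_isometry(2)[OF wd nd gh(1)] by (simp add: isometry_group_iff gh(2) X)
    next
      fix f assume f: "f \<in> isometry_group ?G"
      have fX: "f x \<in> X" if "x \<in> X" for x using f that X by (auto simp: isometry_group_iff iso_def hom_def)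
      have fm: "f (x \<otimes>\<^bsub>?G\<^esub> y) = f x \<otimes>\<^bsub>?G\<^esub> f y" if "x \<in> X" "y \<in> X" for x y
        using f that X by (auto simp: isometry_group_iff iso_def hom_def)
      have fq: "[bval d A B C (f x) = bval d A B C x] (mod 2 * int (K * d))" if "x \<in> X" for x
        using f that X unfolding qform_binary_quad_group_eq_iff[OF K d, symmetric] by (auto simp: isometry_group_iff)
      define g where "g = f e1"
      define h where "h = f e2"
      have ghX: "g \<in> X" "h \<in> X" unfolding g_def h_def using fX eX by blast+
      have fh: "f \<in> hom ?G ?G" using f by (auto simp: isometry_group_iff iso_def)
      have pow_red: "z [^]\<^bsub>?G\<^esub> j = red K d (int j * fst z, int j * snd z)" for z j
        unfolding pow_binary_quad_group[OF K d] by (simp add: red_def)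
      have fz: "f z = red K d (comb g h z)" if z: "z \<in> X" for z
      proof -
        obtain i j where ij: "z = (int i, int j)"
        proof
          show "z = (int (nat (fst z)), int (nat (snd z)))" using z unfolding X_def by (cases z) simp
        qed
        have "e1 [^]\<^bsub>?G\<^esub> i \<otimes>\<^bsub>?G\<^esub> e2 [^]\<^bsub>?G\<^esub> j = red K d z"
          unfolding pow_red mult_binary_quad_group ij by (simp add: red_def e1_def e2_def mod_simps)
        then have "f z = f (e1 [^]\<^bsub>?G\<^esub> i \<otimes>\<^bsub>?G\<^esub> e2 [^]\<^bsub>?G\<^esub> j)" using redX[OF z] by simp
        also have "\<dots> = f (e1 [^]\<^bsub>?G\<^esub> i) \<otimes>\<^bsub>?G\<^esub> f (e2 [^]\<^bsub>?G\<^esub> j)"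
          by (rule fm) (use eX X G.nat_pow_closed in auto)
        also have "f (e1 [^]\<^bsub>?G\<^esub> i) = g [^]\<^bsub>?G\<^esub> i" unfolding g_def
          by (rule hom_nat_pow[OF fh _ G.is_group G.is_group]) (use eX X in simp)
        also have "f (e2 [^]\<^bsub>?G\<^esub> j) = h [^]\<^bsub>?G\<^esub> j" unfolding h_def
          by (rule hom_nat_pow[OF fh _ G.is_group G.is_group]) (use eX X in simp)
        finally show ?thesis unfolding pow_red mult_binary_quad_group ij
          by (simp add: red_def comb_def mod_simps)
      qed
      \<comment> \<open>the second generator has order dividing K, and so has its image\<close>
      have dh: "int d dvd fst h"
      proof -
        have "e2 [^]\<^bsub>?G\<^esub> K = red K d (0, 0)" unfolding pow_red by (simp add: red_def e2_def mod_simps)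
        then have "e2 [^]\<^bsub>?G\<^esub> K = \<one>\<^bsub>?G\<^esub>" by (simp add: red_def one_binary_quad_group)
        moreover have "f (e2 [^]\<^bsub>?G\<^esub> K) = h [^]\<^bsub>?G\<^esub> K" unfolding h_def
          by (rule hom_nat_pow[OF fh _ G.is_group G.is_group]) (use eX X in simp)
        moreover have "f \<one>\<^bsub>?G\<^esub> = \<one>\<^bsub>?G\<^esub>" by (rule hom_one[OF fh G.is_group G.is_group])
        ultimately have "red K d (int K * fst h, int K * snd h) = (0,0)"
          unfolding pow_red by (simp add: one_binary_quad_group)
        then have "int K * int d dvd int K * fst h" by (auto simp: red_def)
        then show ?thesis using K by simp
      qed
      have gg: "[bval d A B C g = A] (mod 2 * int (K * d))"
      proof -
        have "[bval d A B C g = bval d A B C e1] (mod 2 * int (K * d))" unfolding g_def by (rule fq[OF eX(1)])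
        also have "[bval d A B C e1 = bval d A B C (1,0)] (mod 2 * int (K * d))"
          by (rule bval_red[OF wd]) (simp add: e1_def)
        finally show ?thesis by (simp add: bval_def)
      qed
      have hh: "[bval d A B C h = C * int d] (mod 2 * int (K * d))"
      proof -
        have "[bval d A B C h = bval d A B C e2] (mod 2 * int (K * d))" unfolding h_def by (rule fq[OF eX(2)])
        also have "[bval d A B C e2 = bval d A B C (0,1)] (mod 2 * int (K * d))"
          by (rule bval_red[OF wd]) (simp add: e2_def)
        finally show ?thesis by (simp add: bval_def)
      qed
      have gh: "[bpol d A B C g h = B * int d] (mod int (K * d))"
      proof -
        let ?e = "red K d (1,1)"
        have e: "?e \<in> X" unfolding X[symmetric] by (rule red_in_carrier[OF K d])
        have "f ?e = red K d (comb g h (1,1))" unfolding fz[OF e] by (rule red_comb_red[OF dh]) simp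
        then have "[bval d A B C (f ?e) = bval d A B C (comb g h (1,1))] (mod 2 * int (K * d))"
          by (intro bval_red[OF wd]) simp
        moreover have "[bval d A B C (f ?e) = bval d A B C ?e] (mod 2 * int (K * d))" by (rule fq[OF e])
        moreover have "[bval d A B C ?e = bval d A B C (1,1)] (mod 2 * int (K * d))"
          by (rule bval_red[OF wd]) simp
        ultimately have "[bval d A B C (comb g h (1,1)) = bval d A B C (1,1)] (mod 2 * int (K * d))"
          by (simp add: cong_def)
        then have 1: "2 * int (K * d) dvd bval d A B C (comb g h (1,1)) - bval d A B C (1,1)"
          by (simp only: cong_iff_dvd_diff)
        have "bval d A B C (comb g h (1,1)) - bval d A B C (1,1) - (bval d A B C g - A) - (bval d A B C h - C * int d)
          = 2 * (bpol d A B C g h - B * int d)"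
          unfolding bval_comb by (simp add: bval_def algebra_simps)
        moreover have "2 * int (K * d) dvd bval d A B C (comb g h (1,1)) - bval d A B C (1,1) - (bval d A B C g - A) - (bval d A B C h - C * int d)"
          by (rule dvd_diff[OF dvd_diff[OF 1 gg[unfolded cong_iff_dvd_diff]] hh[unfolded cong_iff_dvd_diff]])
        ultimately have "2 * int (K * d) dvd 2 * (bpol d A B C g h - B * int d)" by simp
        then show ?thesis unfolding cong_iff_dvd_diff dvd_mult_cancel_left by simp
      qed
      have fr: "frame K d A B C A B C g h" unfolding frame_def using dh gg gh hh by blast
      have "f = ?F (g,h)"
      proof (rule extensionalityI[of _ X])
        show "f \<in> extensional X" using f X by (auto simp: isometry_group_iff)
        fix x assume "x \<in> X"
        then show "f x = ?F (g,h) x" using fz by simp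
      qed simp
      then show "f \<in> ?F ` ?S" using fr ghX by (intro image_eqI[of _ _ "(g,h)"]) auto
    qed
  qed
  then show ?thesis by (rule bij_betw_same_card[symmetric])
qed

section \<open>Isometry groups of the normal forms\<close>

text \<open>The parameter \<open>\<epsilon>\<close> is \<open>1\<close> for \<open>p = 2\<close> and \<open>0\<close> for odd \<open>p\<close>. It records that squaring gains one power of \<open>2\<close>,
  which allows both cases to be treated together.\<close>
lemma cong_square_refine:
  fixes p i j :: int
  assumes "[i = j] (mod p ^ k)" "\<epsilon> = 0 \<or> \<epsilon> = 1 \<and> p = 2 \<and> k \<ge> 1"
  shows "[i^2 = j^2] (mod p ^ (k + \<epsilon>))"
proof (cases "\<epsilon> = 0")
  case True
  then show ?thesis using cong_pow[OF assms(1), of 2] by simp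
next
  case False
  then have e: "\<epsilon> = 1" "p = 2" "k \<ge> 1" using assms(2) by auto
  obtain a where a: "i - j = 2^k * a" using assms(1) unfolding e cong_iff_dvd_diff by (rule dvdE)
  obtain n where n: "k = Suc n" using e(3) by (cases k) auto
  have "i = j + 2^k * a" using a by simp
  then have "i^2 - j^2 = 2^(k+1) * (a * j + 2^n * a^2)" unfolding n by (simp add: power2_eq_square algebra_simps)
  then show ?thesis unfolding e cong_iff_dvd_diff by simp
qed

lemma cong_cancel_unit_pair:
  fixes p x y t s :: int
  assumes p: "prime p" and xy: "k = 0 \<or> \<not> p dvd x \<or> \<not> p dvd y"
    and "[t * x = s * x] (mod p^k)" "[t * y = s * y] (mod p^k)"
  shows "[t = s] (mod p^k)"
proof -
  have "k = 0 \<or> coprime x (p^k) \<or> coprime y (p^k)" using coprime_prime_power[OF p] xy by blast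
  then show ?thesis
    using assms(3,4) cong_mult_rcancel[of x "p^k" t s] cong_mult_rcancel[of y "p^k" t s] by (auto simp: cong_iff_dvd_diff)
qed

text \<open>The orthogonal complement of a vector with a unit coordinate in a unimodular plane is free of rank one. It is
  spanned by \<open>(x, - y w / u)\<close> in the coordinates \<open>(i, j)\<close>.\<close>
lemma orthogonal_parameter_ex:
  fixes p u w x y i j :: int
  assumes p: "prime p" and u: "\<not> p dvd u" and w: "\<not> p dvd w" and xy: "k = 0 \<or> \<not> p dvd x \<or> \<not> p dvd y"
    and v: "[u * v = 1] (mod p^k)" and orth: "[u * x * j + w * y * i = 0] (mod p^k)"
  shows "\<exists>t. [i = t * x] (mod p^k) \<and> [j = - (t * y * w * v)] (mod p^k)"
proof -
  have solve_j: "[j = - (t * y * w * v)] (mod p^k)" if "[u * j = - (w * y * t)] (mod p^k)" for t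
  proof -
    have "[j = v * (- (w * y * t))] (mod p^k)" using that cong_divide_unit[OF v] by blast
    moreover have "v * (- (w * y * t)) = - (t * y * w * v)" by (simp add: algebra_simps)
    ultimately show ?thesis by (simp only:)
  qed
  have orth': "p^k dvd u * x * j + w * y * i" using orth by (simp add: cong_0_iff)
  consider "k = 0" | "\<not> p dvd x" | "\<not> p dvd y" using xy by blast
  then show ?thesis
  proof cases
    case 1
    then show ?thesis by simp
  next
    case 2
    obtain x' where x': "[x * x' = 1] (mod p^k)" using prime_power_inverse_ex[OF p 2] by blast
    define t where "t = x' * i"
    have "[x * t = 1 * i] (mod p^k)" unfolding t_def mult.assoc[symmetric] by (rule cong_mult[OF x' cong_refl])
    then have i: "[i = t * x] (mod p^k)" by (simp add: cong_sym_eq mult.commute)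
    have "p^k dvd (u * x * j + w * y * i) - w * y * (i - t * x)"
      using i unfolding cong_iff_dvd_diff by (rule dvd_diff[OF orth' dvd_mult])
    then have "p^k dvd x * (u * j + w * y * t)" by (simp add: algebra_simps)
    moreover have "coprime (p^k) x" using coprime_prime_power[OF p 2] by (simp only: coprime_commute)
    ultimately have "p^k dvd u * j + w * y * t" using coprime_dvd_mult_right_iff by blast
    then have "[u * j = - (w * y * t)] (mod p^k)" by (simp add: cong_iff_dvd_diff)
    from solve_j[OF this] i show ?thesis by blast
  next
    case 3
    have wy: "\<not> p dvd w * y" using 3 w prime_dvd_multD[OF p] by blast
    obtain z where z: "[(w * y) * z = 1] (mod p^k)" using prime_power_inverse_ex[OF p wy] by blast
    define t where "t = - (z * (u * j))"
    have "[(w * y) * z * (u * j) = 1 * (u * j)] (mod p^k)" by (rule cong_mult[OF z cong_refl])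
    then have "p^k dvd (w * y) * z * (u * j) - u * j" by (simp add: cong_iff_dvd_diff)
    moreover have "w * y * t + u * j = - ((w * y) * z * (u * j) - u * j)" by (simp add: t_def algebra_simps)
    ultimately have wyt: "p^k dvd w * y * t + u * j" by (simp only: dvd_minus_iff)
    then have "[u * j = - (w * y * t)] (mod p^k)" by (simp add: cong_iff_dvd_diff add.commute)
    note j = solve_j[OF this]
    have "p^k dvd (u * x * j + w * y * i) - x * (w * y * t + u * j)"
      by (rule dvd_diff[OF orth' dvd_mult[OF wyt]])
    then have "p^k dvd (w * y) * (i - t * x)" by (simp add: algebra_simps)
    moreover have "coprime (p^k) (w * y)" using coprime_prime_power[OF p wy] by (simp only: coprime_commute)
    ultimately have "p^k dvd i - t * x" using coprime_dvd_mult_right_iff by blast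
    then show ?thesis using j by (auto simp: cong_iff_dvd_diff)
  qed
qed

text \<open>After the substitution \<open>z = p^r j\<close>, the vectors \<open>(i, j)\<close> orthogonal to the given one are the multiples by
  \<open>t\<close> of \<open>(x, - y w / u)\<close>. The length of the multiple is \<open>t^2 w\<close> times the value of the conic at \<open>(x, y)\<close>, divided by \<open>u\<close>, that is
  \<open>t^2 w\<close>, up to the common factor \<open>p^r\<close>. So the condition on the length is \<open>t^2 = 1\<close>.\<close>
lemma card_orthogonal_vectors:
  fixes p u w x y :: int
  assumes p: "prime p" and u: "\<not> p dvd u" and w: "\<not> p dvd w"
    and eps: "\<epsilon> = 0 \<or> \<epsilon> = 1 \<and> p = 2 \<and> k \<ge> 1"
    and xy: "[u * x^2 + w * p^r * y^2 = u] (mod p^(k+r+\<epsilon>))"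
  shows "card {(z,i)\<in>{0..<p^(k+r)}\<times>{0..<p^k}. p^r dvd z \<and> [u * x * z + w * p^r * y * i = 0] (mod p^(k+r)) \<and>
      [u * z^2 + w * p^r * i^2 = w * p^r] (mod p^(k+r+\<epsilon>))}
    = card {t\<in>{0..<p^k}. [t^2 = 1] (mod p^(k+\<epsilon>))}"
proof -
  let ?K = "p^k" and ?d = "p^r"
  have p0: "p > 0" using p by (simp add: prime_gt_0_int)
  have d0: "?d > 0" "?K > 0" using p0 by simp_all
  obtain v where v: "[u * v = 1] (mod p^(k+\<epsilon>))" using prime_power_inverse_ex[OF p u] by blast
  have Kdvd: "?K dvd p^(k+\<epsilon>)" by (simp add: power_add)
  have vK: "[u * v = 1] (mod ?K)" by (rule cong_dvd_modulus[OF v Kdvd])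
  have xyK: "[u * x^2 + w * ?d * y^2 = u] (mod p^(k+\<epsilon>))"
    by (rule cong_dvd_modulus[OF xy]) (simp add: power_add)
  \<comment> \<open>otherwise p would divide u\<close>
  have unit: "k = 0 \<or> \<not> p dvd x \<or> \<not> p dvd y"
  proof (rule ccontr)
    assume "\<not> ?thesis"
    then have h: "k \<noteq> 0" "p dvd x" "p dvd y" by auto
    have "p dvd ?K" using h(1) by (simp add: dvd_power)
    then have "[u * x^2 + w * ?d * y^2 = u] (mod p)" using cong_dvd_modulus[OF xyK] Kdvd dvd_trans by blast
    moreover have "p dvd u * x^2 + w * ?d * y^2" using h(2,3) by (simp add: power2_eq_square)
    ultimately show False using u cong_dvd_iff by blast
  qed
  have divide_d: "[?d * a = ?d * b] (mod p^(n+r)) \<longleftrightarrow> [a = b] (mod p^n)" for a b n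
  proof -
    have "[?d * a = ?d * b] (mod p^(n+r)) \<longleftrightarrow> ?d * p^n dvd ?d * (a - b)"
      unfolding cong_iff_dvd_diff by (simp add: power_add algebra_simps)
    also have "\<dots> \<longleftrightarrow> [a = b] (mod p^n)" unfolding cong_iff_dvd_diff using p0 by (simp add: dvd_mult_cancel_left)
    finally show ?thesis .
  qed
  have norm: "[u * ?d * j^2 + w * i^2 = w * t^2] (mod p^(k+\<epsilon>))"
    if i: "[i = t * x] (mod ?K)" and j: "[j = - (t * y * w * v)] (mod ?K)" for i j t
  proof -
    have "[u * ?d * j^2 + w * i^2 = u * ?d * (- (t * y * w * v))^2 + w * (t * x)^2] (mod p^(k+\<epsilon>))"
      by (rule cong_add[OF cong_mult[OF cong_refl cong_square_refine[OF j eps]] cong_mult[OF cong_refl cong_square_refine[OF i eps]]])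
    moreover have "[u * ?d * (- (t * y * w * v))^2 + w * (t * x)^2 = w * t^2] (mod p^(k+\<epsilon>))"
    proof -
      have "u * ?d * (- (t * y * w * v))^2 + w * (t * x)^2 - w * t^2 =
         (u * v - 1) * (?d * t^2 * y^2 * w^2 * v - w * t^2 * x^2 + w * t^2) + w * t^2 * v * (u * x^2 + w * ?d * y^2 - u)"
        by (simp add: power2_eq_square algebra_simps)
      then show ?thesis using v xyK unfolding cong_iff_dvd_diff by simp
    qed
    ultimately show ?thesis by (rule cong_trans)
  qed
  have cancel_w: "[w * t^2 = w] (mod p^(k+\<epsilon>)) \<longleftrightarrow> [t^2 = 1] (mod p^(k+\<epsilon>))" for t
    using cong_mult_lcancel[OF coprime_prime_power[OF p w], of "t^2" 1] by (simp only: mult_1_right)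
  let ?T = "{t\<in>{0..<?K}. [t^2 = 1] (mod p^(k+\<epsilon>))}"
  let ?H = "{(z,i)\<in>{0..<p^(k+r)}\<times>{0..<?K}. ?d dvd z \<and> [u * x * z + w * ?d * y * i = 0] (mod p^(k+r)) \<and>
      [u * z^2 + w * ?d * i^2 = w * ?d] (mod p^(k+r+\<epsilon>))}"
  let ?f = "\<lambda>t. (?d * ((- (t * y * w * v)) mod ?K), (t * x) mod ?K)"
  have condH: "[u * x * (?d * j) + w * ?d * y * i = 0] (mod p^(k+r)) \<longleftrightarrow> [u * x * j + w * y * i = 0] (mod ?K)"
    "[u * (?d * j)^2 + w * ?d * i^2 = w * ?d] (mod p^(k+r+\<epsilon>)) \<longleftrightarrow> [u * ?d * j^2 + w * i^2 = w] (mod p^(k+\<epsilon>))" for j i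
  proof -
    have "u * x * (?d * j) + w * ?d * y * i = ?d * (u * x * j + w * y * i)" by (simp add: algebra_simps)
    then show "[u * x * (?d * j) + w * ?d * y * i = 0] (mod p^(k+r)) \<longleftrightarrow> [u * x * j + w * y * i = 0] (mod ?K)"
      using divide_d[of "u * x * j + w * y * i" 0 k] by simp
    have "u * (?d * j)^2 + w * ?d * i^2 = ?d * (u * ?d * j^2 + w * i^2)" by (simp add: power2_eq_square algebra_simps)
    moreover have "k + r + \<epsilon> = (k + \<epsilon>) + r" by simp
    ultimately show "[u * (?d * j)^2 + w * ?d * i^2 = w * ?d] (mod p^(k+r+\<epsilon>)) \<longleftrightarrow> [u * ?d * j^2 + w * i^2 = w] (mod p^(k+\<epsilon>))"
      using divide_d[of "u * ?d * j^2 + w * i^2" w "k + \<epsilon>"] by (simp only: mult.commute[of w])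
  qed
  have "bij_betw ?f ?T ?H"
  proof (rule bij_betw_imageI)
    show "inj_on ?f ?T"
    proof (rule inj_onI)
      fix t s assume t: "t \<in> ?T" and s: "s \<in> ?T" and eq: "?f t = ?f s"
      have 1: "[t * x = s * x] (mod ?K)" using eq by (simp add: cong_def)
      have "[- (t * y * w * v) = - (s * y * w * v)] (mod ?K)" using eq p0 by (simp add: cong_def)
      then have "[u * (- (t * y * w * v)) = u * (- (s * y * w * v))] (mod ?K)" by (rule cong_mult[OF cong_refl])
      then have "?K dvd (u * v) * (w * (s * y - t * y))" by (simp add: cong_iff_dvd_diff algebra_simps)
      moreover have "?K dvd (u * v - 1) * (w * (s * y - t * y))" using vK by (simp add: cong_iff_dvd_diff)
      ultimately have "?K dvd (u * v) * (w * (s * y - t * y)) - (u * v - 1) * (w * (s * y - t * y))" by (rule dvd_diff)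
      then have "?K dvd w * (s * y - t * y)" by (simp add: algebra_simps)
      moreover have "coprime ?K w" using coprime_prime_power[OF p w] by (simp only: coprime_commute)
      ultimately have "?K dvd s * y - t * y" using coprime_dvd_mult_right_iff by blast
      then have 2: "[t * y = s * y] (mod ?K)" by (simp add: cong_iff_dvd_diff dvd_diff_commute)
      have "[t = s] (mod ?K)" by (rule cong_cancel_unit_pair[OF p unit 1 2])
      then show "t = s" using t s by (simp add: cong_def)
    qed
    show "?f ` ?T = ?H"
    proof (intro equalityI subsetI)
      fix h assume "h \<in> ?f ` ?T"
      then obtain t where t: "t \<in> ?T" "h = ?f t" by blast
      define i where "i = (t * x) mod ?K"
      define j where "j = (- (t * y * w * v)) mod ?K"
      have ci: "[i = t * x] (mod ?K)" and cj: "[j = - (t * y * w * v)] (mod ?K)" by (simp_all add: i_def j_def cong_def)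
      have "[u * ?d * j^2 + w * i^2 = w] (mod p^(k+\<epsilon>))"
        by (rule cong_trans[OF norm[OF ci cj]]) (use t(1) cancel_w[of t] in simp)
      moreover have "[u * x * j + w * y * i = 0] (mod ?K)"
      proof -
        have "[u * x * j + w * y * i = u * x * (- (t * y * w * v)) + w * y * (t * x)] (mod ?K)"
          by (rule cong_add[OF cong_mult[OF cong_refl cj] cong_mult[OF cong_refl ci]])
        also have "u * x * (- (t * y * w * v)) + w * y * (t * x) = (u * v - 1) * (- (x * t * y * w))"
          by (simp add: algebra_simps)
        also have "[(u * v - 1) * (- (x * t * y * w)) = 0] (mod ?K)" using vK by (simp add: cong_iff_dvd_diff)
        finally show ?thesis .
      qed
      moreover have "?d * j \<in> {0..<p^(k+r)}"
      proof -
        have "j \<in> {0..<?K}" using d0 by (simp add: j_def)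
        then show ?thesis using d0 by (simp add: power_add mult.commute)
      qed
      moreover have "i \<in> {0..<?K}" using d0 by (simp add: i_def)
      ultimately have "(?d * j, i) \<in> ?H" using condH[of j i] by simp
      then show "h \<in> ?H" unfolding t(2) i_def j_def .
    next
      fix h assume h: "h \<in> ?H"
      then obtain z i where zi: "h = (z, i)" "z \<in> {0..<p^(k+r)}" "i \<in> {0..<?K}" "?d dvd z" by blast
      obtain j where j: "z = ?d * j" using zi(4) by (rule dvdE)
      have jK: "j \<in> {0..<?K}" using zi(2) d0 unfolding j power_add by (simp add: mult.commute[of ?d] zero_le_mult_iff)
      have c: "[u * x * j + w * y * i = 0] (mod ?K)" "[u * ?d * j^2 + w * i^2 = w] (mod p^(k+\<epsilon>))"
        using h unfolding zi(1) j condH[symmetric] by simp_all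
      obtain t0 where t0: "[i = t0 * x] (mod ?K)" "[j = - (t0 * y * w * v)] (mod ?K)"
        using orthogonal_parameter_ex[OF p u w unit vK c(1)] by blast
      define t where "t = t0 mod ?K"
      have tt: "[t0 = t] (mod ?K)" by (simp add: t_def cong_def)
      have ti: "[i = t * x] (mod ?K)"
        by (rule cong_trans[OF t0(1) cong_mult[OF tt cong_refl]])
      have tj: "[j = - (t * y * w * v)] (mod ?K)"
      proof -
        have "[t0 * (- (y * w * v)) = t * (- (y * w * v))] (mod ?K)" by (rule cong_mult[OF tt cong_refl])
        then show ?thesis using cong_trans[OF t0(2)] by (simp add: mult.assoc)
      qed
      have "[w * t^2 = w] (mod p^(k+\<epsilon>))" using cong_trans[OF cong_sym[OF norm[OF ti tj]] c(2)] .
      then have "t \<in> ?T" using cancel_w d0 by (simp add: t_def)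
      moreover have "?f t = h"
        using ti tj jK zi(3) unfolding zi(1) j by (simp add: cong_def)
      ultimately show "h \<in> ?f ` ?T" by (rule rev_image_eqI[OF _ sym])
    qed
  qed
  then show ?thesis by (rule bij_betw_same_card[symmetric])
qed

text \<open>The first vector of a frame is a point of the conic, and the second an orthogonal vector of the right length, whose number does
  not depend on the first. The scaling \<open>c\<close> absorbs the difference between even and odd \<open>p\<close>: values are compared modulo
  \<open>2 p^(k+r)\<close>, which for odd \<open>p\<close> and an even form is a condition modulo \<open>p^(k+r)\<close>, but for \<open>p = 2\<close> one modulo \<open>2^(k+r+1)\<close>.\<close>
lemma card_isometry_group_diagonal:
  fixes p :: nat and u w :: int
  assumes p: "prime p" and u: "\<not> int p dvd u" and w: "\<not> int p dvd w"
    and c: "c = 1 \<and> \<epsilon> = 1 \<and> p = 2 \<and> k \<ge> 1 \<or> c = 2 \<and> \<epsilon> = 0 \<and> odd p"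
  shows "card (isometry_group (binary_quad_group (p^k) (p^r) (c * u) 0 (c * w))) =
    card {t\<in>{0..<int p^k}. [t^2 = 1] (mod int p^(k+\<epsilon>))} *
    card {(x,y)\<in>{0..<int p^(k+r)}\<times>{0..<int p^k}. [u * x^2 + w * int p^r * y^2 = u] (mod int p^(k+r+\<epsilon>))}"
proof -
  let ?p = "int p"
  have pp: "prime ?p" using p by simp
  have p0: "p > 0" using p by (simp add: prime_gt_0_nat)
  have P: "int (p^k * p^r) = ?p^(k+r)" "int (p^r) = ?p^r" "int (p^k) = ?p^k" by (simp_all add: power_add)
  have P2: "2 * ?p^(k+r) = c * ?p^(k+r+\<epsilon>)" using c by auto
  have c0: "c \<noteq> 0" using c by auto
  have cc: "coprime (?p^(k+r)) c"
    using c by auto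
  have eps: "\<epsilon> = 0 \<or> \<epsilon> = 1 \<and> ?p = 2 \<and> k \<ge> 1" using c by auto
  have wd: "well_defined_form (p^k) (p^r) (c * u) (c * w)"
    unfolding well_defined_form_def P using c p0 by auto
  have nd: "nondegenerate_form (p^k) (p^r) (c * u) 0 (c * w)"
  proof -
    have "\<not> ?p dvd u * w" using u w prime_dvd_multD[OF pp] by blast
    then have "coprime (u * w) (?p^(k+r))" by (rule coprime_prime_power[OF pp])
    moreover have "coprime (c * c) (?p^(k+r))" using cc by (simp add: coprime_commute)
    ultimately have "coprime ((c * c) * (u * w)) (?p^(k+r))" by (simp only: coprime_mult_left_iff)
    then show ?thesis unfolding nondegenerate_form_def P by (simp add: mult_ac)
  qed
  have scale: "[c * a = c * b] (mod 2 * ?p^(k+r)) \<longleftrightarrow> [a = b] (mod ?p^(k+r+\<epsilon>))" for a b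
  proof -
    have "[c * a = c * b] (mod 2 * ?p^(k+r)) \<longleftrightarrow> c * ?p^(k+r+\<epsilon>) dvd c * (a - b)"
      unfolding P2 cong_iff_dvd_diff by (simp add: right_diff_distrib)
    then show ?thesis using c0 by (simp add: cong_iff_dvd_diff)
  qed
  have scale0: "[c * a = 0] (mod ?p^(k+r)) \<longleftrightarrow> [a = 0] (mod ?p^(k+r))" for a
    using coprime_dvd_mult_right_iff[OF cc] by (simp add: cong_0_iff)
  have fr: "frame (p^k) (p^r) (c * u) 0 (c * w) (c * u) 0 (c * w) g h \<longleftrightarrow>
      [u * (fst g)^2 + w * ?p^r * (snd g)^2 = u] (mod ?p^(k+r+\<epsilon>)) \<and>
      (?p^r dvd fst h \<and> [u * fst g * fst h + w * ?p^r * snd g * snd h = 0] (mod ?p^(k+r)) \<and>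
      [u * (fst h)^2 + w * ?p^r * (snd h)^2 = w * ?p^r] (mod ?p^(k+r+\<epsilon>)))" for g h
  proof -
    have 1: "bval (p^r) (c * u) 0 (c * w) z = c * (u * (fst z)^2 + w * ?p^r * (snd z)^2)" for z
      by (simp add: bval_def algebra_simps)
    have 2: "bpol (p^r) (c * u) 0 (c * w) g h = c * (u * fst g * fst h + w * ?p^r * snd g * snd h)"
      by (simp add: bpol_def algebra_simps)
    have 3: "c * w * ?p^r = c * (w * ?p^r)" "0 * ?p^r = 0" by simp_all
    show ?thesis unfolding frame_def 1 2 3 P scale scale0 by blast
  qed
  let ?X = "{0..<?p^(k+r)}\<times>{0..<?p^k}"
  have "card (isometry_group (binary_quad_group (p^k) (p^r) (c * u) 0 (c * w)))
    = card {(g,h)\<in>?X\<times>?X. frame (p^k) (p^r) (c * u) 0 (c * w) (c * u) 0 (c * w) g h}"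
    using card_isometry_group_frames[OF wd nd] unfolding P .
  also have "\<dots> = card {t\<in>{0..<?p^k}. [t^2 = 1] (mod ?p^(k+\<epsilon>))} *
      card {g\<in>?X. [u * (fst g)^2 + w * ?p^r * (snd g)^2 = u] (mod ?p^(k+r+\<epsilon>))}"
  proof (rule card_Sigma_const_fibre)
    fix g assume "g \<in> ?X"
    show "card {h\<in>?X. frame (p^k) (p^r) (c * u) 0 (c * w) (c * u) 0 (c * w) g h} =
      (if [u * (fst g)^2 + w * ?p^r * (snd g)^2 = u] (mod ?p^(k+r+\<epsilon>))
       then card {t\<in>{0..<?p^k}. [t^2 = 1] (mod ?p^(k+\<epsilon>))} else 0)"
    proof (cases "[u * (fst g)^2 + w * ?p^r * (snd g)^2 = u] (mod ?p^(k+r+\<epsilon>))")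
      case True
      have "{h\<in>?X. frame (p^k) (p^r) (c * u) 0 (c * w) (c * u) 0 (c * w) g h} =
        {(z,i)\<in>?X. ?p^r dvd z \<and> [u * fst g * z + w * ?p^r * snd g * i = 0] (mod ?p^(k+r)) \<and>
          [u * z^2 + w * ?p^r * i^2 = w * ?p^r] (mod ?p^(k+r+\<epsilon>))}"
        unfolding fr using True by auto
      then show ?thesis using True card_orthogonal_vectors[OF pp u w eps True] by simp
    next
      case False
      then have "{h\<in>?X. frame (p^k) (p^r) (c * u) 0 (c * w) (c * u) 0 (c * w) g h} = {}" unfolding fr by blast
      then show ?thesis using False by (simp only: card.empty if_False)
    qed
  qed simp_all
  also have "{g\<in>?X. [u * (fst g)^2 + w * ?p^r * (snd g)^2 = u] (mod ?p^(k+r+\<epsilon>))} =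
     {(x,y)\<in>?X. [u * x^2 + w * ?p^r * y^2 = u] (mod ?p^(k+r+\<epsilon>))}" by auto
  finally show ?thesis .
qed

lemma card_isometry_group_diagonal_odd:
  fixes p :: nat and u w :: int
  assumes p: "prime p" "odd p" and u: "\<not> int p dvd u" and w: "\<not> int p dvd w"
  shows "r \<ge> 1 \<Longrightarrow> card (isometry_group (binary_quad_group (p^k) (p^r) (2 * u) 0 (2 * w))) = (if k = 0 then 2 else 4 * p^k)"
    and "k \<ge> 1 \<Longrightarrow> int (card (isometry_group (binary_quad_group (p^k) 1 (2 * u) 0 (2 * w)))) =
      2 * (int p^(k-1) * (int p - Legendre (- (u * w)) (int p)))"
proof -
  have pp: "prime (int p)" "odd (int p)" using p by simp_all
  have c: "(2::int) = 1 \<and> (0::nat) = 1 \<and> p = 2 \<and> k \<ge> 1 \<or> (2::int) = 2 \<and> (0::nat) = 0 \<and> odd p" using p by simp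
  note D = card_isometry_group_diagonal[OF p(1) u w c]
  have T: "card {t\<in>{0..<int p^k}. [t^2 = 1] (mod int p^k)} = (if k = 0 then 1 else 2)"
    by (rule card_square_roots_of_one_odd[OF pp])
  show "card (isometry_group (binary_quad_group (p^k) (p^r) (2 * u) 0 (2 * w))) = (if k = 0 then 2 else 4 * p^k)" if "r \<ge> 1"
  proof -
    have "card {(x,y)\<in>{0..<int p^(k+r)}\<times>{0..<int p^k}. [u * x^2 + w * int p^r * y^2 = u] (mod int p^(k+r))} = 2 * p^k"
      using card_binary_degenerate_odd[OF pp, of k "k+r" u w] that u by (simp add: nat_power_eq)
    then show ?thesis using D[of r] T by simp
  qed
  show "int (card (isometry_group (binary_quad_group (p^k) 1 (2 * u) 0 (2 * w)))) =
      2 * (int p^(k-1) * (int p - Legendre (- (u * w)) (int p)))" if k: "k \<ge> 1"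
  proof -
    have "int (card {(x,y)\<in>{0..<int p^k}\<times>{0..<int p^k}. [u * x^2 + w * y^2 = u] (mod int p^k)}) = 
       int p^(k-1) * (int p - Legendre (- (u * w)) (int p))"
      by (rule card_conic_odd[OF pp k u w])
    then show ?thesis using D[of 0] T k by simp
  qed
qed

lemma card_isometry_group_diagonal_two:
  fixes u w :: int
  assumes u: "odd u" and w: "odd w" and k: "k \<ge> 1"
  shows "r \<ge> 1 \<Longrightarrow> card (isometry_group (binary_quad_group (2^k) (2^r) u 0 w)) =
      (if k = 1 then 1 else 2) * (if r \<ge> 3 then 2 * 2^k else 2^k)"
    and "card (isometry_group (binary_quad_group (2^k) 1 u 0 w)) =
      (if k = 1 then 1 else 2) * (2^(k-1) * (if [u = w] (mod 4) then 2 else 1))"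
proof -
  have c: "(1::int) = 1 \<and> (1::nat) = 1 \<and> (2::nat) = 2 \<and> k \<ge> 1 \<or> (1::int) = 2 \<and> (1::nat) = 0 \<and> odd (2::nat)" using k by simp
  have u': "\<not> int 2 dvd u" and w': "\<not> int 2 dvd w" using u w by simp_all
  have D: "card (isometry_group (binary_quad_group (2^k) (2^r) u 0 w)) =
    card {t\<in>{0..<2^k::int}. [t^2 = 1] (mod 2^(k+1))} *
    card {(x,y)\<in>{0..<2^(k+r)::int}\<times>{0..<2^k}. [u * x^2 + w * 2^r * y^2 = u] (mod 2^(k+r+1))}" for r
    using card_isometry_group_diagonal[OF two_is_prime_nat u' w' c, of r] by simp
  have T: "card {t\<in>{0..<2^k::int}. [t^2 = 1] (mod 2^(k+1))} = (if k = 1 then 1 else 2)"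
    using card_square_roots_of_one_two[OF k] by simp
  show "card (isometry_group (binary_quad_group (2^k) (2^r) u 0 w)) =
      (if k = 1 then 1 else 2) * (if r \<ge> 3 then 2 * 2^k else 2^k)" if "r \<ge> 1"
    unfolding D T using card_binary_degenerate_two[OF u w k that] by simp
  show "card (isometry_group (binary_quad_group (2^k) 1 u 0 w)) =
      (if k = 1 then 1 else 2) * (2^(k-1) * (if [u = w] (mod 4) then 2 else 1))"
    using D[of 0] unfolding T using card_conic_two[OF u w k] by simp
qed

lemma card_isometry_group_hyperbolic:
  assumes k: "k \<ge> 1"
  shows "card (isometry_group (binary_quad_group (2^k) 1 0 1 0)) = 2^k"
proof -
  have wd: "well_defined_form (2^k) 1 0 0" by (simp add: well_defined_form_def)
  have nd: "nondegenerate_form (2^k) 1 0 1 0" by (simp add: nondegenerate_form_def)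
  have dbl: "[2 * a = 0] (mod 2 * 2^k) \<longleftrightarrow> [a = 0] (mod 2^k)" for a :: int
    by (simp add: cong_0_iff)
  have fr: "frame (2^k) 1 0 1 0 0 1 0 g h \<longleftrightarrow> [fst g * snd g = 0] (mod 2^k) \<and> [fst h * snd h = 0] (mod 2^k) \<and>
      [fst g * snd h + snd g * fst h = 1] (mod 2^k)" for g h
    using dbl[of "fst g * snd g"] dbl[of "fst h * snd h"]
    unfolding frame_def bval_def bpol_def by (auto simp: mult.assoc)
  show ?thesis unfolding card_isometry_group_frames[OF wd nd] fr
    using card_hyperbolic_pairs[OF k] by simp
qed

lemma card_isometry_group_eisenstein:
  assumes k: "k \<ge> 1"
  shows "card (isometry_group (binary_quad_group (2^k) 1 2 1 2)) = 3 * 2^k"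
proof -
  have wd: "well_defined_form (2^k) 1 2 2" by (simp add: well_defined_form_def)
  have "coprime (3::int) (2^k)" by simp
  then have nd: "nondegenerate_form (2^k) 1 2 1 2" by (simp add: nondegenerate_form_def)
  have dbl: "[2 * a = 2] (mod 2 * 2^k) \<longleftrightarrow> [a = 1] (mod 2^k)" for a :: int
  proof -
    have "[2 * a = 2] (mod 2 * 2^k) \<longleftrightarrow> 2 * 2^k dvd 2 * (a - 1)" unfolding cong_iff_dvd_diff by (simp add: right_diff_distrib)
    also have "\<dots> \<longleftrightarrow> [a = 1] (mod 2^k)" unfolding cong_iff_dvd_diff by (simp only: dvd_mult_cancel_left) simp
    finally show ?thesis .
  qed
  have bv: "bval 1 2 1 2 z = 2 * ((fst z)^2 + fst z * snd z + (snd z)^2)" for z by (simp add: bval_def)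
  have fr: "frame (2^k) 1 2 1 2 2 1 2 g h \<longleftrightarrow> [(fst g)^2 + fst g * snd g + (snd g)^2 = 1] (mod 2^k) \<and>
      [(fst h)^2 + fst h * snd h + (snd h)^2 = 1] (mod 2^k) \<and>
      [2 * fst g * fst h + (fst g * snd h + snd g * fst h) + 2 * snd g * snd h = 1] (mod 2^k)" for g h
    unfolding frame_def bv bpol_def
    using dbl[of "(fst g)^2 + fst g * snd g + (snd g)^2"] dbl[of "(fst h)^2 + fst h * snd h + (snd h)^2"] by auto
  show ?thesis unfolding card_isometry_group_frames[OF wd nd] fr
    using card_eisenstein_pairs[OF k] by simp
qed

section \<open>Reduction to normal forms and their invariants\<close>

lemma form_A_eq: "form_A k \<theta> \<theta>' = binary_quad_group (2^k) 1 \<theta> 0 \<theta>'"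
  by (simp add: form_A_def binary_quad_group_def)

lemma form_B_eq:
  assumes "k \<le> l"
  shows "form_B l k \<theta> \<theta>' = binary_quad_group (2^k) (2^(l-k)) \<theta> 0 \<theta>'"
proof -
  have "2^k * 2^(l-k) = (2::nat)^l" using assms by (simp flip: power_add)
  then show ?thesis unfolding form_B_def binary_quad_group_def by simp
qed

lemma form_U_eq: "form_U k = binary_quad_group (2^k) 1 0 1 0"
  by (simp add: form_U_def binary_quad_group_def)

lemma form_V_eq: "form_V k = binary_quad_group (2^k) 1 2 1 2"
  by (simp add: form_V_def binary_quad_group_def)

lemma quad_isomorphic_swap:
  assumes "well_defined_form K 1 A C" "nondegenerate_form K 1 A B C"
  shows "quad_isomorphic (binary_quad_group K 1 C B A) (binary_quad_group K 1 A B C)"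
proof (rule quad_isomorphic_of_frame[where g = "(0,1)" and h = "(1,0)"])
  show "nondegenerate_form K 1 C B A" using assms(2) by (simp add: nondegenerate_form_def mult.commute)
  show "frame K 1 A B C C B A (0,1) (1,0)" by (simp add: frame_def bval_def bpol_def)
qed (fact assms)

text \<open>Replacing the first generator by the sum of both turns a form with \<open>A\<close>, \<open>C\<close> divisible by an odd prime into one with a unit in
  the first place.\<close>
lemma quad_isomorphic_shear:
  assumes "well_defined_form K 1 A C" "nondegenerate_form K 1 A B C"
  shows "quad_isomorphic (binary_quad_group K 1 (A + 2 * B + C) (B + C) C) (binary_quad_group K 1 A B C)"
proof (rule quad_isomorphic_of_frame[where g = "(1,1)" and h = "(0,1)"])
  have "(A + 2 * B + C) * C - int 1 * (B + C)^2 = A * C - int 1 * B^2"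
    by (simp add: power2_eq_square algebra_simps)
  then show "nondegenerate_form K 1 (A + 2 * B + C) (B + C) C"
    using assms(2) unfolding nondegenerate_form_def by (simp only:)
  show "frame K 1 A B C (A + 2 * B + C) (B + C) C (1,1) (0,1)" by (simp add: frame_def bval_def bpol_def)
qed (fact assms)

text \<open>Gram-Schmidt: a generator of unit length splits off, and the second generator is replaced by its projection
  \<open>h = e2 - (B d / A) e1\<close>. Its first coordinate is a multiple of \<open>d\<close>, as a frame requires. The determinant is preserved even modulo
  \<open>(K d)^2\<close>, since the error involves the square of \<open>A v - 1\<close>.\<close>
lemma split_off_unit:
  assumes wd: "well_defined_form K d A C" and nd: "nondegenerate_form K d A B C"
    and A: "coprime A (int (K * d))"
  obtains C' where "quad_isomorphic (binary_quad_group K d A 0 C') (binary_quad_group K d A B C)"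
    "[A * C' = A * C - int d * B^2] (mod int (K * d) * int (K * d))" "even A \<Longrightarrow> even C \<Longrightarrow> even C'"
proof -
  obtain v where v: "[A * v = 1] (mod int (K * d))" using cong_solve_coprime_int[OF A] by blast
  obtain e where e: "A * v - 1 = int (K * d) * e" using v unfolding cong_iff_dvd_diff by (rule dvdE)
  define C' where "C' = A * B^2 * int d * v^2 - 2 * B^2 * int d * v + C"
  have "A * C' - (A * C - int d * B^2) = int d * B^2 * (A * v - 1)^2"
    by (simp add: C'_def power2_eq_square algebra_simps)
  also have "\<dots> = (int (K * d) * int (K * d)) * (int d * B^2 * e^2)"
    unfolding e by (simp only: power2_eq_square mult_ac)
  finally have cong: "[A * C' = A * C - int d * B^2] (mod int (K * d) * int (K * d))"
    unfolding cong_iff_dvd_diff by (simp only: dvd_triv_left)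
  have "[A * C' = A * C - int d * B^2] (mod int (K * d))"
    by (rule cong_dvd_modulus[OF cong]) simp
  then have "coprime (A * C' - int d * 0^2) (int (K * d))"
    using nd cong_imp_coprime cong_sym unfolding nondegenerate_form_def by (metis diff_zero mult_zero_right power2_eq_square)
  then have nd': "nondegenerate_form K d A 0 C'" by (simp only: nondegenerate_form_def)
  have fr: "frame K d A B C A 0 C' (1, 0) (- (B * int d * v), 1)"
    unfolding frame_def
  proof (intro conjI)
    show "int d dvd fst (- (B * int d * v), 1::int)" by simp
    show "[bval d A B C (1, 0) = A] (mod 2 * int (K * d))" by (simp add: bval_def)
    have "bval d A B C (- (B * int d * v), 1) = C' * int d"
      by (simp add: bval_def C'_def power2_eq_square algebra_simps)
    then show "[bval d A B C (- (B * int d * v), 1) = C' * int d] (mod 2 * int (K * d))" by simp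
    have "bpol d A B C (1, 0) (- (B * int d * v), 1) = - (B * int d * (A * v - 1))"
      by (simp add: bpol_def algebra_simps)
    also have "\<dots> = int (K * d) * (- (B * int d * e))" unfolding e by (simp only: mult_minus_right mult_ac)
    finally show "[bpol d A B C (1, 0) (- (B * int d * v), 1) = 0 * int d] (mod int (K * d))"
      by (simp only: cong_iff_dvd_diff mult_zero_left diff_zero dvd_triv_left)
  qed
  have ev: "even A \<Longrightarrow> even C \<Longrightarrow> even C'" by (simp add: C'_def)
  show ?thesis by (rule that[OF quad_isomorphic_of_frame[OF wd nd' fr] cong ev])
qed

text \<open>It suffices to make the first coefficient a unit. If \<open>p\<close> divides \<open>A\<close>, nondegeneracy forces \<open>r = 0\<close>, and then either \<open>C\<close> is a unit,
  or \<open>2 B\<close> and hence the length \<open>A + 2 B + C\<close> of the sum of the generators.\<close>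
lemma diagonal_form_odd:
  fixes p :: nat and A B C :: int
  assumes p: "prime p" "odd p" and kr: "k + r \<ge> 1" and ev: "even A" "even C"
    and nd: "nondegenerate_form (p^k) (p^r) A B C"
  shows "\<exists>u w. \<not> int p dvd u \<and> \<not> int p dvd w \<and>
    quad_isomorphic (binary_quad_group (p^k) (p^r) (2 * u) 0 (2 * w)) (binary_quad_group (p^k) (p^r) A B C) \<and>
    [(2 * u) * (2 * w) = A * C - int p^r * B^2] (mod int p)"
proof -
  have pp: "prime (int p)" using p by simp
  have p0: "p > 0" using p by (simp add: prime_gt_0_nat)
  have P: "int (p^k * p^r) = int p^(k+r)" by (simp add: power_add)
  have pP: "int p dvd int p^(k+r)" using kr by (cases "k + r") simp_all
  have unit: "\<not> int p dvd X" if "coprime X (int p^(k+r))" for X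
  proof
    assume "int p dvd X"
    then have "is_unit (int p)" using that pP coprime_common_divisor by blast
    then show False using pp not_prime_unit by blast
  qed
  have main: "\<exists>u w. \<not> int p dvd u \<and> \<not> int p dvd w \<and>
    quad_isomorphic (binary_quad_group (p^k) (p^r) (2 * u) 0 (2 * w)) (binary_quad_group (p^k) (p^r) A B C) \<and>
    [(2 * u) * (2 * w) = A * C - int p^r * B^2] (mod int p)"
    if A: "\<not> int p dvd A" and ev: "even A" "even C" and nd: "nondegenerate_form (p^k) (p^r) A B C" for A B C
  proof -
    have wd: "well_defined_form (p^k) (p^r) A C" using ev p0 by (simp add: well_defined_form_def)
    have "coprime A (int (p^k * p^r))" unfolding P by (rule coprime_prime_power[OF pp A])
    then obtain C' where C': "quad_isomorphic (binary_quad_group (p^k) (p^r) A 0 C') (binary_quad_group (p^k) (p^r) A B C)"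
      "[A * C' = A * C - int (p^r) * B^2] (mod int (p^k * p^r) * int (p^k * p^r))" "even C'"
      using split_off_unit[OF wd nd] ev by metis
    obtain u where u: "A = 2 * u" using ev(1) by (rule evenE)
    obtain w where w: "C' = 2 * w" using C'(3) by (rule evenE)
    have cong: "[A * C' = A * C - int (p^r) * B^2] (mod int p)"
      by (rule cong_dvd_modulus[OF C'(2)]) (use pP P in simp)
    have "\<not> int p dvd A * C - int (p^r) * B^2" using nd unit unfolding nondegenerate_form_def P by blast
    then have "\<not> int p dvd A * C'" using cong cong_dvd_iff by blast
    then have "\<not> int p dvd u" "\<not> int p dvd w" unfolding u w by auto
    then show ?thesis using C'(1) cong unfolding u w by auto
  qed
  show ?thesis
  proof (cases "int p dvd A")
    case False
    then show ?thesis by (rule main[OF _ ev nd])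
  next
    case pA: True
    have r0: "r = 0"
    proof (rule ccontr)
      assume "r \<noteq> 0"
      then have "int p dvd A * C - int (p^r) * B^2" using pA by simp
      then show False using nd unit unfolding nondegenerate_form_def P by blast
    qed
    have wd: "well_defined_form (p^k) 1 A C" using ev p0 by (simp add: well_defined_form_def)
    have nd1: "nondegenerate_form (p^k) 1 A B C" using nd r0 by simp
    show ?thesis
    proof (cases "int p dvd C")
      case False
      have nd2: "nondegenerate_form (p^k) (p^r) C B A" using nd1 r0 by (simp add: nondegenerate_form_def mult.commute)
      from main[OF False ev(2,1) nd2] obtain u w where uw: "\<not> int p dvd u" "\<not> int p dvd w"
        "quad_isomorphic (binary_quad_group (p^k) (p^r) (2 * u) 0 (2 * w)) (binary_quad_group (p^k) (p^r) C B A)"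
        "[(2 * u) * (2 * w) = C * A - int p^r * B^2] (mod int p)" by blast
      have "quad_isomorphic (binary_quad_group (p^k) (p^r) (2 * u) 0 (2 * w)) (binary_quad_group (p^k) (p^r) A B C)"
        using quad_isomorphic_trans[OF uw(3)] quad_isomorphic_swap[OF wd nd1] r0 by simp
      then show ?thesis using uw by (metis mult.commute)
    next
      case pC: True
      have pB: "\<not> int p dvd B"
      proof
        assume "int p dvd B"
        then have "int p dvd A * C - int (p^r) * B^2" using pA by (simp add: power2_eq_square)
        then show False using nd unit unfolding nondegenerate_form_def P by blast
      qed
      have p2: "\<not> int p dvd 2 * B" using odd_prime_not_dvd_double[OF pp _ pB] p by simp
      have unitA: "\<not> int p dvd A + 2 * B + C"
      proof
        assume "int p dvd A + 2 * B + C"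
        then have "int p dvd (A + 2 * B + C) - A - C" using pA pC by (intro dvd_diff)
        then show False using p2 by simp
      qed
      have det: "(A + 2 * B + C) * C - int (p^r) * (B + C)^2 = A * C - int (p^r) * B^2"
        using r0 by (simp add: power2_eq_square algebra_simps)
      have nd2: "nondegenerate_form (p^k) (p^r) (A + 2 * B + C) (B + C) C"
        using nd unfolding nondegenerate_form_def det .
      have "even (A + 2 * B + C)" using ev by simp
      from main[OF unitA this ev(2) nd2] obtain u w where uw: "\<not> int p dvd u" "\<not> int p dvd w"
        "quad_isomorphic (binary_quad_group (p^k) (p^r) (2 * u) 0 (2 * w)) (binary_quad_group (p^k) (p^r) (A + 2 * B + C) (B + C) C)"
        "[(2 * u) * (2 * w) = (A + 2 * B + C) * C - int p^r * (B + C)^2] (mod int p)" by blast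
      have "quad_isomorphic (binary_quad_group (p^k) (p^r) (2 * u) 0 (2 * w)) (binary_quad_group (p^k) (p^r) A B C)"
        using quad_isomorphic_trans[OF uw(3)] quad_isomorphic_shear[OF wd nd1] r0 by simp
      then show ?thesis using uw(1,2,4) det by auto
    qed
  qed
qed

text \<open>The first coefficient is odd automatically for \<open>r \<ge> 1\<close>; for \<open>r = 0\<close> the generators are exchanged if necessary. Here a
  diagonalization exists only if some value of the form has an odd numerator.\<close>
lemma diagonal_form_two:
  fixes A B C :: int
  assumes k: "k \<ge> 1" and nd: "nondegenerate_form (2^k) (2^r) A B C" and A: "r \<ge> 1 \<or> odd A \<or> odd C"
  shows "\<exists>u w. odd u \<and> odd w \<and>
    quad_isomorphic (binary_quad_group (2^k) (2^r) u 0 w) (binary_quad_group (2^k) (2^r) A B C) \<and>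
    [u * w = A * C - 2^r * B^2] (mod 4)"
proof -
  have P: "int (2^k * 2^r) = 2^(k+r)" by (simp add: power_add)
  have evP: "even (int (2^k * 2^r))" using k by simp
  have unit: "odd (A * C - 2^r * B^2)" if "nondegenerate_form (2^k) (2^r) A B C" for A B C :: int
    using that k unfolding nondegenerate_form_def by (auto simp: coprime_commute)
  have main: "\<exists>u w. odd u \<and> odd w \<and>
    quad_isomorphic (binary_quad_group (2^k) (2^r) u 0 w) (binary_quad_group (2^k) (2^r) A B C) \<and>
    [u * w = A * C - 2^r * B^2] (mod 4)"
    if A: "odd A" and nd: "nondegenerate_form (2^k) (2^r) A B C" for A B C :: int
  proof -
    have wd: "well_defined_form (2^k) (2^r) A C" using k by (simp add: well_defined_form_def)
    have "coprime A (int (2^k * 2^r))" using A by simp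
    then obtain C' where C': "quad_isomorphic (binary_quad_group (2^k) (2^r) A 0 C') (binary_quad_group (2^k) (2^r) A B C)"
      "[A * C' = A * C - int (2^r) * B^2] (mod int (2^k * 2^r) * int (2^k * 2^r))"
      using split_off_unit[OF wd nd] by metis
    have "2 * 2 dvd int (2^k * 2^r) * int (2^k * 2^r)" using evP by (rule mult_dvd_mono) (fact evP)
    then have cong: "[A * C' = A * C - 2^r * B^2] (mod 4)"
      using cong_dvd_modulus[OF C'(2)] by simp
    have "[A * C' = A * C - 2^r * B^2] (mod 2)" by (rule cong_dvd_modulus[OF cong]) simp
    then have "odd (A * C')" using unit[OF nd] cong_dvd_iff by blast
    then have "odd C'" by simp
    then show ?thesis using A C'(1) cong by blast
  qed
  show ?thesis
  proof (cases "odd A")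
    case True
    then show ?thesis by (rule main[OF _ nd])
  next
    case False
    have r0: "r = 0"
    proof (rule ccontr)
      assume "r \<noteq> 0"
      then have "even (A * C - 2^r * B^2)" using False by simp
      then show False using unit[OF nd] by blast
    qed
    then have C: "odd C" using A False by simp
    have wd: "well_defined_form (2^k) 1 A C" using k by (simp add: well_defined_form_def)
    have nd1: "nondegenerate_form (2^k) 1 A B C" using nd r0 by simp
    have nd2: "nondegenerate_form (2^k) (2^r) C B A" using nd1 r0 by (simp add: nondegenerate_form_def mult.commute)
    from main[OF C nd2] obtain u w where uw: "odd u" "odd w"
      "quad_isomorphic (binary_quad_group (2^k) (2^r) u 0 w) (binary_quad_group (2^k) (2^r) C B A)"
      "[u * w = C * A - 2^r * B^2] (mod 4)" by blast
    have "quad_isomorphic (binary_quad_group (2^k) (2^r) u 0 w) (binary_quad_group (2^k) (2^r) A B C)"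
      using quad_isomorphic_trans[OF uw(3)] quad_isomorphic_swap[OF wd nd1] r0 by simp
    then show ?thesis using uw by (metis mult.commute)
  qed
qed

text \<open>If \<open>\<alpha>\<close> is even, \<open>\<alpha> x^2 + B x + \<gamma>\<close> has a root modulo \<open>2^k\<close>, so \<open>(x, 1)\<close> is isotropic. It is completed
  to a hyperbolic pair by rescaling the first generator to inner product \<open>1\<close> and correcting it by a multiple of the
  isotropic vector.\<close>
lemma hyperbolic_form:
  fixes \<alpha> \<gamma> B :: int
  assumes k: "k \<ge> 1" and B: "odd B" and e: "even (\<alpha> * \<gamma>)"
  shows "quad_isomorphic (binary_quad_group (2^k) 1 0 1 0) (binary_quad_group (2^k) 1 (2 * \<alpha>) B (2 * \<gamma>))"
proof -
  have wd: "well_defined_form (2^k) 1 (2 * a) (2 * c)" for a c by (simp add: well_defined_form_def)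
  have ndU: "nondegenerate_form (2^k) 1 0 1 0" by (simp add: nondegenerate_form_def)
  have main: "quad_isomorphic (binary_quad_group (2^k) 1 0 1 0) (binary_quad_group (2^k) 1 (2 * \<alpha>) B (2 * \<gamma>))"
    if a: "even \<alpha>" for \<alpha> \<gamma> :: int
  proof -
    obtain x where x: "[\<alpha> * x^2 + B * x = - \<gamma>] (mod 2^k)"
      using quadratic_cong_solvable[of 2 \<alpha> B "- \<gamma>" k] a B by auto
    define F where "F = \<alpha> * x^2 + B * x + \<gamma>"
    have F: "2^k dvd F" using x by (simp add: F_def cong_iff_dvd_diff)
    have "odd (2 * \<alpha> * x + B)" using B by simp
    then have "coprime (2 * \<alpha> * x + B) (2^k)" by simp
    then obtain s where s: "[(2 * \<alpha> * x + B) * s = 1] (mod 2^k)" using cong_solve_coprime_int by blast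
    \<comment> \<open>the vector s e1 has length 2 \<alpha> s^2 and inner product 1 with (x, 1)\<close>
    define t where "t = - (\<alpha> * s^2)"
    define b where "b = (2 * \<alpha> * x + B) * s"
    have b: "2^k dvd b - 1" using s by (simp add: b_def cong_iff_dvd_diff)
    have fr: "frame (2^k) 1 (2 * \<alpha>) B (2 * \<gamma>) 0 1 0 (x, 1) (s + t * x, t)"
      unfolding frame_def
    proof (intro conjI)
      have "bval 1 (2 * \<alpha>) B (2 * \<gamma>) (x, 1) = 2 * F" by (simp add: bval_def F_def algebra_simps)
      then show "[bval 1 (2 * \<alpha>) B (2 * \<gamma>) (x, 1) = 0] (mod 2 * int (2^k * 1))"
        using F by (simp add: cong_0_iff)
      have bp: "bpol 1 (2 * \<alpha>) B (2 * \<gamma>) (x, 1) (s + t * x, t) - 1 = (b - 1) + F * (2 * t)"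
        by (simp add: bpol_def F_def b_def power2_eq_square algebra_simps)
      have "2^k dvd bpol 1 (2 * \<alpha>) B (2 * \<gamma>) (x, 1) (s + t * x, t) - 1"
        unfolding bp by (rule dvd_add[OF b dvd_mult2[OF F]])
      then show "[bpol 1 (2 * \<alpha>) B (2 * \<gamma>) (x, 1) (s + t * x, t) = 1 * int 1] (mod int (2^k * 1))"
        by (simp add: cong_iff_dvd_diff)
      have "bval 1 (2 * \<alpha>) B (2 * \<gamma>) (s + t * x, t) = 2 * ((b - 1) * t + F * t^2)"
        unfolding bval_def F_def b_def by (simp add: t_def power2_eq_square algebra_simps)
      moreover have "2 * 2^k dvd 2 * ((b - 1) * t + F * t^2)"
        by (rule mult_dvd_mono[OF dvd_refl]) (use b F in simp)
      ultimately show "[bval 1 (2 * \<alpha>) B (2 * \<gamma>) (s + t * x, t) = 0 * int 1] (mod 2 * int (2^k * 1))"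
        by (simp add: cong_0_iff)
    qed simp
    show ?thesis by (rule quad_isomorphic_of_frame[OF wd ndU fr])
  qed
  show ?thesis
  proof (cases "even \<alpha>")
    case True
    then show ?thesis by (rule main)
  next
    case False
    then have "even \<gamma>" using e by simp
    have "odd (2 * \<alpha> * (2 * \<gamma>) - B^2)" using B by simp
    then have nd: "nondegenerate_form (2^k) 1 (2 * \<alpha>) B (2 * \<gamma>)" by (simp add: nondegenerate_form_def)
    show ?thesis
      by (rule quad_isomorphic_trans[OF main[OF \<open>even \<gamma>\<close>] quad_isomorphic_swap[OF wd nd]])
  qed
qed

text \<open>The first vector \<open>g = (1, 2 t)\<close> of half-length \<open>1\<close> exists by solving a quadratic congruence. The second is sought as
  \<open>h = 2 i g + s e2\<close>. Inner product \<open>1\<close> fixes \<open>s\<close> in terms of \<open>i\<close>, and half-length \<open>1\<close> becomes a quadratic congruence for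
  \<open>i\<close> with odd linear coefficient, which is solvable.\<close>
lemma eisenstein_form:
  fixes \<alpha> \<gamma> B :: int
  assumes k: "k \<ge> 1" and B: "odd B" and a: "odd \<alpha>" and c: "odd \<gamma>"
  shows "quad_isomorphic (binary_quad_group (2^k) 1 2 1 2) (binary_quad_group (2^k) 1 (2 * \<alpha>) B (2 * \<gamma>))"
proof -
  let ?N = "(2::int)^k"
  have wd: "well_defined_form (2^k) 1 (2 * \<alpha>) (2 * \<gamma>)" by (simp add: well_defined_form_def)
  have "coprime (3::int) (2^k)" by simp
  then have ndV: "nondegenerate_form (2^k) 1 2 1 2" by (simp add: nondegenerate_form_def)
  have "even (1 - \<alpha>)" using a by simp
  then obtain e1 where e1: "1 - \<alpha> = 2 * e1" by (rule evenE)
  obtain t where t: "[(2 * \<gamma>) * t^2 + B * t = e1] (mod ?N)"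
    using quadratic_cong_solvable[of 2 "2 * \<gamma>" B e1 k] B by auto
  define F where "F = \<alpha> + B * (2 * t) + \<gamma> * (2 * t)^2"
  have F: "?N dvd F - 1"
  proof -
    have "F - 1 = 2 * ((2 * \<gamma>) * t^2 + B * t - e1)" using e1 by (simp add: F_def power2_eq_square algebra_simps)
    then show ?thesis using t by (simp only: cong_iff_dvd_diff dvd_mult)
  qed
  define \<delta> where "\<delta> = B + 4 * \<gamma> * t"
  have "odd \<delta>" using B by (simp add: \<delta>_def)
  then have "coprime \<delta> ?N" by simp
  then obtain v where v: "[\<delta> * v = 1] (mod ?N)" using cong_solve_coprime_int by blast
  have ov: "odd v"
  proof -
    have "2 dvd ?N" using k by simp
    then have "2 dvd \<delta> * v - 1" using v dvd_trans unfolding cong_iff_dvd_diff by blast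
    then show ?thesis by auto
  qed
  define c' where "c' = \<gamma> * v^2"
  have "even (1 - c')" using c ov by (simp add: c'_def)
  then obtain e2 where e2: "1 - c' = 2 * e2" by (rule evenE)
  obtain i where i: "[(- (2 * (1 - 4 * c'))) * i^2 + (1 - 4 * c') * i = e2] (mod ?N)"
    using quadratic_cong_solvable[of 2 "- (2 * (1 - 4 * c'))" "1 - 4 * c'" e2 k] by auto
  \<comment> \<open>makes the inner product 4 i + s \<delta> equal to 1\<close>
  define s where "s = v * (1 - 4 * i)"
  have sd: "?N dvd \<delta> * s - (1 - 4 * i)"
  proof -
    have "\<delta> * s - (1 - 4 * i) = (\<delta> * v - 1) * (1 - 4 * i)" by (simp add: s_def algebra_simps)
    then show ?thesis using v by (simp add: cong_iff_dvd_diff)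
  qed
  have fr: "frame (2^k) 1 (2 * \<alpha>) B (2 * \<gamma>) 2 1 2 (1, 2 * t) (2 * i, 4 * i * t + s)"
    unfolding frame_def
  proof (intro conjI)
    have "bval 1 (2 * \<alpha>) B (2 * \<gamma>) (1, 2 * t) - 2 = 2 * (F - 1)"
      by (simp add: bval_def F_def power2_eq_square algebra_simps)
    moreover have "2 * ?N dvd 2 * (F - 1)" by (rule mult_dvd_mono[OF dvd_refl F])
    ultimately show "[bval 1 (2 * \<alpha>) B (2 * \<gamma>) (1, 2 * t) = 2] (mod 2 * int (2^k * 1))"
      unfolding cong_iff_dvd_diff by simp
    have bp: "bpol 1 (2 * \<alpha>) B (2 * \<gamma>) (1, 2 * t) (2 * i, 4 * i * t + s) - 1 = (F - 1) * (4 * i) + (\<delta> * s - (1 - 4 * i))"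
      by (simp add: bpol_def F_def \<delta>_def power2_eq_square algebra_simps)
    have "?N dvd bpol 1 (2 * \<alpha>) B (2 * \<gamma>) (1, 2 * t) (2 * i, 4 * i * t + s) - 1"
      unfolding bp by (rule dvd_add[OF dvd_mult2[OF F] sd])
    then show "[bpol 1 (2 * \<alpha>) B (2 * \<gamma>) (1, 2 * t) (2 * i, 4 * i * t + s) = 1 * int 1] (mod int (2^k * 1))"
      by (simp add: cong_iff_dvd_diff)
    have "bval 1 (2 * \<alpha>) B (2 * \<gamma>) (2 * i, 4 * i * t + s) - 2 =
      2 * ((F - 1) * (4 * i^2) + (\<delta> * s - (1 - 4 * i)) * (2 * i)
        + 2 * ((- (2 * (1 - 4 * c'))) * i^2 + (1 - 4 * c') * i - e2))"
    proof -
      have "bval 1 (2 * \<alpha>) B (2 * \<gamma>) (2 * i, 4 * i * t + s) = 2 * (F * (4 * i^2) + \<delta> * s * (2 * i) + \<gamma> * s^2)"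
        by (simp add: bval_def F_def \<delta>_def power2_eq_square algebra_simps)
      moreover have "\<gamma> * s^2 = c' * (1 - 4 * i)^2" by (simp add: s_def c'_def power2_eq_square algebra_simps)
      moreover have "2 * e2 = 1 - c'" using e2 by simp
      ultimately show ?thesis by (simp add: power2_eq_square algebra_simps)
    qed
    moreover have "2 * ?N dvd 2 * ((F - 1) * (4 * i^2) + (\<delta> * s - (1 - 4 * i)) * (2 * i)
        + 2 * ((- (2 * (1 - 4 * c'))) * i^2 + (1 - 4 * c') * i - e2))"
      by (rule mult_dvd_mono[OF dvd_refl], rule dvd_add[OF dvd_add[OF dvd_mult2[OF F] dvd_mult2[OF sd]] dvd_mult])
         (use i in \<open>simp only: cong_iff_dvd_diff\<close>)
    ultimately show "[bval 1 (2 * \<alpha>) B (2 * \<gamma>) (2 * i, 4 * i * t + s) = 2 * int 1] (mod 2 * int (2^k * 1))"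
      unfolding cong_iff_dvd_diff by simp
  qed simp
  show ?thesis by (rule quad_isomorphic_of_frame[OF wd ndV fr])
qed

lemma exponent_binary_quad_group:
  assumes K: "K > 0" and d: "d > 0"
  shows "(\<forall>z\<in>carrier (binary_quad_group K d A B C). z [^]\<^bsub>binary_quad_group K d A B C\<^esub> (N::nat) = \<one>\<^bsub>binary_quad_group K d A B C\<^esub>)
    \<longleftrightarrow> K * d dvd N"
proof
  assume "\<forall>z\<in>carrier (binary_quad_group K d A B C). z [^]\<^bsub>binary_quad_group K d A B C\<^esub> N = \<one>\<^bsub>binary_quad_group K d A B C\<^esub>"
  then have "red K d (1,0) [^]\<^bsub>binary_quad_group K d A B C\<^esub> N = (0,0)"
    using red_in_carrier[OF K d] by (simp add: one_binary_quad_group)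
  then have "(int N * (1 mod int (K * d))) mod int (K * d) = 0"
    unfolding pow_binary_quad_group[OF K d] by (cases "N = 0") (simp_all add: red_def)
  then have "int (K * d) dvd int N" by (simp add: mod_mult_right_eq dvd_eq_mod_eq_0)
  then show "K * d dvd N" by (simp only: of_nat_dvd_iff)
next
  assume N: "K * d dvd N"
  then have "int (K * d) dvd int N" by (simp only: of_nat_dvd_iff)
  moreover have "K dvd N" using N dvd_mult_left by blast
  ultimately show "\<forall>z\<in>carrier (binary_quad_group K d A B C). z [^]\<^bsub>binary_quad_group K d A B C\<^esub> N = \<one>\<^bsub>binary_quad_group K d A B C\<^esub>"
    unfolding pow_binary_quad_group[OF K d] one_binary_quad_group by (auto simp: red_def)
qed

lemma quad_isomorphic_pow:
  assumes "group D" "group E" "quad_isomorphic D E" "\<forall>z\<in>carrier E. z [^]\<^bsub>E\<^esub> (N::nat) = \<one>\<^bsub>E\<^esub>"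
  shows "\<forall>z\<in>carrier D. z [^]\<^bsub>D\<^esub> N = \<one>\<^bsub>D\<^esub>"
proof
  fix z assume z: "z \<in> carrier D"
  obtain f where f: "f \<in> iso D E" using assms(3) by (auto simp: quad_isomorphic_def)
  then have fh: "f \<in> hom D E" and inj: "inj_on f (carrier D)" by (auto simp: iso_def bij_betw_def)
  interpret D: group D by fact
  have "f (z [^]\<^bsub>D\<^esub> N) = f z [^]\<^bsub>E\<^esub> N" by (rule hom_nat_pow[OF fh z assms(1,2)])
  also have "\<dots> = \<one>\<^bsub>E\<^esub>" using assms(4) fh z by (auto simp: hom_def)
  also have "\<dots> = f \<one>\<^bsub>D\<^esub>" using hom_one[OF fh assms(1,2)] by simp
  finally show "z [^]\<^bsub>D\<^esub> N = \<one>\<^bsub>D\<^esub>" using inj z by (simp add: inj_on_def)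
qed

text \<open>The exponent of the group is \<open>K d\<close> and its order \<open>K d K\<close>.\<close>
lemma quad_isomorphic_binary_orders:
  assumes "K > 0" "d > 0" "K' > 0" "d' > 0"
    and iso: "quad_isomorphic (binary_quad_group K d A B C) (binary_quad_group K' d' A' B' C')"
  shows "K = K'" "d = d'"
proof -
  let ?D = "binary_quad_group K d A B C" and ?E = "binary_quad_group K' d' A' B' C'"
  have gD: "group ?D" and gE: "group ?E"
    using comm_group_binary_quad_group comm_group.axioms(2) by blast+
  have "K * d dvd K' * d'"
    using quad_isomorphic_pow[OF gD gE iso, of "K' * d'"] exponent_binary_quad_group assms(1-4) by (metis dvd_refl)
  moreover have "K' * d' dvd K * d"
    using quad_isomorphic_pow[OF gE gD quad_isomorphic_sym[OF gD iso], of "K * d"] exponent_binary_quad_group assms(1-4) by (metis dvd_refl)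
  ultimately have P: "K * d = K' * d'" by (rule dvd_antisym)
  have "card (carrier ?D) = card (carrier ?E)"
    using iso bij_betw_same_card unfolding quad_isomorphic_def iso_def by blast
  then have "K * d * K = K' * d' * K'" using assms(1-4) by (simp add: carrier_binary_quad_group nat_mult_distrib)
  then show "K = K'" using P assms(1-4) by simp
  then show "d = d'" using P assms(1-4) by simp
qed

lemma all_even_bval_iff:
  assumes wd: "well_defined_form K d A C"
  shows "(\<forall>z\<in>carrier (binary_quad_group K d A B C). even (bval d A B C z)) \<longleftrightarrow> even A \<and> even (C * int d)"
proof
  have K: "K > 0" and d: "d > 0" using wd by (simp_all add: well_defined_form_def)
  assume h: "\<forall>z\<in>carrier (binary_quad_group K d A B C). even (bval d A B C z)"
  have "even (bval d A B C w)" for w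
  proof -
    have "[bval d A B C (red K d w) = bval d A B C w] (mod 2 * int (K * d))"
      by (rule bval_red[OF wd]) simp
    then have "[bval d A B C (red K d w) = bval d A B C w] (mod 2)" by (rule cong_dvd_modulus) simp
    moreover have "even (bval d A B C (red K d w))" using h red_in_carrier[OF K d] by blast
    ultimately show ?thesis using cong_dvd_iff by blast
  qed
  from this[of "(1,0)"] this[of "(0,1)"] show "even A \<and> even (C * int d)" by (simp add: bval_def)
next
  assume "even A \<and> even (C * int d)"
  then show "\<forall>z\<in>carrier (binary_quad_group K d A B C). even (bval d A B C z)"
    by (auto simp: bval_def)
qed

text \<open>Whether all values of the form have even numerators is an isometry invariant. It separates \<open>U\<close> and \<open>V\<close> from the
  diagonal types.\<close>
lemma quad_isomorphic_parity:
  assumes wd: "well_defined_form K d A C" and wd': "well_defined_form K d A' C'"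
    and iso: "quad_isomorphic (binary_quad_group K d A B C) (binary_quad_group K d A' B' C')"
    and ev: "even A'" "even (C' * int d)"
  shows "even A \<and> even (C * int d)"
proof -
  have K: "K > 0" and d: "d > 0" using wd by (simp_all add: well_defined_form_def)
  obtain f where f: "f \<in> iso (binary_quad_group K d A B C) (binary_quad_group K d A' B' C')"
    "\<forall>z\<in>carrier (binary_quad_group K d A B C). qform (binary_quad_group K d A' B' C') (f z) = qform (binary_quad_group K d A B C) z"
    using iso by (auto simp: quad_isomorphic_def)
  have "even (bval d A B C z)" if z: "z \<in> carrier (binary_quad_group K d A B C)" for z
  proof -
    have "f z \<in> carrier (binary_quad_group K d A' B' C')" using f(1) z by (auto simp: iso_def hom_def)
    then have "even (bval d A' B' C' (f z))" using all_even_bval_iff[OF wd'] ev by blast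
    moreover have "[bval d A' B' C' (f z) = bval d A B C z] (mod 2 * int (K * d))"
      using f(2) z unfolding qform_binary_quad_group_eq_iff[OF K d, symmetric] by blast
    then have "[bval d A' B' C' (f z) = bval d A B C z] (mod 2)" by (rule cong_dvd_modulus) simp
    ultimately show ?thesis using cong_dvd_iff by blast
  qed
  then show ?thesis using all_even_bval_iff[OF wd] by blast
qed

section \<open>Lattices of rank two\<close>

lemma zspan_pair:
  assumes "u1 \<noteq> u2"
  shows "zspan L {u1, u2} = {smul L (of_int i) u1 + smul L (of_int j) u2 | i j. True}"
proof -
  have sum2: "(\<Sum>v\<in>{u1,u2}. g v) = g u1 + g u2" for g :: "'a \<Rightarrow> 'a" using assms by simp
  show ?thesis unfolding zspan_def sum2
  proof (intro equalityI subsetI)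
    fix z assume "z \<in> {smul L (of_int i) u1 + smul L (of_int j) u2 | i j. True}"
    then obtain i j where z: "z = smul L (of_int i) u1 + smul L (of_int j) u2" by blast
    show "z \<in> range (\<lambda>f. smul L (of_int (f u1)) u1 + smul L (of_int (f u2)) u2)"
      unfolding z by (rule range_eqI[of _ _ "\<lambda>v. if v = u1 then i else j"]) (use assms in simp)
  qed auto
qed

text \<open>Restates the basis property, which is formulated with finite sums, in coordinates.\<close>
lemma lattice_basis_pair_iff:
  assumes vs: "vector_space (smul L)" and ne: "u1 \<noteq> u2"
  shows "lattice_basis L {u1, u2} \<longleftrightarrow>
    (\<forall>x y. smul L x u1 + smul L y u2 = 0 \<longrightarrow> x = 0 \<and> y = 0) \<and>
    (\<forall>z. \<exists>x y. z = smul L x u1 + smul L y u2) \<and>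
    points L = {smul L (of_int i) u1 + smul L (of_int j) u2 | i j. True}"
proof -
  interpret V: vector_space "smul L" by fact
  have sum2: "(\<Sum>v\<in>{u1,u2}. g v) = g u1 + g u2" for g :: "'a \<Rightarrow> 'a" using ne by simp
  have coeff: "\<exists>f. f u1 = x \<and> f u2 = y" for x y :: 'c
    by (rule exI[of _ "\<lambda>v. if v = u1 then x else y"]) (use ne in simp)
  have dep: "\<not> V.dependent {u1, u2} \<longleftrightarrow> (\<forall>x y. smul L x u1 + smul L y u2 = 0 \<longrightarrow> x = 0 \<and> y = 0)"
    (is "_ \<longleftrightarrow> ?I")
  proof
    assume h: "\<not> V.dependent {u1, u2}"
    show ?I
    proof (intro allI impI)
      fix x y assume 0: "smul L x u1 + smul L y u2 = 0"
      define f where "f = (\<lambda>v. if v = u1 then x else y)"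
      have f: "f u1 = x" "f u2 = y" using ne by (auto simp: f_def)
      have "(\<Sum>v\<in>{u1,u2}. smul L (f v) v) = 0" unfolding sum2 f by (rule 0)
      then have "\<forall>v\<in>{u1,u2}. f v = 0" using h unfolding V.dependent_finite[of "{u1,u2}", simplified] by blast
      then show "x = 0 \<and> y = 0" using f by simp
    qed
  next
    assume I: ?I
    show "\<not> V.dependent {u1, u2}"
    proof
      assume "V.dependent {u1, u2}"
      then obtain f where f: "\<exists>v\<in>{u1,u2}. f v \<noteq> 0" "(\<Sum>v\<in>{u1,u2}. smul L (f v) v) = 0"
        using V.dependent_finite[of "{u1,u2}"] by auto
      have "smul L (f u1) u1 + smul L (f u2) u2 = 0" using f(2) unfolding sum2 .
      then have "f u1 = 0 \<and> f u2 = 0" using I by blast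
      then show False using f(1) by simp
    qed
  qed
  have span: "V.span {u1, u2} = UNIV \<longleftrightarrow> (\<forall>z. \<exists>x y. z = smul L x u1 + smul L y u2)"
  proof -
    have "V.span {u1, u2} = {smul L x u1 + smul L y u2 | x y. True}"
    proof -
      have "V.span {u1, u2} = range (\<lambda>f. smul L (f u1) u1 + smul L (f u2) u2)"
        using V.span_finite[of "{u1,u2}"] sum2 by simp
      also have "\<dots> = {smul L x u1 + smul L y u2 | x y. True}"
      proof (intro equalityI subsetI)
        fix z assume "z \<in> {smul L x u1 + smul L y u2 | x y. True}"
        then obtain x y where z: "z = smul L x u1 + smul L y u2" by blast
        obtain f where f: "f u1 = x \<and> f u2 = y" using coeff[of x y] ..
        show "z \<in> range (\<lambda>f. smul L (f u1) u1 + smul L (f u2) u2)"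
          unfolding z by (rule range_eqI[of _ _ f]) (simp add: f)
      qed auto
      finally show ?thesis .
    qed
    then show ?thesis by blast
  qed
  show ?thesis unfolding lattice_basis_def dep span zspan_pair[OF ne] by simp
qed

definition lincomb :: "('v::ab_group_add) zlattice \<Rightarrow> 'v \<Rightarrow> 'v \<Rightarrow> rat \<Rightarrow> rat \<Rightarrow> 'v" where
  "lincomb L u1 u2 x y = smul L x u1 + smul L y u2"

locale binary_lattice =
  fixes L :: "('v::ab_group_add) zlattice" and u1 u2 :: 'v
  assumes integral: "integral_lattice L" and distinct: "u1 \<noteq> u2" and basis: "lattice_basis L {u1, u2}"
begin

sublocale V: vector_space "smul L"
  using integral by (simp add: integral_lattice_def)

lemma lincomb_add: "lincomb L u1 u2 x y + lincomb L u1 u2 x' y' = lincomb L u1 u2 (x + x') (y + y')"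
  by (simp add: lincomb_def V.scale_left_distrib algebra_simps)

lemma lincomb_diff: "lincomb L u1 u2 x y - lincomb L u1 u2 x' y' = lincomb L u1 u2 (x - x') (y - y')"
  by (simp add: lincomb_def V.scale_left_diff_distrib algebra_simps)

lemma lincomb_scale: "smul L t (lincomb L u1 u2 x y) = lincomb L u1 u2 (t * x) (t * y)"
  by (simp add: lincomb_def V.scale_right_distrib)

lemma lincomb_basis: "lincomb L u1 u2 1 0 = u1" "lincomb L u1 u2 0 1 = u2" "lincomb L u1 u2 0 0 = 0"
  by (simp_all add: lincomb_def)

lemma lincomb_0_iff: "lincomb L u1 u2 x y = 0 \<longleftrightarrow> x = 0 \<and> y = 0"
  using basis unfolding lattice_basis_pair_iff[OF V.vector_space_axioms distinct] lincomb_def by auto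

lemma lincomb_eq_iff: "lincomb L u1 u2 x y = lincomb L u1 u2 x' y' \<longleftrightarrow> x = x' \<and> y = y'"
  using lincomb_0_iff[of "x - x'" "y - y'"] lincomb_diff[of x y x' y'] by auto

lemma lincomb_ex: "\<exists>x y. z = lincomb L u1 u2 x y"
  using basis unfolding lattice_basis_pair_iff[OF V.vector_space_axioms distinct] lincomb_def by blast

lemma points_eq: "points L = {lincomb L u1 u2 (of_int i) (of_int j) | i j. True}"
  using basis unfolding lattice_basis_pair_iff[OF V.vector_space_axioms distinct] lincomb_def by blast

lemma lincomb_in_points_iff: "lincomb L u1 u2 x y \<in> points L \<longleftrightarrow> x \<in> \<int> \<and> y \<in> \<int>"
  unfolding points_eq by (auto simp: lincomb_eq_iff elim!: Ints_cases)

lemma u_in_points: "u1 \<in> points L" "u2 \<in> points L"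
  using lincomb_in_points_iff[of 1 0] lincomb_in_points_iff[of 0 1] by (simp_all add: lincomb_basis)

lemma form_sym: "form L x y = form L y x"
  using integral unfolding integral_lattice_def by blast

lemma form_add_right: "form L x (y + z) = form L x y + form L x z"
  and form_scale_right: "form L x (smul L t y) = t * form L x y"
proof -
  interpret F: Vector_Spaces.linear "smul L" "(*)" "form L x"
    using integral unfolding integral_lattice_def by blast
  show "form L x (y + z) = form L x y + form L x z" by (rule F.add)
  show "form L x (smul L t y) = t * form L x y" by (rule F.scale)
qed

lemma form_add_left: "form L (x + y) z = form L x z + form L y z"
  using form_add_right[of z x y] by (simp only: form_sym[of z])

lemma form_scale_left: "form L (smul L t x) y = t * form L x y"
  using form_scale_right[of y t x] by (simp only: form_sym[of y])

lemma form_lincomb: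
  "form L (lincomb L u1 u2 x y) (lincomb L u1 u2 z w) =
    x * z * form L u1 u1 + (x * w + y * z) * form L u1 u2 + y * w * form L u2 u2"
  unfolding lincomb_def form_add_left form_add_right form_scale_left form_scale_right form_sym[of u2 u1]
  by (simp add: algebra_simps)

lemma gram_integral:
  "form L u1 u1 \<in> \<int>" "form L u1 u2 \<in> \<int>" "form L u2 u2 \<in> \<int>"
  using integral u_in_points unfolding integral_lattice_def by blast+

lemma even_lattice_iff:
  assumes "form L u1 u1 = of_int A" "form L u1 u2 = of_int B" "form L u2 u2 = of_int C"
  shows "even_lattice L \<longleftrightarrow> even A \<and> even C"
proof
  assume "even_lattice L"
  then have h: "\<exists>k::int. form L x x = of_int (2 * k)" if "x \<in> points L" for x
    using that unfolding even_lattice_def by blast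
  obtain k :: int where "form L u1 u1 = of_int (2 * k)" using h u_in_points by blast
  moreover obtain l :: int where "form L u2 u2 = of_int (2 * l)" using h u_in_points by blast
  ultimately have "A = 2 * k" "C = 2 * l" unfolding assms by (simp_all only: of_int_eq_iff)
  then show "even A \<and> even C" by simp
next
  assume "even A \<and> even C"
  then obtain k l where kl: "A = 2 * k" "C = 2 * l" by (auto elim!: evenE)
  have "\<exists>t::int. form L x x = of_int (2 * t)" if xL: "x \<in> points L" for x
  proof -
    obtain i j where x: "x = lincomb L u1 u2 (of_int i) (of_int j)" using xL unfolding points_eq by blast
    have "form L x x = of_int (2 * (i * i * k + i * j * B + j * j * l))"
      unfolding x form_lincomb assms kl by (simp add: algebra_simps)
    then show ?thesis by blast
  qed
  then show "even_lattice L" using integral unfolding even_lattice_def by blast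
qed

text \<open>The determinant of a lattice is defined by a description over all bases. Two bases differ by an integral matrix with
  integral inverse, hence of determinant \<open>\<plusminus>1\<close>, and the Gram determinant changes by the square.\<close>
lemma lattice_det_eq:
  assumes d: "of_int d = form L u1 u1 * form L u2 u2 - (form L u1 u2)^2"
  shows "lattice_det L = d"
  unfolding lattice_det_def
proof (rule the_equality)
  define v where "v = (\<lambda>i::2. if i = 1 then u1 else u2)"
  have v: "v 1 = u1" "v 2 = u2" by (simp_all add: v_def)
  have rng: "range v = {u1, u2}" unfolding UNIV_2 using v by simp
  have inj: "inj v" using distinct v by (simp add: inj_on_def UNIV_2)
  have "of_int d = det (\<chi> i j. form L (v i) (v j))"
    unfolding det_2 by (simp add: v d power2_eq_square form_sym[of u2 u1])
  then show "\<exists>v::2 \<Rightarrow> 'v. inj v \<and> lattice_basis L (range v) \<and> of_int d = det (\<chi> i j. form L (v i) (v j))"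
    using inj basis rng by metis
next
  fix d' assume "\<exists>v::2 \<Rightarrow> 'v. inj v \<and> lattice_basis L (range v) \<and> of_int d' = det (\<chi> i j. form L (v i) (v j))"
  then obtain v :: "2 \<Rightarrow> 'v" where v: "inj v" "lattice_basis L (range v)" "of_int d' = det (\<chi> i j. form L (v i) (v j))"
    by blast
  define w1 where "w1 = v 1"
  define w2 where "w2 = v 2"
  have ne: "w1 \<noteq> w2" using v(1) unfolding w1_def w2_def by (simp add: inj_eq)
  have rng: "range v = {w1, w2}" unfolding UNIV_2 w1_def w2_def by simp
  interpret W: binary_lattice L w1 w2
    using integral ne v(2) rng by unfold_locales simp_all
  have d': "of_int d' = form L w1 w1 * form L w2 w2 - (form L w1 w2)^2"
    using v(3) unfolding det_2 by (simp add: w1_def w2_def power2_eq_square form_sym[of "v 2" "v 1"])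
  obtain p q where w1: "w1 = lincomb L u1 u2 (of_int p) (of_int q)" using W.u_in_points points_eq by blast
  obtain s t where w2: "w2 = lincomb L u1 u2 (of_int s) (of_int t)" using W.u_in_points points_eq by blast
  obtain p' q' where u1: "u1 = lincomb L w1 w2 (of_int p') (of_int q')" using u_in_points W.points_eq by blast
  obtain s' t' where u2: "u2 = lincomb L w1 w2 (of_int s') (of_int t')" using u_in_points W.points_eq by blast
  have expand: "lincomb L w1 w2 (of_int i) (of_int j) = lincomb L u1 u2 (of_int (i * p + j * s)) (of_int (i * q + j * t))" for i j
  proof -
    have "lincomb L w1 w2 (of_int i) (of_int j) =
      smul L (of_int i) (lincomb L u1 u2 (of_int p) (of_int q)) + smul L (of_int j) (lincomb L u1 u2 (of_int s) (of_int t))"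
      unfolding lincomb_def[of L w1 w2] w1[symmetric] w2[symmetric] ..
    then show ?thesis by (simp add: lincomb_scale lincomb_add)
  qed
  have "lincomb L u1 u2 1 0 = lincomb L u1 u2 (of_int (p' * p + q' * s)) (of_int (p' * q + q' * t))"
    unfolding lincomb_basis expand[symmetric] by (rule u1)
  then have "of_int (p' * p + q' * s) = (1::rat)" "of_int (p' * q + q' * t) = (0::rat)" unfolding lincomb_eq_iff by simp_all
  then have e1: "p' * p + q' * s = 1" "p' * q + q' * t = 0" by linarith+
  have "lincomb L u1 u2 0 1 = lincomb L u1 u2 (of_int (s' * p + t' * s)) (of_int (s' * q + t' * t))"
    unfolding lincomb_basis expand[symmetric] by (rule u2)
  then have "of_int (s' * p + t' * s) = (0::rat)" "of_int (s' * q + t' * t) = (1::rat)" unfolding lincomb_eq_iff by simp_all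
  then have e2: "s' * p + t' * s = 0" "s' * q + t' * t = 1" by linarith+
  have "(p' * t' - q' * s') * (p * t - q * s) = (p' * p + q' * s) * (s' * q + t' * t) - (p' * q + q' * t) * (s' * p + t' * s)"
    by (simp add: algebra_simps)
  then have "(p' * t' - q' * s') * (p * t - q * s) = 1" using e1 e2 by simp
  then have "p * t - q * s = 1 \<or> p * t - q * s = - 1" unfolding zmult_eq_1_iff by blast
  then have sq: "(p * t - q * s)^2 = 1" by (elim disjE) simp_all
  have "(of_int d' :: rat) = of_int ((p * t - q * s)^2) * of_int d"
    unfolding d' d unfolding w1 w2 form_lincomb by (simp add: power2_eq_square algebra_simps)
  then show "d' = d" unfolding sq by simp
qed

end

lemma lattice_isometric_of_equal_gram:
  assumes L: "binary_lattice L u1 u2" and M: "binary_lattice M w1 w2" 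
    and gram: "of_nat N * form M w1 w1 = form L u1 u1" "of_nat N * form M w1 w2 = form L u1 u2" "of_nat N * form M w2 w2 = form L u2 u2"
  shows "lattice_isometric L (rescale M N)"
proof -
  interpret L: binary_lattice L u1 u2 by fact
  interpret M: binary_lattice M w1 w2 by fact
  define f where "f = (\<lambda>z. SOME w. \<exists>x y. z = lincomb L u1 u2 x y \<and> w = lincomb M w1 w2 x y)"
  have f: "f (lincomb L u1 u2 x y) = lincomb M w1 w2 x y" for x y
    unfolding f_def by (rule some_equality) (auto simp: L.lincomb_eq_iff)
  have pts: "points (rescale M N) = points M" and frm: "form (rescale M N) x y = of_nat N * form M x y" for x y
    by (simp_all add: rescale_def)
  have "bij_betw f (points L) (points M)"
  proof (rule bij_betw_imageI)
    show "inj_on f (points L)"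
      unfolding L.points_eq by (rule inj_onI) (auto simp: f M.lincomb_eq_iff)
    show "f ` points L = points M"
    proof (intro equalityI subsetI)
      fix w assume "w \<in> f ` points L"
      then obtain i j where "w = f (lincomb L u1 u2 (of_int i) (of_int j))" unfolding L.points_eq by blast
      then show "w \<in> points M" by (simp add: f M.lincomb_in_points_iff)
    next
      fix w assume "w \<in> points M"
      then obtain i j where w: "w = lincomb M w1 w2 (of_int i) (of_int j)" unfolding M.points_eq by blast
      show "w \<in> f ` points L"
        unfolding w by (rule image_eqI[of _ _ "lincomb L u1 u2 (of_int i) (of_int j)"]) (simp_all add: f L.lincomb_in_points_iff)
    qed
  qed
  moreover have "f (x + y) = f x + f y" if "x \<in> points L" "y \<in> points L" for x y
    using that unfolding L.points_eq by (auto simp: L.lincomb_add M.lincomb_add f)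
  moreover have "form (rescale M N) (f x) (f y) = form L x y" if x: "x \<in> points L" and y: "y \<in> points L" for x y
  proof -
    obtain i j where x: "x = lincomb L u1 u2 i j" using L.lincomb_ex by blast
    obtain k l where y: "y = lincomb L u1 u2 k l" using L.lincomb_ex by blast
    show ?thesis unfolding x y f frm L.form_lincomb M.form_lincomb gram[symmetric] by (simp add: algebra_simps)
  qed
  ultimately show ?thesis unfolding lattice_isometric_def pts by blast
qed

text \<open>An additive bijection of the lattices carries a basis of \<open>L\<close> to a basis of \<open>M\<close>. Independence over \<open>\<rat>\<close> is reduced to
  independence over \<open>\<int>\<close> by clearing denominators, and the images span the ambient space because \<open>M\<close> itself does.\<close>
lemma lattice_isometric_transport:
  assumes L: "binary_lattice L u1 u2" and M: "integral_lattice M" and iso: "lattice_isometric L (rescale M N)"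
  obtains w1 w2 where "binary_lattice M w1 w2"
    "of_nat N * form M w1 w1 = form L u1 u1" "of_nat N * form M w1 w2 = form L u1 u2" "of_nat N * form M w2 w2 = form L u2 u2"
proof -
  interpret L: binary_lattice L u1 u2 by fact
  interpret W: vector_space "smul M" using M by (simp add: integral_lattice_def)
  obtain f where bij: "bij_betw f (points L) (points M)"
    and add: "\<And>x y. x \<in> points L \<Longrightarrow> y \<in> points L \<Longrightarrow> f (x + y) = f x + f y"
    and frm: "\<And>x y. x \<in> points L \<Longrightarrow> y \<in> points L \<Longrightarrow> of_nat N * form M (f x) (f y) = form L x y"
    using iso unfolding lattice_isometric_def by (auto simp: rescale_def)
  define w1 where "w1 = f u1"
  define w2 where "w2 = f u2"
  let ?l = "\<lambda>i j. lincomb L u1 u2 (of_int i) (of_int j)"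
  have lp: "?l i j \<in> points L" for i j by (simp add: L.lincomb_in_points_iff)
  have f0: "f 0 = 0" using add[OF lp[of 0 0] lp[of 0 0]] by (simp add: L.lincomb_basis)
  have fadd: "f (?l (i + i') (j + j')) = f (?l i j) + f (?l i' j')" for i j i' j'
    using add[OF lp[of i j] lp[of i' j']] by (simp add: L.lincomb_add)
  have f1: "f (?l i 0) = smul M (of_int i) w1" for i
  proof (induction i rule: int_induct[where k = 0])
    case base
    then show ?case by (simp add: L.lincomb_basis f0)
  next
    case (step1 i)
    then show ?case using fadd[of i 1 0 0] by (simp add: L.lincomb_basis w1_def W.scale_left_distrib)
  next
    case (step2 i)
    then show ?case using fadd[of "i - 1" 1 0 0] by (simp add: L.lincomb_basis w1_def W.scale_left_diff_distrib algebra_simps)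
  qed
  have f2: "f (?l 0 j) = smul M (of_int j) w2" for j
  proof (induction j rule: int_induct[where k = 0])
    case base
    then show ?case by (simp add: L.lincomb_basis f0)
  next
    case (step1 i)
    then show ?case using fadd[of 0 0 i 1] by (simp add: L.lincomb_basis w2_def W.scale_left_distrib)
  next
    case (step2 i)
    then show ?case using fadd[of 0 0 "i - 1" 1] by (simp add: L.lincomb_basis w2_def W.scale_left_diff_distrib algebra_simps)
  qed
  have fl: "f (?l i j) = smul M (of_int i) w1 + smul M (of_int j) w2" for i j
    using fadd[of i 0 0 j] f1[of i] f2[of j] by simp
  have pts: "points M = {smul M (of_int i) w1 + smul M (of_int j) w2 | i j. True}"
  proof -
    have "points M = f ` points L" using bij by (simp add: bij_betw_def)
    also have "\<dots> = {f (?l i j) | i j. True}" unfolding L.points_eq by blast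
    finally show ?thesis unfolding fl .
  qed
  \<comment> \<open>clear denominators: the relation becomes one between images of lattice points\<close>
  have ind: "x = 0 \<and> y = 0" if h: "smul M x w1 + smul M y w2 = 0" for x y
  proof -
    obtain a b where ab: "x = of_int a / of_int b" "b > 0" by (metis Rat_cases Fract_of_int_quotient)
    obtain c e where ce: "y = of_int c / of_int e" "e > 0" by (metis Rat_cases Fract_of_int_quotient)
    have "smul M (of_int (b * e)) (smul M x w1 + smul M y w2) = 0" using h by simp
    then have "smul M (of_int (b * e) * x) w1 + smul M (of_int (b * e) * y) w2 = 0" by (simp add: W.scale_right_distrib)
    moreover have "of_int (b * e) * x = (of_int (a * e) :: rat)" "of_int (b * e) * y = (of_int (c * b) :: rat)"
      using ab ce by simp_all
    ultimately have "f (?l (a * e) (c * b)) = 0" unfolding fl by (simp only:)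
    then have "f (?l (a * e) (c * b)) = f (?l 0 0)" by (simp add: L.lincomb_basis f0)
    then have "?l (a * e) (c * b) = ?l 0 0" using bij lp unfolding bij_betw_def by (metis inj_onD)
    then have "a * e = 0 \<and> c * b = 0" unfolding L.lincomb_eq_iff by simp
    then show ?thesis using ab ce by auto
  qed
  have ne: "w1 \<noteq> w2" using ind[of 1 "-1"] by auto
  obtain B where B: "lattice_basis M B" using M by (auto simp: integral_lattice_def)
  have span: "\<exists>x y. z = smul M x w1 + smul M y w2" for z
  proof -
    have "B \<subseteq> W.span {w1, w2}"
    proof
      fix b assume b: "b \<in> B"
      have fin: "finite B" using B by (simp add: lattice_basis_def)
      have "(\<Sum>x\<in>B. smul M (of_int (if x = b then 1 else 0)) x) = (\<Sum>x\<in>B. if x = b then x else 0)"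
        by (rule sum.cong) auto
      then have eq: "(\<Sum>x\<in>B. smul M (of_int (if x = b then 1 else 0)) x) = b" using fin b by simp
      have "b \<in> zspan M B"
        unfolding zspan_def by (rule range_eqI[of _ _ "\<lambda>x. if x = b then 1 else 0"]) (simp only: eq)
      then have "b \<in> points M" using B by (simp add: lattice_basis_def)
      then obtain i j where "b = smul M (of_int i) w1 + smul M (of_int j) w2" unfolding pts by blast
      then show "b \<in> W.span {w1, w2}" by (simp add: W.span_add W.span_scale W.span_base)
    qed
    then have "W.span B \<subseteq> W.span {w1, w2}" by (rule W.span_minimal) (rule W.subspace_span)
    then have "z \<in> W.span {w1, w2}" using B by (auto simp: lattice_basis_def)
    then obtain g where "z = (\<Sum>v\<in>{w1,w2}. smul M (g v) v)" using W.span_finite[of "{w1,w2}"] by auto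
    then show ?thesis using ne by auto
  qed
  have "lattice_basis M {w1, w2}"
    unfolding lattice_basis_pair_iff[OF W.vector_space_axioms ne] using ind span pts by blast
  then have "binary_lattice M w1 w2" using M ne by unfold_locales
  then show ?thesis using frm[OF L.u_in_points(1) L.u_in_points(1)] frm[OF L.u_in_points]
      frm[OF L.u_in_points(2) L.u_in_points(2)] that unfolding w1_def w2_def by blast
qed

definition gram_lattice :: "int \<Rightarrow> int \<Rightarrow> int \<Rightarrow> (rat^2) zlattice" where
  "gram_lattice A B C = \<lparr>smul = (*s),
     form = (\<lambda>x y. of_int A * x $ 1 * y $ 1 + of_int B * (x $ 1 * y $ 2 + x $ 2 * y $ 1) + of_int C * x $ 2 * y $ 2),
     points = {x. x $ 1 \<in> \<int> \<and> x $ 2 \<in> \<int>}\<rparr>"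

lemma gram_lattice:
  assumes det: "A * C - B^2 \<noteq> 0"
  shows "binary_lattice (gram_lattice A B C) (axis 1 1) (axis 2 1)"
    and "form (gram_lattice A B C) (axis 1 1) (axis 1 1) = of_int A"
    and "form (gram_lattice A B C) (axis 1 1) (axis 2 1) = of_int B"
    and "form (gram_lattice A B C) (axis 2 1) (axis 2 1) = of_int C"
proof -
  let ?M = "gram_lattice A B C"
  have smul: "smul ?M = (*s)" by (simp add: gram_lattice_def)
  have frm: "form ?M x y = of_int A * x $ 1 * y $ 1 + of_int B * (x $ 1 * y $ 2 + x $ 2 * y $ 1) + of_int C * x $ 2 * y $ 2" for x y
    by (simp add: gram_lattice_def)
  have pts: "points ?M = {x. x $ 1 \<in> \<int> \<and> x $ 2 \<in> \<int>}" by (simp add: gram_lattice_def)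
  have ax: "(axis 1 1 :: rat^2) $ 1 = 1" "(axis 1 1 :: rat^2) $ 2 = 0" "(axis 2 1 :: rat^2) $ 1 = 0" "(axis 2 1 :: rat^2) $ 2 = 1"
    by (simp_all add: axis_def)
  have vs: "vector_space (smul ?M)" unfolding smul by (rule vec.vector_space_axioms)
  have ne: "(axis 1 1 :: rat^2) \<noteq> axis 2 1"
  proof
    assume "(axis 1 1 :: rat^2) = axis 2 1"
    then have "(axis 1 1 :: rat^2) $ 1 = (axis 2 1 :: rat^2) $ 1" by simp
    then show False unfolding ax by simp
  qed
  have co: "smul ?M x (axis 1 1) + smul ?M y (axis 2 1) = z \<longleftrightarrow> z $ 1 = x \<and> z $ 2 = y" for x y z
    unfolding smul by (auto simp: vec_eq_iff forall_2 ax)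
  have basis: "lattice_basis ?M {axis 1 1, axis 2 1}"
    unfolding lattice_basis_pair_iff[OF vs ne]
  proof (intro conjI allI impI)
    fix x y assume "smul ?M x (axis 1 1) + smul ?M y (axis 2 1) = 0"
    then show "x = 0" "y = 0" unfolding co by simp_all
  next
    fix z :: "rat^2"
    show "\<exists>x y. z = smul ?M x (axis 1 1) + smul ?M y (axis 2 1)"
      using co[of "z $ 1" "z $ 2" z] by metis
  next
    show "points ?M = {smul ?M (of_int i) (axis 1 1) + smul ?M (of_int j) (axis 2 1) | i j. True}"
    proof (intro equalityI subsetI)
      fix z assume "z \<in> points ?M"
      then obtain i j where "z $ 1 = of_int i" "z $ 2 = of_int j" unfolding pts by (auto elim!: Ints_cases)
      then show "z \<in> {smul ?M (of_int i) (axis 1 1) + smul ?M (of_int j) (axis 2 1) | i j. True}"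
        using co[of "of_int i" "of_int j" z] by force
    next
      fix z assume "z \<in> {smul ?M (of_int i) (axis 1 1) + smul ?M (of_int j) (axis 2 1) | i j. True}"
      then obtain i j where "smul ?M (of_int i) (axis 1 1) + smul ?M (of_int j) (axis 2 1) = z" by blast
      then show "z \<in> points ?M" unfolding co pts by simp
    qed
  qed
  have lin: "Vector_Spaces.linear (smul ?M) (*) (form ?M x)" for x
  proof -
    have vr: "vector_space ((*) :: rat \<Rightarrow> rat \<Rightarrow> rat)" by unfold_locales (simp_all add: algebra_simps)
    show ?thesis unfolding Vector_Spaces.linear_iff smul
      using vec.vector_space_axioms vr by (simp add: frm algebra_simps)
  qed
  have nondeg: "x = 0" if h: "\<forall>y. form ?M x y = 0" for x
  proof -
    have 1: "of_int A * x $ 1 + of_int B * x $ 2 = 0" using h[rule_format, of "axis 1 1"] by (simp add: frm ax)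
    have 2: "of_int B * x $ 1 + of_int C * x $ 2 = 0" using h[rule_format, of "axis 2 1"] by (simp add: frm ax)
    have "of_int (A * C - B^2) * x $ 1 = of_int C * (of_int A * x $ 1 + of_int B * x $ 2) - of_int B * (of_int B * x $ 1 + of_int C * x $ 2)"
      by (simp add: power2_eq_square algebra_simps)
    then have "of_int (A * C - B^2) * x $ 1 = 0" unfolding 1 2 by simp
    then have x1: "x $ 1 = 0" using det by (simp only: mult_eq_0_iff of_int_eq_0_iff) simp
    have "of_int (A * C - B^2) * x $ 2 = of_int A * (of_int B * x $ 1 + of_int C * x $ 2) - of_int B * (of_int A * x $ 1 + of_int B * x $ 2)"
      by (simp add: power2_eq_square algebra_simps)
    then have "of_int (A * C - B^2) * x $ 2 = 0" unfolding 1 2 by simp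
    then have "x $ 2 = 0" using det by (simp only: mult_eq_0_iff of_int_eq_0_iff) simp
    then show ?thesis using x1 by (simp add: vec_eq_iff forall_2)
  qed
  have "integral_lattice ?M" unfolding integral_lattice_def
  proof (intro conjI allI impI ballI)
    show "\<exists>B'. lattice_basis ?M B'" using basis by blast
    fix x y
    show "form ?M x y = form ?M y x" by (simp add: frm algebra_simps)
    show "form ?M x y \<in> \<int>" if "x \<in> points ?M" "y \<in> points ?M"
      using that unfolding pts frm by (auto intro!: Ints_add Ints_mult)
  qed (fact vs, fact lin, use nondeg in blast)
  then show "binary_lattice ?M (axis 1 1) (axis 2 1)" using ne basis by unfold_locales
  show "form ?M (axis 1 1) (axis 1 1) = of_int A" "form ?M (axis 1 1) (axis 2 1) = of_int B"
    "form ?M (axis 2 1) (axis 2 1) = of_int C" by (simp_all add: frm ax)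
qed

section \<open>Primary parts of a binary form\<close>

lemma p_component_simps [simp]:
  "monoid.mult (p_component p D) = monoid.mult D" "one (p_component p D) = one D" "qform (p_component p D) = qform D"
  by (simp_all add: p_component_def)

lemma carrier_p_component:
  "x \<in> carrier (p_component p D) \<longleftrightarrow> x \<in> carrier D \<and> (\<exists>k::nat. x [^]\<^bsub>D\<^esub> (p ^ k) = \<one>\<^bsub>D\<^esub>)"
  by (simp add: p_component_def)

lemma quad_isomorphic_p_component:
  assumes D: "group D" and E: "group E" and iso: "quad_isomorphic D E"
  shows "quad_isomorphic (p_component p D) (p_component p E)"
proof -
  obtain f where f: "f \<in> iso D E" "\<forall>x\<in>carrier D. qform E (f x) = qform D x"
    using iso by (auto simp: quad_isomorphic_def)
  have fh: "f \<in> hom D E" and inj: "inj_on f (carrier D)" and surj: "f ` carrier D = carrier E"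
    using f(1) by (auto simp: iso_def bij_betw_def)
  interpret D: group D by fact
  have pow: "f x [^]\<^bsub>E\<^esub> (j::nat) = \<one>\<^bsub>E\<^esub> \<longleftrightarrow> x [^]\<^bsub>D\<^esub> j = \<one>\<^bsub>D\<^esub>" if x: "x \<in> carrier D" for x j
  proof -
    have "f (x [^]\<^bsub>D\<^esub> j) = f x [^]\<^bsub>E\<^esub> j" by (rule hom_nat_pow[OF fh x D E])
    moreover have "f \<one>\<^bsub>D\<^esub> = \<one>\<^bsub>E\<^esub>" by (rule hom_one[OF fh D E])
    moreover have "f (x [^]\<^bsub>D\<^esub> j) = f \<one>\<^bsub>D\<^esub> \<longleftrightarrow> x [^]\<^bsub>D\<^esub> j = \<one>\<^bsub>D\<^esub>"
      by (rule inj_on_eq_iff[OF inj]) (use x in simp_all)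
    ultimately show ?thesis by simp
  qed
  have sub: "carrier (p_component p D) \<subseteq> carrier D" by (auto simp: carrier_p_component)
  have img: "f ` carrier (p_component p D) = carrier (p_component p E)"
  proof (intro equalityI subsetI)
    fix y assume "y \<in> f ` carrier (p_component p D)"
    then obtain x where x: "x \<in> carrier (p_component p D)" "y = f x" by blast
    have "f x \<in> carrier E" using x sub surj by blast
    then show "y \<in> carrier (p_component p E)" using x pow sub by (auto simp: carrier_p_component)
  next
    fix y assume y: "y \<in> carrier (p_component p E)"
    then obtain x where x: "x \<in> carrier D" "y = f x" using surj by (auto simp: carrier_p_component)
    then have "x \<in> carrier (p_component p D)" using y pow by (auto simp: carrier_p_component)
    then show "y \<in> f ` carrier (p_component p D)" using x by blast
  qed
  have "f (x \<otimes>\<^bsub>D\<^esub> y) = f x \<otimes>\<^bsub>E\<^esub> f y" if "x \<in> carrier (p_component p D)" "y \<in> carrier (p_component p D)" for x y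
    by (rule hom_mult[OF fh]) (use that sub in blast)+
  then have "f \<in> iso (p_component p D) (p_component p E)"
    unfolding iso_def hom_def bij_betw_def using img inj_on_subset[OF inj sub] by auto
  then show ?thesis unfolding quad_isomorphic_def using f(2) sub by auto
qed

text \<open>An element of \<open>p\<close>-power order killed by \<open>p^v N\<close> is killed by the greatest common divisor, which is a divisor of \<open>p^v\<close>.\<close>
lemma p_component_eq_torsion:
  fixes D :: "'a quad_group"
  assumes D: "comm_group D" and p: "prime p" and N: "\<not> p dvd N"
    and exp: "\<And>x. x \<in> carrier D \<Longrightarrow> x [^]\<^bsub>D\<^esub> (p ^ v * N) = \<one>\<^bsub>D\<^esub>"
  shows "p_component p D = torsion (p ^ v) D"
proof -
  interpret comm_group D by fact
  have "x [^]\<^bsub>D\<^esub> (p ^ v) = \<one>\<^bsub>D\<^esub>" if x: "x \<in> carrier D" and k: "x [^]\<^bsub>D\<^esub> (p ^ k) = \<one>\<^bsub>D\<^esub>" for x and k :: nat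
  proof -
    have "ord x dvd p ^ k" using k pow_eq_id[OF x] by blast
    then have "coprime (ord x) N"
      using p N by (metis coprime_commute coprime_divisors coprime_power_left_iff dvd_refl prime_imp_coprime)
    moreover have "ord x dvd p ^ v * N" using exp[OF x] pow_eq_id[OF x] by blast
    ultimately have "ord x dvd p ^ v" using coprime_dvd_mult_left_iff by blast
    then show ?thesis using pow_eq_id[OF x] by blast
  qed
  then have "{x \<in> carrier D. \<exists>k::nat. x [^]\<^bsub>D\<^esub> (p ^ k) = \<one>\<^bsub>D\<^esub>} = {x \<in> carrier D. x [^]\<^bsub>D\<^esub> (p ^ v) = \<one>\<^bsub>D\<^esub>}"
    by blast
  then show ?thesis unfolding p_component_def torsion_def by simp
qed

lemma carrier_torsion_binary:
  assumes "K > 0" "d > 0" "N > 0"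
  shows "z \<in> carrier (torsion N (binary_quad_group K d A B C)) \<longleftrightarrow>
    z \<in> carrier (binary_quad_group K d A B C) \<and> int (K * d) dvd int N * fst z \<and> int K dvd int N * snd z"
  using assms by (simp add: carrier_torsion pow_binary_quad_group one_binary_quad_group red_def dvd_eq_mod_eq_0)

lemma qform_binary_red:
  assumes "well_defined_form K d A C"
  shows "qform (binary_quad_group K d A B C) (red K d z) = mod2Z (of_int (bval d A B C z) / of_nat (K * d))"
proof -
  have K: "K > 0" "d > 0" using assms by (simp_all add: well_defined_form_def)
  have "K * d > 0" using K by simp
  show ?thesis
    unfolding qform_binary_quad_group[OF K] mod2Z_eq_iff[OF \<open>K * d > 0\<close>] by (intro bval_red[OF assms]) simp
qed

text \<open>The \<open>p^(k+e)\<close>-torsion consists of the multiples of \<open>n' r'\<close> in the first and of \<open>n'\<close> in the second coordinate.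
  Substituting these multiples, one factor \<open>n' r'\<close> of the numerator cancels against the denominator.\<close>
lemma torsion_binary_quad_group:
  fixes p n' r' :: nat
  assumes p: "prime p" and n': "\<not> p dvd n'" and r': "\<not> p dvd r'"
    and wd: "well_defined_form (p^k * n') (p^e * r') A C"
  shows "quad_isomorphic (binary_quad_group (p^k) (p^e) (A * int (n' * r')) (B * int (n' * r')) (C * int n'))
    (torsion (p^(k+e)) (binary_quad_group (p^k * n') (p^e * r') A B C))"
proof -
  let ?K = "p^k * n'" and ?d = "p^e * r'"
  let ?G = "binary_quad_group (p^k) (p^e) (A * int (n' * r')) (B * int (n' * r')) (C * int n')"
  let ?H = "binary_quad_group ?K ?d A B C"
  have p0: "p > 0" using p by (simp add: prime_gt_0_nat)
  have n0: "n' > 0" and r0: "r' > 0" using n' r' by (auto intro: Nat.gr0I)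
  have K: "?K > 0" "?d > 0" using p0 n0 r0 by simp_all
  have K': "p^k > 0" "p^e > 0" using p0 by simp_all
  have Kd: "?K * ?d = p^(k+e) * (n' * r')" by (simp add: power_add mult_ac)
  have Kd': "p^k * p^e = p^(k+e)" by (simp add: power_add)
  define \<phi> where "\<phi> = (\<lambda>z. red ?K ?d (fst z * int (n' * r'), snd z * int n'))"
  have red\<phi>: "\<phi> (red (p^k) (p^e) z) = \<phi> z" for z
  proof -
    obtain a b where z: "red (p^k) (p^e) z = (fst z + int (p^k * p^e) * a, snd z + int (p^k) * b)"
      using red_cong_obtain[of "p^k" "p^e" "red (p^k) (p^e) z" z] by auto
    show ?thesis unfolding \<phi>_def red_eq_iff z Kd Kd' by (simp add: algebra_simps)
  qed
  have add: "\<phi> (z \<otimes>\<^bsub>?G\<^esub> w) = \<phi> z \<otimes>\<^bsub>?H\<^esub> \<phi> w" for z w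
    unfolding mult_binary_quad_group red\<phi> unfolding \<phi>_def red_add_red by (simp add: algebra_simps)
  have tors: "\<phi> z \<in> carrier (torsion (p^(k+e)) ?H)" for z
  proof -
    have "p^(k+e) > 0" using p0 by simp
    moreover have "int (?K * ?d) dvd int (p^(k+e)) * fst (\<phi> z)"
    proof -
      have "int (?K * ?d) dvd int (p^(k+e)) * (fst z * int (n' * r'))" unfolding Kd by simp
      moreover have "[int (p^(k+e)) * fst (\<phi> z) = int (p^(k+e)) * (fst z * int (n' * r'))] (mod int (?K * ?d))"
        by (rule cong_mult[OF cong_refl]) (simp add: \<phi>_def red_def cong_def)
      ultimately show ?thesis using cong_dvd_iff by blast
    qed
    moreover have "int ?K dvd int (p^(k+e)) * snd (\<phi> z)"
    proof -
      have "int ?K dvd int (p^(k+e)) * (snd z * int n')" by (simp add: power_add)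
      moreover have "[int (p^(k+e)) * snd (\<phi> z) = int (p^(k+e)) * (snd z * int n')] (mod int ?K)"
        by (rule cong_mult[OF cong_refl]) (simp add: \<phi>_def red_def cong_def)
      ultimately show ?thesis using cong_dvd_iff by blast
    qed
    moreover have "\<phi> z \<in> carrier ?H" unfolding \<phi>_def by (rule red_in_carrier[OF K])
    ultimately show ?thesis using carrier_torsion_binary[OF K] by blast
  qed
  have inj: "inj_on \<phi> (carrier ?G)"
  proof (rule inj_onI)
    fix z w assume z: "z \<in> carrier ?G" and w: "w \<in> carrier ?G" and eq: "\<phi> z = \<phi> w"
    have 1: "int (p^(k+e) * (n' * r')) dvd (fst z - fst w) * int (n' * r')" and 2: "int (p^k * n') dvd (snd z - snd w) * int n'"
      using eq unfolding \<phi>_def red_eq_iff Kd by (simp_all add: left_diff_distrib)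
    have "int (p^(k+e)) dvd fst z - fst w" using 1 n0 r0 by (simp add: mult.assoc[symmetric])
    moreover have "int (p^k) dvd snd z - snd w" using 2 n0 by simp
    ultimately have "red (p^k) (p^e) z = red (p^k) (p^e) w" unfolding red_eq_iff Kd' by blast
    then show "z = w" using red_id[OF K' z] red_id[OF K' w] by simp
  qed
  have "\<phi> ` carrier ?G = carrier (torsion (p^(k+e)) ?H)"
  proof (intro equalityI subsetI)
    fix y assume "y \<in> \<phi> ` carrier ?G"
    then show "y \<in> carrier (torsion (p^(k+e)) ?H)" using tors by blast
  next
    fix y assume y: "y \<in> carrier (torsion (p^(k+e)) ?H)"
    have pe: "p^(k+e) > 0" using p0 by simp
    have yH: "y \<in> carrier ?H" and d1: "int (?K * ?d) dvd int (p^(k+e)) * fst y" and d2: "int ?K dvd int (p^(k+e)) * snd y"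
      using y unfolding carrier_torsion_binary[OF K pe] by blast+
    have "int (p^(k+e)) * int (n' * r') dvd int (p^(k+e)) * fst y" using d1 unfolding Kd by simp
    then have "int (n' * r') dvd fst y" using p0 unfolding dvd_mult_cancel_left by simp
    then obtain i where i: "fst y = int (n' * r') * i" by (rule dvdE)
    have "int n' dvd int (p^(k+e)) * snd y" using d2 by (metis dvd_mult_right of_nat_mult)
    moreover have "coprime (int n') (int (p^(k+e)))"
      using prime_imp_coprime[OF p n'] by (simp add: coprime_commute)
    ultimately have "int n' dvd snd y" using coprime_dvd_mult_right_iff by blast
    then obtain j where j: "snd y = int n' * j" by (rule dvdE)
    have "\<phi> (red (p^k) (p^e) (i, j)) = red ?K ?d y" unfolding red\<phi> unfolding \<phi>_def using i j by (simp add: mult.commute prod_eq_iff red_def)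
    also have "\<dots> = y" by (rule red_id[OF K yH])
    finally show "y \<in> \<phi> ` carrier ?G" using red_in_carrier[OF K'] by (metis imageI)
  qed
  then have "\<phi> \<in> iso ?G (torsion (p^(k+e)) ?H)"
    unfolding iso_def hom_def bij_betw_def using inj tors add by simp
  moreover have "qform (torsion (p^(k+e)) ?H) (\<phi> z) = qform ?G z" for z
  proof -
    have "bval ?d A B C (fst z * int (n' * r'), snd z * int n') =
      bval (p^e) (A * int (n' * r')) (B * int (n' * r')) (C * int n') z * int (n' * r')"
      by (simp add: bval_def power2_eq_square algebra_simps)
    then have "qform ?H (\<phi> z) = mod2Z (of_int (bval (p^e) (A * int (n' * r')) (B * int (n' * r')) (C * int n') z * int (n' * r')) / of_nat (p^(k+e) * (n' * r')))"
      unfolding \<phi>_def qform_binary_red[OF wd] Kd by simp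
    also have "of_int (bval (p^e) (A * int (n' * r')) (B * int (n' * r')) (C * int n') z * int (n' * r')) / of_nat (p^(k+e) * (n' * r'))
       = (of_int (bval (p^e) (A * int (n' * r')) (B * int (n' * r')) (C * int n') z) / of_nat (p^(k+e)) :: rat)"
      using n0 r0 by simp
    also have "mod2Z \<dots> = qform ?G z" unfolding qform_binary_quad_group[OF K'] Kd' ..
    finally show ?thesis by simp
  qed
  ultimately show ?thesis unfolding quad_isomorphic_def by blast
qed

lemma mod2Z_add: "{x + y | x y. x \<in> mod2Z r \<and> y \<in> mod2Z s} = mod2Z (r + s)"
proof (intro equalityI subsetI)
  fix z assume "z \<in> {x + y | x y. x \<in> mod2Z r \<and> y \<in> mod2Z s}"
  then obtain i j :: int where "z = (r + of_int (2 * i)) + (s + of_int (2 * j))" unfolding mod2Z_def by blast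
  then have "z = (r + s) + of_int (2 * (i + j))" by simp
  then show "z \<in> mod2Z (r + s)" unfolding mod2Z_def by blast
next
  fix z assume "z \<in> mod2Z (r + s)"
  then obtain i :: int where "z = (r + s) + of_int (2 * i)" unfolding mod2Z_def by blast
  then have z: "z = r + (s + of_int (2 * i))" by simp
  have "r \<in> mod2Z r" unfolding mod2Z_def by (rule range_eqI[of _ _ 0]) simp
  moreover have "s + of_int (2 * i) \<in> mod2Z s" unfolding mod2Z_def by blast
  ultimately show "z \<in> {x + y | x y. x \<in> mod2Z r \<and> y \<in> mod2Z s}" unfolding z by blast
qed

text \<open>The inner product of the two elements is killed by \<open>M\<close> and by \<open>N\<close>, hence vanishes. Addition of values is expressed as
  addition of cosets.\<close>
lemma orthogonal_coprime_torsion: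
  assumes wd: "well_defined_form K d A C" and cop: "coprime M N"
    and z: "z \<in> carrier (torsion M (binary_quad_group K d A B C))" and w: "w \<in> carrier (torsion N (binary_quad_group K d A B C))"
    and pos: "M > 0" "N > 0"
  shows "qform (binary_quad_group K d A B C) (z \<otimes>\<^bsub>binary_quad_group K d A B C\<^esub> w) =
    {x + y | x y. x \<in> qform (binary_quad_group K d A B C) z \<and> y \<in> qform (binary_quad_group K d A B C) w}"
proof -
  have K: "K > 0" "d > 0" using wd by (simp_all add: well_defined_form_def)
  have z1: "int (K * d) dvd int M * fst z" and "int K dvd int M * snd z" using z carrier_torsion_binary[OF K pos(1)] by blast+
  then have z2: "int (K * d) dvd int M * snd z * int d" by (simp add: mult_dvd_mono)
  have w1: "int (K * d) dvd int N * fst w" and "int K dvd int N * snd w" using w carrier_torsion_binary[OF K pos(2)] by blast+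
  then have w2: "int (K * d) dvd int N * snd w * int d" by (simp add: mult_dvd_mono)
  have "int M * bpol d A B C z w = (int M * fst z) * (A * fst w + B * int d * snd w) + (int M * snd z * int d) * (B * fst w + C * snd w)"
    by (simp add: bpol_def algebra_simps)
  then have 1: "int (K * d) dvd int M * bpol d A B C z w" using z1 z2 by (simp only: dvd_add dvd_mult2)
  have "int N * bpol d A B C z w = (int N * fst w) * (A * fst z + B * int d * snd z) + (int N * snd w * int d) * (B * fst z + C * snd z)"
    by (simp add: bpol_def algebra_simps)
  then have 2: "int (K * d) dvd int N * bpol d A B C z w" using w1 w2 by (simp only: dvd_add dvd_mult2)
  obtain i where "[int M * i = 1] (mod int N)" using cong_solve_coprime_int[of "int M" "int N"] cop by auto
  then obtain j where j: "int M * i - 1 = int N * j" unfolding cong_iff_dvd_diff by (auto elim: dvdE)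
  have "bpol d A B C z w = i * (int M * bpol d A B C z w) - j * (int N * bpol d A B C z w)"
  proof -
    have "i * (int M * bpol d A B C z w) - j * (int N * bpol d A B C z w) = (int M * i - int N * j) * bpol d A B C z w"
      by (simp add: algebra_simps)
    then show ?thesis using j by simp
  qed
  then have dv: "int (K * d) dvd bpol d A B C z w" using 1 2 by (metis dvd_diff dvd_mult)
  have "bval d A B C (fst z + fst w, snd z + snd w) = (bval d A B C z + bval d A B C w) + 2 * bpol d A B C z w"
    by (simp add: bval_def bpol_def power2_eq_square algebra_simps)
  moreover have "2 * int (K * d) dvd 2 * bpol d A B C z w" by (rule mult_dvd_mono[OF dvd_refl dv])
  ultimately have cong: "[bval d A B C (fst z + fst w, snd z + snd w) = bval d A B C z + bval d A B C w] (mod 2 * int (K * d))"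
    by (simp add: cong_iff_dvd_diff)
  have "K * d > 0" using K by simp
  have "qform (binary_quad_group K d A B C) (z \<otimes>\<^bsub>binary_quad_group K d A B C\<^esub> w) =
      mod2Z (of_int (bval d A B C (fst z + fst w, snd z + snd w)) / of_nat (K * d))"
    unfolding mult_binary_quad_group qform_binary_red[OF wd] ..
  also have "\<dots> = mod2Z (of_int (bval d A B C z + bval d A B C w) / of_nat (K * d))"
    using mod2Z_eq_iff[OF \<open>K * d > 0\<close>] cong by blast
  also have "\<dots> = mod2Z (of_int (bval d A B C z) / of_nat (K * d) + of_int (bval d A B C w) / of_nat (K * d))"
    by (simp add: add_divide_distrib)
  also have "\<dots> = {x + y | x y. x \<in> qform (binary_quad_group K d A B C) z \<and> y \<in> qform (binary_quad_group K d A B C) w}"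
    unfolding mod2Z_add[symmetric] qform_binary_quad_group[OF K] ..
  finally show ?thesis .
qed

lemma card_isometry_group_binary_product:
  assumes wd: "well_defined_form K d A C"
  shows "card (isometry_group (binary_quad_group K d A B C)) =
    (\<Prod>p\<in>prime_factors (K * d). card (isometry_group (torsion (p ^ multiplicity p (K * d)) (binary_quad_group K d A B C))))"
proof -
  let ?G = "binary_quad_group K d A B C"
  have K: "K > 0" "d > 0" using wd by (simp_all add: well_defined_form_def)
  have "{z \<in> carrier ?G. z [^]\<^bsub>?G\<^esub> (K * d) = \<one>\<^bsub>?G\<^esub>} = carrier ?G"
    using exponent_binary_quad_group[OF K, of A B C "K * d"] by auto
  then have all: "torsion (K * d) ?G = ?G" unfolding torsion_def by simp
  have "card (isometry_group (torsion (\<Prod>p\<in>prime_factors (K * d). p ^ multiplicity p (K * d)) ?G)) =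
      (\<Prod>p\<in>prime_factors (K * d). card (isometry_group (torsion (p ^ multiplicity p (K * d)) ?G)))"
    by (rule card_isometry_group_prime_product[OF comm_group_binary_quad_group finite_binary_quad_group[OF K], where Q = "\<lambda>X Y. {x + y | x y. x \<in> X \<and> y \<in> Y}"])
       (auto simp: orthogonal_coprime_torsion[OF wd])
  moreover have "(\<Prod>p\<in>prime_factors (K * d). p ^ multiplicity p (K * d)) = K * d"
    using K by (simp add: prod_prime_factors)
  ultimately show ?thesis by (simp add: all)
qed

section \<open>The discriminant form of a lattice of rank two\<close>

text \<open>A basis of \<open>L\<close> such that \<open>u1/n\<close>, \<open>u2/(n r)\<close> is a basis of the dual lattice. The Gram entries are divisible by \<open>n\<close> and \<open>n r\<close>
  as indicated, because the dual vectors pair integrally with \<open>L\<close>.\<close>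
locale discriminant_data = binary_lattice L u1 u2 for L :: "('v::ab_group_add) zlattice" and u1 u2 :: 'v +
  fixes n r :: nat and a b c :: int
  assumes n: "n > 0" and r: "r > 0"
    and gram: "form L u1 u1 = of_int (int n * a)" "form L u1 u2 = of_int (int (n * r) * b)" "form L u2 u2 = of_int (int (n * r) * c)"
    and unimodular: "a * c - int r * b^2 = 1 \<or> a * c - int r * b^2 = - 1"
    and even_a: "even (a * int n)" and even_c: "even (c * int (n * r))"
    and dual: "points (dual_lattice L) = {lincomb L u1 u2 (of_int i / of_nat n) (of_int j / of_nat (n * r)) | i j. True}"
begin

lemma well_defined: "well_defined_form n r c a"
  using n r even_a even_c by (simp add: well_defined_form_def)

lemma lattice_det: "lattice_det L = (a * c - int r * b^2) * (int n)^2 * int r"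
  by (rule lattice_det_eq) (simp add: gram power2_eq_square algebra_simps)

text \<open>Coordinates on the dual lattice. They are exchanged, as the cyclic factor of larger order \<open>n r\<close> comes first in
  \<open>binary_quad_group\<close> but belongs to \<open>u2\<close>.\<close>
definition dvec :: "int \<times> int \<Rightarrow> 'v" where
  "dvec z = lincomb L u1 u2 (of_int (snd z) / of_nat n) (of_int (fst z) / of_nat (n * r))"

lemma dvec_add: "dvec z + dvec w = dvec (fst z + fst w, snd z + snd w)"
  unfolding dvec_def lincomb_add by (simp add: add_divide_distrib)

lemma dual_eq: "points (dual_lattice L) = range dvec"
proof -
  have "range dvec = {lincomb L u1 u2 (of_int i / of_nat n) (of_int j / of_nat (n * r)) | i j. True}"
  proof (intro equalityI subsetI)
    fix x assume "x \<in> {lincomb L u1 u2 (of_int i / of_nat n) (of_int j / of_nat (n * r)) | i j. True}"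
    then obtain i j where x: "x = lincomb L u1 u2 (of_int i / of_nat n) (of_int j / of_nat (n * r))" by blast
    show "x \<in> range dvec" unfolding x by (rule range_eqI[of _ _ "(j, i)"]) (simp add: dvec_def)
  qed (auto simp: dvec_def)
  then show ?thesis using dual by simp
qed

lemma dvec_in_points_iff: "dvec z \<in> points L \<longleftrightarrow> int (n * r) dvd fst z \<and> int n dvd snd z"
proof -
  have frac: "(of_int x / of_nat N :: rat) \<in> \<int> \<longleftrightarrow> int N dvd x" if "N > 0" for x :: int and N :: nat
  proof
    assume "(of_int x / of_nat N :: rat) \<in> \<int>"
    then obtain y where "of_int x / of_nat N = (of_int y :: rat)" by (rule Ints_cases)
    then have "of_int x = (of_int (int N * y) :: rat)" using that by (simp add: field_simps)
    then have "x = int N * y" by (simp only: of_int_eq_iff)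
    then show "int N dvd x" by simp
  next
    assume "int N dvd x"
    then obtain y where "x = int N * y" by (rule dvdE)
    then show "(of_int x / of_nat N :: rat) \<in> \<int>" using that by simp
  qed
  have "n * r > 0" using n r by simp
  then show ?thesis unfolding dvec_def lincomb_in_points_iff using frac[OF n] frac[of "n * r"] by blast
qed

lemma dvec_diff: "dvec z - dvec w = dvec (fst z - fst w, snd z - snd w)"
  unfolding dvec_def lincomb_diff by (simp add: diff_divide_distrib)

lemma dvec_diff_in_points_iff: "dvec z - dvec w \<in> points L \<longleftrightarrow> red n r z = red n r w"
  unfolding dvec_diff dvec_in_points_iff red_eq_iff by simp

lemma form_dvec: "form L (dvec z) (dvec z) = of_int (bval r c b a z) / of_nat (n * r)"
  unfolding dvec_def form_lincomb gram bval_def using n r by (simp add: field_simps power2_eq_square)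

abbreviation dual_group :: "'v monoid" where
  "dual_group \<equiv> \<lparr>carrier = points (dual_lattice L), monoid.mult = (+), one = 0\<rparr>"

lemma comm_group_dual: "comm_group dual_group"
proof (rule comm_groupI)
  have 0: "dvec (0, 0) = 0" by (simp add: dvec_def lincomb_basis)
  have "0 \<in> range dvec" by (rule range_eqI[of _ _ "(0, 0)"]) (simp add: 0)
  then show "\<one>\<^bsub>dual_group\<^esub> \<in> carrier dual_group" by (simp add: dual_eq)
  fix x assume "x \<in> carrier dual_group"
  then obtain z where z: "x = dvec z" unfolding dual_eq by auto
  have "dvec (- fst z, - snd z) + dvec z = 0" unfolding dvec_add using 0 by simp
  then show "\<exists>y\<in>carrier dual_group. y \<otimes>\<^bsub>dual_group\<^esub> x = \<one>\<^bsub>dual_group\<^esub>" unfolding z dual_eq by auto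
next
  fix x y assume "x \<in> carrier dual_group" "y \<in> carrier dual_group"
  then show "x \<otimes>\<^bsub>dual_group\<^esub> y \<in> carrier dual_group" unfolding dual_eq by (auto simp: dvec_add)
qed (simp_all add: algebra_simps)

lemma points_subset_dual: "points L \<subseteq> points (dual_lattice L)"
  using integral by (auto simp: dual_lattice_def integral_lattice_def)

lemma points_add: "x \<in> points L \<Longrightarrow> y \<in> points L \<Longrightarrow> x + y \<in> points L"
  and points_minus: "x \<in> points L \<Longrightarrow> - x \<in> points L" and points_0: "0 \<in> points L"
proof -
  show 0: "0 \<in> points L" using lincomb_in_points_iff[of 0 0] by (simp add: lincomb_basis)
  show add: "x + y \<in> points L" if xy: "x \<in> points L" "y \<in> points L" for x y
  proof -
    obtain p q where x: "x = lincomb L u1 u2 p q" using lincomb_ex by blast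
    obtain s t where y: "y = lincomb L u1 u2 s t" using lincomb_ex by blast
    show ?thesis using xy unfolding x y lincomb_add lincomb_in_points_iff by simp
  qed
  show "- x \<in> points L" if x: "x \<in> points L"
  proof -
    obtain p q where xx: "x = lincomb L u1 u2 p q" using lincomb_ex by blast
    have "- x = lincomb L u1 u2 (- p) (- q)" using lincomb_diff[of 0 0 p q] unfolding xx by (simp add: lincomb_basis)
    then show ?thesis using x unfolding xx lincomb_in_points_iff by (simp add: lincomb_in_points_iff)
  qed
qed

lemma subgroup_points: "subgroup (points L) dual_group"
proof (rule group.subgroupI[OF comm_group.axioms(2)[OF comm_group_dual]])
  interpret G: comm_group dual_group by (rule comm_group_dual)
  show "points L \<subseteq> carrier dual_group" using points_subset_dual by simp
  show "points L \<noteq> {}" using points_0 by blast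
  fix x assume x: "x \<in> points L"
  have "inv\<^bsub>dual_group\<^esub> x = - x"
    by (rule G.inv_equality) (use x points_minus points_subset_dual in auto)
  then show "inv\<^bsub>dual_group\<^esub> x \<in> points L" using points_minus[OF x] by simp
  fix y assume "y \<in> points L"
  then show "x \<otimes>\<^bsub>dual_group\<^esub> y \<in> points L" using points_add[OF x] by simp
qed

lemma coset_eq_iff: "points L #>\<^bsub>dual_group\<^esub> x = points L #>\<^bsub>dual_group\<^esub> y \<longleftrightarrow> x - y \<in> points L"
proof -
  have cs: "points L #>\<^bsub>dual_group\<^esub> z = {h + z | h. h \<in> points L}" for z
    unfolding r_coset_def by auto
  show ?thesis
  proof
    assume "points L #>\<^bsub>dual_group\<^esub> x = points L #>\<^bsub>dual_group\<^esub> y"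
    moreover have "x \<in> points L #>\<^bsub>dual_group\<^esub> x" unfolding cs using points_0 by force
    ultimately obtain h where "h \<in> points L" "x = h + y" unfolding cs by blast
    then show "x - y \<in> points L" by simp
  next
    assume d: "x - y \<in> points L"
    show "points L #>\<^bsub>dual_group\<^esub> x = points L #>\<^bsub>dual_group\<^esub> y"
    proof (intro equalityI subsetI)
      fix z assume "z \<in> points L #>\<^bsub>dual_group\<^esub> x"
      then obtain h where h: "h \<in> points L" "z = h + x" unfolding cs by blast
      then have "z = (h + (x - y)) + y" "h + (x - y) \<in> points L" using points_add[OF h(1) d] by simp_all
      then show "z \<in> points L #>\<^bsub>dual_group\<^esub> y" unfolding cs by blast
    next
      fix z assume "z \<in> points L #>\<^bsub>dual_group\<^esub> y"
      then obtain h where h: "h \<in> points L" "z = h + y" unfolding cs by blast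
      then have "z = (h + - (x - y)) + x" "h + - (x - y) \<in> points L" using points_add[OF h(1) points_minus[OF d]] by simp_all
      then show "z \<in> points L #>\<^bsub>dual_group\<^esub> x" unfolding cs by blast
    qed
  qed
qed

lemma comm_group_discriminant_form: "comm_group (discriminant_form L)"
  unfolding discriminant_form_def
  by (rule comm_group_quad_group, rule comm_group.abelian_FactGroup[OF comm_group_dual subgroup_points])

text \<open>Changing a dual vector by a lattice vector \<open>h\<close> changes its length by \<open>(h, h) + 2 (h, x)\<close>, an even integer.\<close>
lemma form_points_dual:
  assumes "even_lattice L" "h \<in> points L" "x \<in> points (dual_lattice L)"
  shows "mod2Z (form L (h + x) (h + x)) = mod2Z (form L x x)"
proof -
  have "form L x h \<in> \<int>" using assms(2,3) by (simp add: dual_lattice_def)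
  then obtain k where k: "form L x h = of_int k" by (rule Ints_cases)
  obtain l :: int where l: "form L h h = of_int (2 * l)" using assms(1,2) unfolding even_lattice_def by blast
  have "form L (h + x) (h + x) - form L x x = of_int (2 * (l + k))"
    unfolding form_add_left form_add_right using k l form_sym[of h x] by simp
  then show ?thesis unfolding mod2Z_eq by blast
qed

lemma qform_discriminant_form:
  assumes "even_lattice L"
  shows "qform (discriminant_form L) (points L #>\<^bsub>dual_group\<^esub> dvec z) = mod2Z (form L (dvec z) (dvec z))"
proof -
  have "dvec z \<in> points (dual_lattice L)" unfolding dual_eq by simp
  then have "(\<Union>x\<in>(points L #>\<^bsub>dual_group\<^esub> dvec z). mod2Z (form L x x)) = (\<Union>h\<in>points L. mod2Z (form L (dvec z) (dvec z)))"
    using form_points_dual[OF assms] unfolding r_coset_def by simp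
  also have "\<dots> = mod2Z (form L (dvec z) (dvec z))" using points_0 by blast
  finally show ?thesis by (simp add: discriminant_form_def)
qed

text \<open>The map sends \<open>(x, y)\<close> to the class of \<open>x u2/(n r) + y u1/n\<close>.\<close>
lemma discriminant_form_isomorphic:
  assumes "even_lattice L"
  shows "quad_isomorphic (binary_quad_group n r c b a) (discriminant_form L)"
proof -
  let ?G = "binary_quad_group n r c b a" and ?D = "discriminant_form L"
  let ?f = "\<lambda>z. points L #>\<^bsub>dual_group\<^esub> dvec z"
  have norm: "points L \<lhd> dual_group"
    using comm_group.subgroup_imp_normal[OF comm_group_dual subgroup_points] .
  have carD: "carrier ?D = range ?f"
    unfolding discriminant_form_def quad_group_simps carrier_FactGroup by (simp add: dual_eq image_image)
  have fred: "?f (red n r z) = ?f z" for z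
    unfolding coset_eq_iff dvec_diff_in_points_iff by simp
  have hom: "?f (z \<otimes>\<^bsub>?G\<^esub> w) = ?f z \<otimes>\<^bsub>?D\<^esub> ?f w" for z w
  proof -
    have "?f z \<otimes>\<^bsub>?D\<^esub> ?f w = points L #>\<^bsub>dual_group\<^esub> (dvec z \<otimes>\<^bsub>dual_group\<^esub> dvec w)"
      unfolding discriminant_form_def quad_group_simps mult_FactGroup
      by (rule normal.rcos_sum[OF norm]) (simp_all add: dual_eq)
    then show ?thesis unfolding mult_binary_quad_group fred by (simp add: dvec_add)
  qed
  have inj: "inj_on ?f (carrier ?G)"
  proof (rule inj_onI)
    fix z w assume z: "z \<in> carrier ?G" and w: "w \<in> carrier ?G" and "?f z = ?f w"
    then have "red n r z = red n r w" unfolding coset_eq_iff dvec_diff_in_points_iff by blast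
    then show "z = w" using red_id[OF n r z] red_id[OF n r w] by simp
  qed
  have "?f ` carrier ?G = carrier ?D"
  proof (intro equalityI subsetI)
    fix X assume "X \<in> carrier ?D"
    then obtain z where "X = ?f z" unfolding carD by blast
    then have "X = ?f (red n r z)" by (simp only: fred)
    then show "X \<in> ?f ` carrier ?G" using red_in_carrier[OF n r] by blast
  qed (use carD in auto)
  then have "?f \<in> iso ?G ?D" unfolding iso_def hom_def bij_betw_def using hom inj by auto
  moreover have "qform ?D (?f z) = qform ?G z" for z
    unfolding qform_discriminant_form[OF assms] form_dvec qform_binary_quad_group[OF n r] ..
  ultimately show ?thesis unfolding quad_isomorphic_def by (intro bexI[of _ ?f]) simp_all
qed

end

text \<open>The hypothesis says that the matrix with rows \<open>(a, b)\<close>, \<open>(r b, c)\<close> is injective on \<open>(\<rat>/\<int>)^2\<close>. Then its inverse is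
  integral, that is, the determinant \<open>\<Delta>\<close> divides \<open>a\<close>, \<open>b\<close>, \<open>c\<close>. So \<open>\<Delta>^2\<close> divides \<open>\<Delta>\<close>.\<close>
lemma integral_inverse_unimodular:
  fixes a b c r :: int
  assumes "\<And>s t :: rat. of_int a * s + of_int b * t \<in> \<int> \<Longrightarrow> of_int (r * b) * s + of_int c * t \<in> \<int> \<Longrightarrow> s \<in> \<int> \<and> t \<in> \<int>"
  shows "a * c - r * b^2 = 1 \<or> a * c - r * b^2 = - 1"
proof -
  define \<Delta> where "\<Delta> = a * c - r * b^2"
  have half: "(1 / 2 :: rat) \<notin> \<int>"
  proof
    assume "(1 / 2 :: rat) \<in> \<int>"
    then obtain k where "(1 / 2 :: rat) = of_int k" by (rule Ints_cases)
    then have "(of_int 1 :: rat) = of_int (2 * k)" by simp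
    then have "1 = 2 * k" by (simp only: of_int_eq_iff)
    then show False by presburger
  qed
  have frac: "y dvd x" if xy: "(of_int x / of_int y :: rat) \<in> \<int>" "y \<noteq> 0" for x y :: int
  proof -
    obtain k where "of_int x / of_int y = (of_int k :: rat)" using xy(1) by (rule Ints_cases)
    then have "(of_int x :: rat) = of_int (y * k)" using xy(2) by (simp add: field_simps)
    then have "x = y * k" by (simp only: of_int_eq_iff)
    then show ?thesis by simp
  qed
  \<comment> \<open>if the determinant vanished, (b, -a) l would be in the kernel for every rational l\<close>
  have nz: "\<Delta> \<noteq> 0"
  proof
    assume \<Delta>: "\<Delta> = 0"
    have ker: "of_int b * l \<in> \<int> \<and> of_int (- a) * l \<in> \<int>" for l :: rat
    proof (rule assms)
      show "of_int a * (of_int b * l) + of_int b * (of_int (- a) * l) \<in> (\<int> :: rat set)" by (simp add: algebra_simps)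
      have "of_int (r * b) * (of_int b * l) + of_int c * (of_int (- a) * l) = - (of_int \<Delta> * l)"
        by (simp add: \<Delta>_def power2_eq_square algebra_simps)
      then show "of_int (r * b) * (of_int b * l) + of_int c * (of_int (- a) * l) \<in> \<int>" by (simp only: \<Delta> of_int_0 mult_zero_left minus_zero Ints_0)
    qed
    have "b = 0"
    proof (rule ccontr)
      assume "b \<noteq> 0"
      then have e: "of_int b * (1 / (2 * of_int b)) = (1 / 2 :: rat)" by simp
      have "of_int b * (1 / (2 * of_int b)) \<in> (\<int> :: rat set)" using ker by blast
      then show False unfolding e using half by blast
    qed
    moreover have "a = 0"
    proof (rule ccontr)
      assume "a \<noteq> 0"
      then have e: "of_int (- a) * (1 / (2 * of_int (- a))) = (1 / 2 :: rat)" by simp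
      have "of_int (- a) * (1 / (2 * of_int (- a))) \<in> (\<int> :: rat set)" using ker by blast
      then show False unfolding e using half by blast
    qed
    ultimately show False using assms[of "1/2" 0] half by simp
  qed
  \<comment> \<open>the columns of the inverse matrix are mapped to the integral vectors (1, 0) and (0, 1)\<close>
  have "of_int c / of_int \<Delta> \<in> (\<int> :: rat set) \<and> of_int (- (r * b)) / of_int \<Delta> \<in> (\<int> :: rat set)"
  proof (rule assms)
    have "of_int a * (of_int c / of_int \<Delta>) + of_int b * (of_int (- (r * b)) / of_int \<Delta>) = (of_int (a * c - r * b^2) / of_int \<Delta> :: rat)"
      by (simp add: power2_eq_square diff_divide_distrib mult_ac)
    also have "\<dots> = 1" unfolding \<Delta>_def[symmetric] using nz by simp
    finally have "of_int a * (of_int c / of_int \<Delta>) + of_int b * (of_int (- (r * b)) / of_int \<Delta>) = (1 :: rat)" .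
    then show "of_int a * (of_int c / of_int \<Delta>) + of_int b * (of_int (- (r * b)) / of_int \<Delta>) \<in> (\<int> :: rat set)" by (simp only: Ints_1)
    show "of_int (r * b) * (of_int c / of_int \<Delta>) + of_int c * (of_int (- (r * b)) / of_int \<Delta>) \<in> (\<int> :: rat set)"
      by (simp add: algebra_simps)
  qed
  then have dc: "\<Delta> dvd c" using frac nz by blast
  have "of_int (- b) / of_int \<Delta> \<in> (\<int> :: rat set) \<and> of_int a / of_int \<Delta> \<in> (\<int> :: rat set)"
  proof (rule assms)
    have "of_int (r * b) * (of_int (- b) / of_int \<Delta>) + of_int c * (of_int a / of_int \<Delta>) = (of_int (a * c - r * b^2) / of_int \<Delta> :: rat)"
      by (simp add: power2_eq_square diff_divide_distrib mult_ac)
    also have "\<dots> = 1" unfolding \<Delta>_def[symmetric] using nz by simp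
    finally have "of_int (r * b) * (of_int (- b) / of_int \<Delta>) + of_int c * (of_int a / of_int \<Delta>) = (1 :: rat)" .
    then show "of_int (r * b) * (of_int (- b) / of_int \<Delta>) + of_int c * (of_int a / of_int \<Delta>) \<in> (\<int> :: rat set)" by (simp only: Ints_1)
    show "of_int a * (of_int (- b) / of_int \<Delta>) + of_int b * (of_int a / of_int \<Delta>) \<in> (\<int> :: rat set)"
      by (simp add: algebra_simps)
  qed
  then have db: "\<Delta> dvd - b" and da: "\<Delta> dvd a" using frac nz by blast+
  have "\<Delta> * \<Delta> dvd a * c" by (rule mult_dvd_mono[OF da dc])
  moreover have "\<Delta> * \<Delta> dvd r * b^2" unfolding power2_eq_square using db by (intro dvd_mult mult_dvd_mono) simp_all
  ultimately have "\<Delta> * \<Delta> dvd a * c - r * b^2" by (rule dvd_diff)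
  then have "\<Delta> * \<Delta> dvd \<Delta> * 1" unfolding \<Delta>_def[symmetric] mult_1_right .
  then have "\<Delta> dvd 1" using nz unfolding dvd_mult_cancel_left by simp
  then show ?thesis unfolding \<Delta>_def[symmetric] by auto
qed

text \<open>Integrality of the pairing of \<open>u1/n\<close> and \<open>u2/(n r)\<close> with \<open>L\<close> gives \<open>a\<close>, \<open>b\<close>, \<open>c\<close>. That there are no further dual vectors gives
  \<open>a c - r b^2 = \<plusminus>1\<close>.\<close>
lemma discriminant_data_exists:
  fixes L :: "('v::ab_group_add) zlattice"
  assumes even: "even_lattice L" and inv: "invariant_factor L n m"
  obtains u1 u2 r a b c where "m = n * r" "discriminant_data L u1 u2 n r a b c"
proof -
  have integral: "integral_lattice L" using even by (simp add: even_lattice_def)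
  interpret V: vector_space "smul L" using integral by (simp add: integral_lattice_def)
  have n: "n > 0" and m: "m > 0" and nm: "n dvd m" using inv by (simp_all add: invariant_factor_def)
  obtain r where r: "m = n * r" using nm by (rule dvdE)
  have r0: "r > 0" using m r by (cases r) simp_all
  obtain v1 v2 where v: "v1 \<noteq> v2" "lattice_basis (dual_lattice L) {v1, v2}"
    "points L = zspan L {smul L (of_nat n) v1, smul L (of_nat m) v2}"
    using inv by (auto simp: invariant_factor_def)
  have smul_dual: "smul (dual_lattice L) = smul L" by (simp add: dual_lattice_def)
  have vsd: "vector_space (smul (dual_lattice L))" unfolding smul_dual by (rule V.vector_space_axioms)
  have ind: "x = 0 \<and> y = 0" if "smul L x v1 + smul L y v2 = 0" for x y
    using v(2) that unfolding lattice_basis_pair_iff[OF vsd v(1)] smul_dual by blast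
  have span: "\<exists>x y. z = smul L x v1 + smul L y v2" for z
    using v(2) unfolding lattice_basis_pair_iff[OF vsd v(1)] smul_dual by blast
  have dual: "points (dual_lattice L) = {smul L (of_int i) v1 + smul L (of_int j) v2 | i j. True}"
    using v(2) unfolding lattice_basis_pair_iff[OF vsd v(1)] smul_dual by blast
  define u1 where "u1 = smul L (of_nat n) v1"
  define u2 where "u2 = smul L (of_nat m) v2"
  have lc: "lincomb L u1 u2 x y = smul L (x * of_nat n) v1 + smul L (y * of_nat m) v2" for x y
    by (simp add: lincomb_def u1_def u2_def)
  have ne: "u1 \<noteq> u2"
  proof
    assume "u1 = u2"
    then have "lincomb L u1 u2 1 (- 1) = 0" by (simp add: lincomb_def)
    then show False using ind[of "of_nat n" "- of_nat m"] n unfolding lc by simp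
  qed
  have "lattice_basis L {u1, u2}"
    unfolding lattice_basis_pair_iff[OF V.vector_space_axioms ne] lincomb_def[symmetric]
  proof (intro conjI allI impI)
    fix x y assume "lincomb L u1 u2 x y = 0"
    then show "x = 0" "y = 0" using ind n m unfolding lc by fastforce+
  next
    fix z
    obtain x y where "z = smul L x v1 + smul L y v2" using span by blast
    then have "z = lincomb L u1 u2 (x / of_nat n) (y / of_nat m)" unfolding lc using n m by simp
    then show "\<exists>x y. z = lincomb L u1 u2 x y" by blast
  next
    show "points L = {lincomb L u1 u2 (of_int i) (of_int j) | i j. True}"
      using v(3) unfolding u1_def[symmetric] u2_def[symmetric] zspan_pair[OF ne] lincomb_def .
  qed
  then interpret B: binary_lattice L u1 u2 using integral ne by unfold_locales
  have dual': "points (dual_lattice L) = {lincomb L u1 u2 (of_int i / of_nat n) (of_int j / of_nat m) | i j. True}"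
    unfolding dual lc using n m by simp
  have dualI: "lincomb L u1 u2 (of_int i / of_nat n) (of_int j / of_nat m) \<in> points (dual_lattice L)" for i j
    unfolding dual' by blast
  have pair: "form L (lincomb L u1 u2 (of_int i / of_nat n) (of_int j / of_nat m)) u \<in> \<int>" if "u \<in> points L" for i j u
    using dualI[of i j] that by (simp add: dual_lattice_def)
  have f1: "form L (lincomb L u1 u2 x y) u1 = x * form L u1 u1 + y * form L u1 u2"
    and f2: "form L (lincomb L u1 u2 x y) u2 = x * form L u1 u2 + y * form L u2 u2" for x y
    using B.form_lincomb[of x y 1 0] B.form_lincomb[of x y 0 1] by (simp_all add: B.lincomb_basis)
  obtain a where a: "form L u1 u1 / of_nat n = of_int a"
    using pair[OF B.u_in_points(1), of 1 0] by (auto simp: f1 elim: Ints_cases)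
  obtain b where b: "form L u1 u2 / of_nat m = of_int b"
    using pair[OF B.u_in_points(1), of 0 1] by (auto simp: f1 elim: Ints_cases)
  obtain c where c: "form L u2 u2 / of_nat m = of_int c"
    using pair[OF B.u_in_points(2), of 0 1] by (auto simp: f2 elim: Ints_cases)
  have g1: "form L u1 u1 = of_int (int n * a)" and g2: "form L u1 u2 = of_int (int m * b)" and g3: "form L u2 u2 = of_int (int m * c)"
    using a b c n m by (simp_all add: field_simps)
  have ev: "even (int n * a) \<and> even (int m * c)"
    using B.even_lattice_iff[OF g1 g2 g3] even by blast
  have unimod: "a * c - int r * b^2 = 1 \<or> a * c - int r * b^2 = - 1"
  proof (rule integral_inverse_unimodular)
    fix s t :: rat
    assume 1: "of_int a * s + of_int b * t \<in> \<int>" and 2: "of_int (int r * b) * s + of_int c * t \<in> \<int>"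
    let ?z = "lincomb L u1 u2 (s / of_nat n) (t / of_nat m)"
    have z1: "form L ?z u1 \<in> \<int>" and z2: "form L ?z u2 \<in> \<int>"
      unfolding f1 f2 g1 g2 g3 using 1 2 n m r0 by (simp_all add: r mult_ac)
    have "form L ?z y \<in> \<int>" if y: "y \<in> points L" for y
    proof -
      obtain i j where y: "y = lincomb L u1 u2 (of_int i) (of_int j)" using y unfolding B.points_eq by blast
      have "form L ?z y = of_int i * form L ?z u1 + of_int j * form L ?z u2"
        unfolding y lincomb_def[of L u1 u2 "of_int i"] B.form_add_right B.form_scale_right ..
      then show ?thesis using z1 z2 by simp
    qed
    then have "?z \<in> points (dual_lattice L)" by (simp add: dual_lattice_def)
    then obtain i j where "?z = lincomb L u1 u2 (of_int i / of_nat n) (of_int j / of_nat m)" unfolding dual' by blast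
    then have "s / of_nat n = of_int i / of_nat n" "t / of_nat m = of_int j / of_nat m" unfolding B.lincomb_eq_iff by simp_all
    then show "s \<in> \<int> \<and> t \<in> \<int>" using n m by simp
  qed
  have "discriminant_data L u1 u2 n r a b c"
    using n r0 g1 g2 g3 unimod ev dual' unfolding r by unfold_locales (simp_all add: mult.commute)
  then show ?thesis using that r by blast
qed

context discriminant_data
begin

text \<open>All Gram entries of \<open>L\<close> are divisible by \<open>n\<close>, hence \<open>L = M(2^k)\<close> where \<open>M\<close> has the entries divided by \<open>2^k\<close>.\<close>
lemma rescaled_lattice_exists:
  assumes n': "n = 2 ^ k * n'"
  shows "\<exists>M :: (rat^2) zlattice. integral_lattice M \<and> lattice_isometric L (rescale M (2 ^ k)) \<and>
    (even_lattice M \<longleftrightarrow> even (int n' * a) \<and> even (int n' * int r * c)) \<and>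
    lattice_det M = (int n')^2 * int r * (a * c - int r * b^2)"
proof -
  define A where "A = int n' * a"
  define B where "B = int n' * int r * b"
  define C where "C = int n' * int r * c"
  have n'0: "n' > 0" using n n' by (cases n') simp_all
  have det: "A * C - B^2 = (int n')^2 * int r * (a * c - int r * b^2)"
    by (simp add: A_def B_def C_def power2_eq_square algebra_simps)
  have "A * C - B^2 \<noteq> 0" unfolding det using n'0 r unimodular by auto
  note M = gram_lattice[OF this]
  interpret M: binary_lattice "gram_lattice A B C" "axis 1 1" "axis 2 1" by (rule M(1))
  have "lattice_isometric L (rescale (gram_lattice A B C) (2 ^ k))"
    by (rule lattice_isometric_of_equal_gram[OF binary_lattice_axioms M(1)])
       (simp_all only: M(2-4) gram, simp_all add: n' A_def B_def C_def)
  moreover have "even_lattice (gram_lattice A B C) \<longleftrightarrow> even A \<and> even C" by (rule M.even_lattice_iff[OF M(2-4)])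
  moreover have "lattice_det (gram_lattice A B C) = A * C - B^2"
    by (rule M.lattice_det_eq) (simp add: M(2-4))
  ultimately show ?thesis using M.integral unfolding det unfolding A_def C_def by blast
qed

lemma rescaled_lattice_gram:
  assumes "integral_lattice M" "lattice_isometric L (rescale M (2 ^ e))"
  shows "\<exists>A B C. 2 ^ e * A = int n * a \<and> 2 ^ e * B = int (n * r) * b \<and> 2 ^ e * C = int (n * r) * c \<and>
    (even_lattice M \<longleftrightarrow> even A \<and> even C) \<and> lattice_det M = A * C - B^2"
proof -
  obtain w1 w2 where M: "binary_lattice M w1 w2"
    and g: "of_nat (2 ^ e) * form M w1 w1 = form L u1 u1" "of_nat (2 ^ e) * form M w1 w2 = form L u1 u2"
      "of_nat (2 ^ e) * form M w2 w2 = form L u2 u2"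
    using lattice_isometric_transport[OF binary_lattice_axioms assms] by blast
  interpret M: binary_lattice M w1 w2 by (rule M)
  obtain A where A: "form M w1 w1 = of_int A" using M.gram_integral(1) by (rule Ints_cases)
  obtain B where B: "form M w1 w2 = of_int B" using M.gram_integral(2) by (rule Ints_cases)
  obtain C where C: "form M w2 w2 = of_int C" using M.gram_integral(3) by (rule Ints_cases)
  have "of_int (2 ^ e * A) = (of_int (int n * a) :: rat)" "of_int (2 ^ e * B) = (of_int (int (n * r) * b) :: rat)"
    "of_int (2 ^ e * C) = (of_int (int (n * r) * c) :: rat)"
    using g unfolding A B C gram by simp_all
  then have "2 ^ e * A = int n * a" "2 ^ e * B = int (n * r) * b" "2 ^ e * C = int (n * r) * c"
    by (simp_all only: of_int_eq_iff)
  moreover have "even_lattice M \<longleftrightarrow> even A \<and> even C" by (rule M.even_lattice_iff[OF A B C])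
  moreover have "lattice_det M = A * C - B^2" by (rule M.lattice_det_eq) (simp add: A B C)
  ultimately show ?thesis by blast
qed

lemma odd_unimodular: "odd (a * c - int r * b^2)"
  using unimodular by (elim disjE) (erule ssubst, simp)+

text \<open>Since \<open>a c - r b^2\<close> is odd, \<open>2^e\<close> divides all Gram entries only if it divides \<open>n\<close>. If a factor \<open>2\<close> of \<open>n\<close> were left over, all
  Gram entries of \<open>M\<close> would be even, so \<open>M\<close> would be an even lattice of even determinant.\<close>
lemma rescaled_lattice_parity:
  assumes n': "n = 2 ^ k * n'" "odd n'" and M: "integral_lattice M" and iso: "lattice_isometric L (rescale M (2 ^ e))"
    and det: "odd (lattice_det M) \<or> \<not> even_lattice M"
  shows "(even_lattice M \<longleftrightarrow> even a \<and> even (int r * c)) \<and> (odd (lattice_det M) \<longleftrightarrow> odd r)"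
proof -
  obtain A B C where A: "2 ^ e * A = int n * a" and B: "2 ^ e * B = int (n * r) * b" and C: "2 ^ e * C = int (n * r) * c"
    and ev: "even_lattice M \<longleftrightarrow> even A \<and> even C" and d: "lattice_det M = A * C - B^2"
    using rescaled_lattice_gram[OF M iso] by blast
  note odd_s = odd_unimodular
  \<comment> \<open>a combination of the divisible Gram entries that equals n up to sign\<close>
  have eq: "2 ^ e * (A * c - B * b) = int n * (a * c - int r * b^2)"
  proof -
    have "2 ^ e * (A * c - B * b) = (2 ^ e * A) * c - (2 ^ e * B) * b" by (simp add: algebra_simps)
    then show ?thesis unfolding A B by (simp add: power2_eq_square algebra_simps)
  qed
  have "2 ^ e dvd int n * (a * c - int r * b^2)" unfolding eq[symmetric] by simp
  moreover have "coprime (2 ^ e) (a * c - int r * b^2)" using odd_s by simp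
  ultimately have "2 ^ e dvd int n" using coprime_dvd_mult_left_iff by blast
  then have "2 ^ e dvd 2 ^ k * int n'" unfolding n' by simp
  moreover have "coprime (2 ^ e) (int n')" using n'(2) by simp
  ultimately have "(2::int) ^ e dvd 2 ^ k" using coprime_dvd_mult_left_iff by blast
  then have "int (2 ^ e) dvd int (2 ^ k)" by simp
  then have "(2::nat) ^ e dvd 2 ^ k" by (simp only: of_nat_dvd_iff)
  then have "e \<le> k" by (rule power_dvd_imp_le) simp
  then obtain f where f: "k = e + f" using le_Suc_ex by blast
  have nn: "int n = 2 ^ e * (2 ^ f * int n')" unfolding n' f by (simp add: power_add)
  have A': "A = 2 ^ f * (int n' * a)" and B': "B = 2 ^ f * (int n' * int r * b)" and C': "C = 2 ^ f * (int n' * int r * c)"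
    using A B C by (simp_all add: nn mult_ac)
  have "f = 0"
  proof (rule ccontr)
    assume "f \<noteq> 0"
    then have "even A" "even B" "even C" unfolding A' B' C' by simp_all
    then have "even_lattice M" "even (lattice_det M)" using ev d by simp_all
    then show False using det by blast
  qed
  then have "A = int n' * a" "C = int n' * int r * c" "lattice_det M = (int n')^2 * int r * (a * c - int r * b^2)"
    using A' B' C' d by (simp_all add: power2_eq_square algebra_simps)
  then show ?thesis using ev n'(2) odd_s by simp
qed

lemma odd_a_and_c: "even r \<Longrightarrow> odd a \<and> odd c"
  using odd_unimodular by simp

lemma even_model_iff:
  "(\<exists>(M :: (rat^2) zlattice) e. even_lattice M \<and> odd (lattice_det M) \<and> lattice_isometric L (rescale M (2 ^ e)))
    \<longleftrightarrow> odd r \<and> even a \<and> even c"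
  (is "?E \<longleftrightarrow> _")
  and odd_model_odd_iff:
  "(\<exists>(M :: (rat^2) zlattice) e. odd_lattice M \<and> odd (lattice_det M) \<and> lattice_isometric L (rescale M (2 ^ e)))
    \<longleftrightarrow> odd r \<and> \<not> (even a \<and> even c)"
  (is "?O \<longleftrightarrow> _")
  and odd_model_even_iff:
  "(\<exists>(M :: (rat^2) zlattice) e. odd_lattice M \<and> even (lattice_det M) \<and> lattice_isometric L (rescale M (2 ^ e)))
    \<longleftrightarrow> even r"
  (is "?Z \<longleftrightarrow> _")
proof -
  have "n \<noteq> 0" "\<not> is_unit (2::nat)" using n by simp_all
  from multiplicity_decompose'[OF this] obtain n' where n': "n = 2 ^ multiplicity 2 n * n'" "odd n'" by blast
  define k where "k = multiplicity 2 n"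
  note n' = n'[folded k_def]
  note odd_s = odd_unimodular
  obtain M :: "(rat^2) zlattice" where M: "integral_lattice M" "lattice_isometric L (rescale M (2 ^ k))"
    and evM: "even_lattice M \<longleftrightarrow> even (int n' * a) \<and> even (int n' * int r * c)"
    and detM: "lattice_det M = (int n')^2 * int r * (a * c - int r * b^2)"
    using rescaled_lattice_exists[OF n'(1)] by blast
  have evM': "even_lattice M \<longleftrightarrow> even a \<and> even (int r * c)" using evM n'(2) by simp
  have detM': "odd (lattice_det M) \<longleftrightarrow> odd r" using detM n'(2) odd_s by simp
  note par = rescaled_lattice_parity[OF n']
  show "?E \<longleftrightarrow> odd r \<and> even a \<and> even c"
  proof
    assume ?E
    then obtain M' :: "(rat^2) zlattice" and e where M': "even_lattice M'" "odd (lattice_det M')" "lattice_isometric L (rescale M' (2 ^ e))" by blast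
    have "integral_lattice M'" using M'(1) by (simp add: even_lattice_def)
    then show "odd r \<and> even a \<and> even c" using par[OF _ M'(3)] M'(1,2) by auto
  next
    assume "odd r \<and> even a \<and> even c"
    then have "even_lattice M" "odd (lattice_det M)" using evM' detM' by simp_all
    then show ?E using M(2) by blast
  qed
  show "?O \<longleftrightarrow> odd r \<and> \<not> (even a \<and> even c)"
  proof
    assume ?O
    then obtain M' :: "(rat^2) zlattice" and e where M': "odd_lattice M'" "odd (lattice_det M')" "lattice_isometric L (rescale M' (2 ^ e))" by blast
    then show "odd r \<and> \<not> (even a \<and> even c)" using par[OF _ M'(3)] unfolding odd_lattice_def by auto
  next
    assume "odd r \<and> \<not> (even a \<and> even c)"
    then have "odd_lattice M" "odd (lattice_det M)" using evM' detM' M(1) by (auto simp: odd_lattice_def)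
    then show ?O using M(2) by blast
  qed
  show "?Z \<longleftrightarrow> even r"
  proof
    assume ?Z
    then obtain M' :: "(rat^2) zlattice" and e where M': "odd_lattice M'" "even (lattice_det M')" "lattice_isometric L (rescale M' (2 ^ e))" by blast
    then show "even r" using par[OF _ M'(3)] unfolding odd_lattice_def by auto
  next
    assume "even r"
    then have "odd_lattice M" "even (lattice_det M)" using evM' detM' M(1) odd_a_and_c by (auto simp: odd_lattice_def)
    then show ?Z using M(2) by blast
  qed
qed

end

section \<open>Local factors at the odd primes\<close>

lemma Legendre_cong:
  assumes "[x = y] (mod p)"
  shows "Legendre x p = Legendre y p"
  unfolding Legendre_def QuadRes_def using assms by (simp add: cong_def)

lemma Legendre_mult_four:
  fixes p :: int
  assumes p: "prime p" "odd p"
  shows "Legendre (4 * x) p = Legendre x p"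
proof -
  have p2: "\<not> p dvd 2" using odd_prime_not_dvd_double[OF p, of 1] p(1) not_prime_unit by auto
  have "coprime 2 p" using prime_imp_coprime[OF p(1) p2] by (simp only: coprime_commute)
  then have "coprime (2 * 2) p" by (simp only: coprime_mult_left_iff)
  then have cop: "coprime 4 p" by simp
  have 0: "[4 * x = 0] (mod p) \<longleftrightarrow> [x = 0] (mod p)"
    using cop by (simp add: cong_0_iff coprime_dvd_mult_right_iff coprime_commute)
  have "QuadRes p (4 * x) \<longleftrightarrow> QuadRes p x"
  proof
    assume "QuadRes p x"
    then obtain y where "[y^2 = x] (mod p)" by (auto simp: QuadRes_def)
    then have "[4 * y^2 = 4 * x] (mod p)" by (rule cong_mult[OF cong_refl])
    then have "[(2 * y)^2 = 4 * x] (mod p)" by (simp add: power2_eq_square)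
    then show "QuadRes p (4 * x)" unfolding QuadRes_def by (rule exI)
  next
    assume "QuadRes p (4 * x)"
    then obtain y where y: "[y^2 = 4 * x] (mod p)" by (auto simp: QuadRes_def)
    obtain i where i: "[2 * i = 1] (mod p)" using prime_power_inverse_ex[OF p(1) p2, of 1] by auto
    have "[(i * y)^2 = i^2 * (4 * x)] (mod p)"
      unfolding power_mult_distrib by (rule cong_mult[OF cong_refl y])
    also have "i^2 * (4 * x) = (2 * i)^2 * x" by (simp add: power2_eq_square)
    also have "[(2 * i)^2 * x = 1^2 * x] (mod p)" by (rule cong_mult[OF cong_pow[OF i] cong_refl])
    finally have "[(i * y)^2 = x] (mod p)" by simp
    then show "QuadRes p x" unfolding QuadRes_def by (rule exI)
  qed
  then show ?thesis unfolding Legendre_def 0 by simp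
qed

lemma prod_if_subset:
  fixes g :: "'a \<Rightarrow> real"
  assumes "finite S" "T \<subseteq> S"
  shows "(\<Prod>x\<in>S. if x \<in> T then g x else 1) = (\<Prod>x\<in>T. g x)"
proof -
  have "S \<inter> T = T" using assms(2) by blast
  then show ?thesis using prod.inter_restrict[OF assms(1), of g T] by simp
qed

text \<open>The powers of \<open>2\<close> multiply to \<open>2^(\<tau>(n) + \<tau>(r))\<close> and the powers \<open>p^k\<close> to \<open>n\<close>.\<close>
lemma assemble_local_factors:
  fixes n r :: nat and F :: "nat \<Rightarrow> real"
  assumes n: "n > 0" and r: "r > 0"
  shows "(\<Prod>p\<in>prime_factors (n * r). 2 ^ ((if p \<in> prime_factors n then 1 else 0) + (if p \<in> prime_factors r then 1 else 0)) *
      real p ^ multiplicity p n * (if p \<in> prime_factors n then F p else 1))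
    = 2 ^ (tau n + tau r) * real n * (\<Prod>p\<in>prime_factors n. F p)"
proof -
  let ?S = "prime_factors (n * r)"
  have S: "?S = prime_factors n \<union> prime_factors r" using n r by (intro prime_factors_product) auto
  have sub: "prime_factors n \<subseteq> ?S" "prime_factors r \<subseteq> ?S" unfolding S by auto
  have two: "(\<Prod>p\<in>?S. (2::real) ^ (if p \<in> prime_factors k then 1 else 0)) = 2 ^ tau k" if "prime_factors k \<subseteq> ?S" for k
  proof -
    have "(\<Prod>p\<in>?S. (2::real) ^ (if p \<in> prime_factors k then 1 else 0)) = (\<Prod>p\<in>?S. if p \<in> prime_factors k then 2 else 1)"
      by (rule prod.cong) auto
    also have "\<dots> = (\<Prod>p\<in>prime_factors k. 2)" by (rule prod_if_subset[OF _ that]) simp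
    finally show ?thesis by (simp add: tau_def)
  qed
  have "(\<Prod>p\<in>?S. real p ^ multiplicity p n) = (\<Prod>p\<in>?S. if p \<in> prime_factors n then real p ^ multiplicity p n else 1)"
  proof (rule prod.cong[OF refl])
    fix p assume p: "p \<in> ?S"
    show "real p ^ multiplicity p n = (if p \<in> prime_factors n then real p ^ multiplicity p n else 1)"
    proof (cases "p \<in> prime_factors n")
      case False
      then have "\<not> p dvd n" using p n by (auto simp: in_prime_factors_iff)
      then show ?thesis using False by (simp add: not_dvd_imp_multiplicity_0)
    qed simp
  qed
  also have "\<dots> = (\<Prod>p\<in>prime_factors n. real p ^ multiplicity p n)" by (rule prod_if_subset[OF _ sub(1)]) simp
  also have "\<dots> = real (\<Prod>p\<in>prime_factors n. p ^ multiplicity p n)" by simp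
  also have "\<dots> = real n" using n by (simp only: prod_prime_factors) (simp add: prod_prime_factors)
  finally have pn: "(\<Prod>p\<in>?S. real p ^ multiplicity p n) = real n" .
  have F: "(\<Prod>p\<in>?S. if p \<in> prime_factors n then F p else 1) = (\<Prod>p\<in>prime_factors n. F p)"
    by (rule prod_if_subset[OF _ sub(1)]) simp
  show ?thesis unfolding prod.distrib power_add two[OF sub(1)] two[OF sub(2)] pn F ..
qed

text \<open>The prime \<open>2\<close> survives in \<open>n/2\<close> unless it divides \<open>n\<close> only once.\<close>
lemma tau_half:
  assumes n: "n = 2 ^ k * n'" and n': "odd n'" and k: "k \<ge> 1"
  shows "tau (n div 2) = card (prime_factors n - {2}) + (if k = 1 then 0 else 1)"
proof -
  have n'0: "n' \<noteq> 0" using n' by (cases n') simp_all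
  have pf: "prime_factors (2 ^ j * n') = (if j = 0 then {} else {2}) \<union> prime_factors n'" for j
  proof -
    have "prime_factors (2 ^ j * n') = prime_factors (2 ^ j) \<union> prime_factors n'"
      using n'0 by (intro prime_factors_product) auto
    moreover have "prime_factors ((2::nat) ^ j) = (if j = 0 then {} else {2})"
      by (simp add: prime_factorization_prime_power)
    ultimately show ?thesis by simp
  qed
  have two: "2 \<notin> prime_factors n'" using n' by (auto simp: in_prime_factors_iff)
  obtain j where j: "k = Suc j" using k by (cases k) auto
  have "n div 2 = 2 ^ j * n'" unfolding n j by simp
  then have "prime_factors (n div 2) = (if j = 0 then {} else {2}) \<union> prime_factors n'" using pf by simp
  moreover have "prime_factors n - {2} = prime_factors n'" unfolding n pf j using two by auto
  ultimately show ?thesis unfolding tau_def using two j by auto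
qed

context discriminant_data
begin

abbreviation model where "model \<equiv> binary_quad_group n r c b a"

lemma torsion_model:
  assumes p: "prime p" and nk: "n = p ^ k * n'" "\<not> p dvd n'" and re: "r = p ^ e * r'" "\<not> p dvd r'"
  shows "quad_isomorphic (binary_quad_group (p ^ k) (p ^ e) (c * int (n' * r')) (b * int (n' * r')) (a * int n')) (torsion (p ^ (k + e)) model)"
  using torsion_binary_quad_group[OF p nk(2) re(2), of k e c a b] well_defined unfolding nk(1) re(1) by simp

text \<open>The determinant of the \<open>p\<close>-part is the unit part of the determinant of \<open>L\<close>, up to the sign contained in \<open>\<epsilon>\<^sub>p\<close>.\<close>
lemma local_det:
  assumes "r = p ^ e * r'"
  shows "c * int (n' * r') * (a * int n') - int (p ^ e) * (b * int (n' * r'))^2 = (int n')^2 * int r' * (a * c - int r * b^2)"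
  unfolding assms by (simp add: power2_eq_square algebra_simps)

lemma local_nondegenerate:
  assumes p: "prime p" and n': "\<not> p dvd n'" and re: "r = p ^ e * r'" "\<not> p dvd r'"
  shows "nondegenerate_form (p ^ k) (p ^ e) (c * int (n' * r')) (b * int (n' * r')) (a * int n')"
proof -
  have "\<not> int p dvd int n'" "\<not> int p dvd int r'" using n' re(2) by simp_all
  moreover have pp: "prime (int p)" using p by simp
  moreover have "\<not> int p dvd a * c - int r * b^2"
  proof
    assume "int p dvd a * c - int r * b^2"
    then have "is_unit (int p)" using unimodular by (metis dvd_minus_iff)
    then show False using pp not_prime_unit by blast
  qed
  ultimately have "\<not> int p dvd (int n')^2 * int r' * (a * c - int r * b^2)"
    by (simp add: prime_dvd_mult_iff prime_dvd_power_iff)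
  from coprime_prime_power[OF pp this, of "k + e"] show ?thesis
    unfolding nondegenerate_form_def local_det[OF re(1)] by (simp add: power_add)
qed

lemma local_well_defined:
  assumes p: "prime p" and nk: "n = p ^ k * n'" and re: "r = p ^ e * r'"
  shows "well_defined_form (p ^ k) (p ^ e) (c * int (n' * r')) (a * int n')"
proof -
  have "p > 0" using p by (simp add: prime_gt_0_nat)
  moreover have c: "c * int (n' * r') * int (p ^ k * p ^ e) = c * int (n * r)" unfolding nk re by simp
  moreover have a: "a * int n' * int (p ^ k) = a * int n" unfolding nk by simp
  ultimately show ?thesis unfolding well_defined_form_def a c using even_a even_c by simp
qed

lemma group_model: "group model"
  by (rule comm_group.axioms(2)[OF comm_group_binary_quad_group])

lemma group_torsion_model: "group (torsion N model)"
  by (rule comm_group.axioms(2)[OF comm_group_torsion[OF comm_group_binary_quad_group]])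

lemma card_torsion_model:
  assumes "quad_isomorphic (binary_quad_group K d A B C) (torsion N model)"
  shows "card (isometry_group (torsion N model)) = card (isometry_group (binary_quad_group K d A B C))"
proof -
  have "finite (carrier (torsion N model))"
    using finite_binary_quad_group[OF n r, of c b a] by (simp add: torsion_def)
  then show ?thesis
    using card_isometry_group_cong[OF comm_group.axioms(2)[OF comm_group_binary_quad_group] group_torsion_model _ assms] by simp
qed

lemma card_isometry_group_discriminant_form:
  assumes "even_lattice L"
  shows "card (isometry_group (discriminant_form L)) =
    (\<Prod>p\<in>prime_factors (n * r). card (isometry_group (torsion (p ^ multiplicity p (n * r)) model)))"
proof -
  have iso: "quad_isomorphic model (discriminant_form L)" by (rule discriminant_form_isomorphic[OF assms])
  have gD: "group (discriminant_form L)" by (rule comm_group.axioms(2)[OF comm_group_discriminant_form])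
  have "card (isometry_group (discriminant_form L)) = card (isometry_group model)"
    by (rule card_isometry_group_cong[OF gD group_model finite_binary_quad_group[OF n r] quad_isomorphic_sym[OF group_model iso]])
  then show ?thesis using card_isometry_group_binary_product[OF well_defined] by simp
qed

text \<open>For the model the \<open>2\<close>-component is a torsion part, which is known to be a binary form.\<close>
lemma two_component_isomorphic:
  assumes even: "even_lattice L" and nk: "n = 2 ^ k * n'" "odd n'" and re: "r = 2 ^ e * r'" "odd r'"
  shows "quad_isomorphic (p_component 2 (discriminant_form L))
    (binary_quad_group (2 ^ k) (2 ^ e) (c * int (n' * r')) (b * int (n' * r')) (a * int n'))"
    and "group (p_component 2 (discriminant_form L))"
proof -
  let ?D = "discriminant_form L"
  have gD: "group ?D" by (rule comm_group.axioms(2)[OF comm_group_discriminant_form])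
  have iso: "quad_isomorphic ?D model" by (rule quad_isomorphic_sym[OF group_model discriminant_form_isomorphic[OF even]])
  have N: "n * r = 2 ^ (k + e) * (n' * r')" unfolding nk re by (simp add: power_add)
  have "p_component 2 model = torsion (2 ^ (k + e)) model"
  proof (rule p_component_eq_torsion[OF comm_group_binary_quad_group two_is_prime_nat])
    show "\<not> 2 dvd n' * r'" using nk re by simp
    show "x [^]\<^bsub>model\<^esub> (2 ^ (k + e) * (n' * r')) = \<one>\<^bsub>model\<^esub>" if "x \<in> carrier model" for x
      using exponent_binary_quad_group[OF n r, of c b a "n * r"] that unfolding N by simp
  qed
  then have 1: "quad_isomorphic (p_component 2 ?D) (torsion (2 ^ (k + e)) model)"
    using quad_isomorphic_p_component[OF gD group_model iso, of 2] by simp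
  have n'': "\<not> 2 dvd n'" "\<not> 2 dvd r'" using nk re by simp_all
  have 2: "quad_isomorphic (binary_quad_group (2 ^ k) (2 ^ e) (c * int (n' * r')) (b * int (n' * r')) (a * int n')) (torsion (2 ^ (k + e)) model)"
    using torsion_model[OF two_is_prime_nat nk(1) n''(1) re(1) n''(2)] by simp
  show "quad_isomorphic (p_component 2 ?D)
    (binary_quad_group (2 ^ k) (2 ^ e) (c * int (n' * r')) (b * int (n' * r')) (a * int n'))"
    using quad_isomorphic_trans[OF 1 quad_isomorphic_sym[OF comm_group.axioms(2)[OF comm_group_binary_quad_group] 2]] .
  have "p_component 2 ?D = torsion (2 ^ (k + e)) ?D"
  proof (rule p_component_eq_torsion[OF comm_group_discriminant_form two_is_prime_nat])
    show "\<not> 2 dvd n' * r'" using nk re by simp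
    have "\<forall>x\<in>carrier ?D. x [^]\<^bsub>?D\<^esub> (n * r) = \<one>\<^bsub>?D\<^esub>"
      by (rule quad_isomorphic_pow[OF gD group_model iso]) (use exponent_binary_quad_group[OF n r, of c b a "n * r"] in simp)
    then show "x [^]\<^bsub>?D\<^esub> (2 ^ (k + e) * (n' * r')) = \<one>\<^bsub>?D\<^esub>" if "x \<in> carrier ?D" for x
      using that unfolding N by blast
  qed
  then show "group (p_component 2 ?D)" using comm_group.axioms(2)[OF comm_group_torsion[OF comm_group_discriminant_form]] by simp
qed

lemma eps_eq:
  assumes p: "prime p" and nk: "n = p ^ k * n'" "\<not> p dvd n'" and re: "r = p ^ e * r'" "\<not> p dvd r'"
  shows "eps L n (n * r) p = (if e = 0 then - ((int n')^2 * int r' * (a * c - int r * b^2)) else 0)"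
proof -
  have p0: "p > 0" "p \<noteq> 0" using p by (simp_all add: prime_gt_0_nat)
  have mn: "multiplicity p n = k" by (rule multiplicity_decomposeI[OF nk p0(2)])
  have nr: "n * r = p ^ (k + e) * (n' * r')" unfolding nk(1) re(1) by (simp add: power_add mult_ac)
  have "\<not> p dvd n' * r'" using nk(2) re(2) p by (simp add: prime_dvd_mult_iff)
  then have mnr: "multiplicity p (n * r) = k + e" using multiplicity_decomposeI[OF nr _ p0(2)] by blast
  show ?thesis
  proof (cases "e = 0")
    case True
    have d: "- lattice_det L = int p ^ (2 * k) * (- ((int n')^2 * int r' * (a * c - int r * b^2)))"
    proof -
      have "(int n)^2 = int p ^ (2 * k) * (int n')^2" unfolding nk(1) by (simp add: power_mult_distrib power_mult[symmetric] mult.commute)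
      moreover have "r = r'" using True re(1) by simp
      ultimately show ?thesis unfolding lattice_det by (simp add: mult_ac)
    qed
    have "- lattice_det L div int p ^ (2 * k) = - ((int n')^2 * int r' * (a * c - int r * b^2))"
      unfolding d by (rule nonzero_mult_div_cancel_left) (use p0 in simp)
    then show ?thesis unfolding eps_def mn mnr using True by simp
  next
    case False
    then show ?thesis unfolding eps_def mn mnr by simp
  qed
qed

text \<open>After diagonalization with coefficients \<open>2 u\<close>, \<open>2 w\<close> and \<open>e = 0\<close>, the determinant \<open>4 u w\<close> is \<open>- \<epsilon>\<^sub>p\<close> modulo \<open>p\<close>, so that the symbol of \<open>- u w\<close>
  in the count of the conic is \<open>\<chi>\<^sub>p(\<epsilon>\<^sub>p)\<close>.\<close>
lemma card_local_odd:
  assumes p: "prime p" "odd p" and nk: "n = p ^ k * n'" "\<not> p dvd n'" and re: "r = p ^ e * r'" "\<not> p dvd r'" and ke: "k + e \<ge> 1"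
  shows "real (card (isometry_group (torsion (p ^ (k + e)) model))) =
    2 ^ ((if k = 0 then 0 else 1) + (if e = 0 then 0 else 1)) * real p ^ k * (if k = 0 then 1 else 1 - chi p (eps L n (n * r) p) / p)"
proof -
  let ?A = "c * int (n' * r')" and ?B = "b * int (n' * r')" and ?C = "a * int n'"
  have pp: "prime (int p)" "odd (int p)" using p by simp_all
  have p0: "p > 0" using p by (simp add: prime_gt_0_nat)
  have wd: "well_defined_form (p ^ k) (p ^ e) ?A ?C" by (rule local_well_defined[OF p(1) nk(1) re(1)])
  have nd: "nondegenerate_form (p ^ k) (p ^ e) ?A ?B ?C" by (rule local_nondegenerate[OF p(1) nk(2) re])
  have "even ?A" "even ?C" using wd p(2) unfolding well_defined_form_def by auto
  from diagonal_form_odd[OF p ke this nd] obtain u w where u: "\<not> int p dvd u" and w: "\<not> int p dvd w"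
    and iso: "quad_isomorphic (binary_quad_group (p ^ k) (p ^ e) (2 * u) 0 (2 * w)) (binary_quad_group (p ^ k) (p ^ e) ?A ?B ?C)"
    and uw: "[(2 * u) * (2 * w) = ?A * ?C - int p ^ e * ?B^2] (mod int p)" by blast
  have card: "card (isometry_group (torsion (p ^ (k + e)) model)) = card (isometry_group (binary_quad_group (p ^ k) (p ^ e) (2 * u) 0 (2 * w)))"
    by (rule card_torsion_model[OF quad_isomorphic_trans[OF iso torsion_model[OF p(1) nk re]]])
  have p2: "p \<noteq> 2" using p(2) by auto
  show ?thesis
  proof (cases "e = 0")
    case False
    then have "chi p (eps L n (n * r) p) = 0" using eps_eq[OF p(1) nk re] p2 by (simp add: chi_def Legendre_def)
    then show ?thesis
      unfolding card using False card_isometry_group_diagonal_odd(1)[OF p u w, of e k] by simp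
  next
    case True
    then have k: "k \<ge> 1" using ke by simp
    have "[- (4 * (u * w)) = eps L n (n * r) p] (mod int p)"
    proof -
      have "?A * ?C - int p ^ e * ?B^2 = - eps L n (n * r) p"
        using local_det[OF re(1), of n'] eps_eq[OF p(1) nk re] True by simp
      then have "[4 * (u * w) = - eps L n (n * r) p] (mod int p)" using uw by (simp add: mult_ac)
      then show ?thesis using cong_minus_minus_iff[of "4 * (u * w)" "- eps L n (n * r) p" "int p"] by simp
    qed
    then have "Legendre (4 * (- (u * w))) (int p) = Legendre (eps L n (n * r) p) (int p)"
      by (intro Legendre_cong) simp
    then have "Legendre (eps L n (n * r) p) (int p) = Legendre (- (u * w)) (int p)"
      using Legendre_mult_four[OF pp, of "- (u * w)"] by (simp only:)
    then have chi: "chi p (eps L n (n * r) p) = Legendre (- (u * w)) (int p)"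
      unfolding chi_def using p2 by simp
    have "int (card (isometry_group (torsion (p ^ (k + e)) model))) = 2 * (int p^(k-1) * (int p - chi p (eps L n (n * r) p)))"
      unfolding card chi using card_isometry_group_diagonal_odd(2)[OF p u w k] True by simp
    then have "real_of_int (int (card (isometry_group (torsion (p ^ (k + e)) model)))) =
        real_of_int (2 * (int p^(k-1) * (int p - chi p (eps L n (n * r) p))))" by (simp only:)
    then have "real (card (isometry_group (torsion (p ^ (k + e)) model))) = 2 * (real p^(k-1) * (real p - chi p (eps L n (n * r) p)))"
      by (simp only: of_int_of_nat_eq of_int_mult of_int_power of_int_diff of_int_numeral)
    also have "\<dots> = 2 * real p ^ k * (1 - chi p (eps L n (n * r) p) / p)"
    proof -
      obtain j where "k = Suc j" using k by (cases k) auto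
      then show ?thesis using p0 by (simp add: field_simps)
    qed
    finally show ?thesis using True k by simp
  qed
qed

end

section \<open>The prime two\<close>

lemma odd_product_cong_one_iff:
  fixes u w :: int
  assumes "odd u" "odd w"
  shows "[u * w = 1] (mod 4) \<longleftrightarrow> [u = w] (mod 4)"
proof -
  obtain i where i: "u = 2 * i + 1" using assms(1) by (rule oddE)
  obtain j where j: "w = 2 * j + 1" using assms(2) by (rule oddE)
  have "[u * w = 1] (mod 4) \<longleftrightarrow> 4 dvd 4 * (i * j) + 2 * (i + j)"
    unfolding i j cong_iff_dvd_diff by (simp add: algebra_simps)
  also have "\<dots> \<longleftrightarrow> 4 dvd 2 * (i + j)" by (rule dvd_add_right_iff) simp
  also have "\<dots> \<longleftrightarrow> 4 dvd 2 * (i - j)" by presburger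
  also have "\<dots> \<longleftrightarrow> [u = w] (mod 4)" unfolding i j cong_iff_dvd_diff by (simp add: algebra_simps)
  finally show ?thesis .
qed

locale two_adic_data = discriminant_data L u1 u2 n r a b c for L :: "('v::ab_group_add) zlattice" and u1 u2 n r a b c +
  fixes k n' e r' :: nat
  assumes even: "even_lattice L" and nk: "n = 2 ^ k * n'" "odd n'" and re: "r = 2 ^ e * r'" "odd r'"
begin

abbreviation "coeff_A \<equiv> c * int (n' * r')"
abbreviation "coeff_B \<equiv> b * int (n' * r')"
abbreviation "coeff_C \<equiv> a * int n'"
abbreviation "local_model \<equiv> binary_quad_group (2 ^ k) (2 ^ e) coeff_A coeff_B coeff_C"
abbreviation "D2 \<equiv> p_component 2 (discriminant_form L)"

lemma nk': "\<not> 2 dvd n'" and re': "\<not> 2 dvd r'"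
  using nk re by simp_all

lemma D2_iso: "quad_isomorphic D2 local_model"
  by (rule two_component_isomorphic(1)[OF even nk re])

lemma group_D2: "group D2"
  by (rule two_component_isomorphic(2)[OF even nk re])

lemma group_binary: "group (binary_quad_group K d A B C)"
  by (rule comm_group.axioms(2)[OF comm_group_binary_quad_group])

lemma D2_iso_iff: "quad_isomorphic D2 E \<longleftrightarrow> quad_isomorphic local_model E"
proof
  assume "quad_isomorphic D2 E"
  then show "quad_isomorphic local_model E" by (rule quad_isomorphic_trans[OF quad_isomorphic_sym[OF group_D2 D2_iso]])
next
  assume "quad_isomorphic local_model E"
  then show "quad_isomorphic D2 E" by (rule quad_isomorphic_trans[OF D2_iso])
qed

lemma multiplicities: "multiplicity 2 n = k" "multiplicity 2 r = e" "multiplicity 2 (n * r) = k + e"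
proof -
  show "multiplicity 2 n = k" using multiplicity_decomposeI[OF nk(1) nk'] by simp
  show "multiplicity 2 r = e" using multiplicity_decomposeI[OF re(1) re'] by simp
  have nr: "n * r = 2 ^ (k + e) * (n' * r')" unfolding nk(1) re(1) by (simp add: power_add)
  have "\<not> 2 dvd n' * r'" using nk re by simp
  then show "multiplicity 2 (n * r) = k + e" using multiplicity_decomposeI[OF nr] by simp
qed

lemma local_wd: "well_defined_form (2 ^ k) (2 ^ e) coeff_A coeff_C"
  using local_well_defined[OF two_is_prime_nat nk(1) re(1)] .

lemma local_nd: "nondegenerate_form (2 ^ k) (2 ^ e) coeff_A coeff_B coeff_C"
  using local_nondegenerate[OF two_is_prime_nat nk' re(1) re'] .

lemma coeff_parity: "even coeff_A \<longleftrightarrow> even c" "even coeff_C \<longleftrightarrow> even a"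
  using nk re by simp_all

lemma r_parity: "even r \<longleftrightarrow> e \<ge> 1"
  using re by (cases e) simp_all

text \<open>If \<open>n\<close> is odd, evenness of \<open>L\<close> makes \<open>a\<close> even, so \<open>r\<close> is odd because \<open>a c - r b^2\<close> is, and then \<open>c\<close> is even as well.\<close>
lemma k_pos: "e \<ge> 1 \<or> odd a \<or> odd c \<Longrightarrow> k \<ge> 1"
proof (rule ccontr)
  assume h: "e \<ge> 1 \<or> odd a \<or> odd c" and "\<not> k \<ge> 1"
  then have "odd n" using nk by simp
  then have "even a" "even c \<or> even r" using even_a even_c by auto
  then show False using h odd_a_and_c r_parity by auto
qed

lemma eps_two: "eps L n (n * r) 2 = (if e = 0 then coeff_B^2 - coeff_A * coeff_C else 0)"
proof (cases "e = 0")
  case True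
  have X: "(int n')^2 * int r' * (a * c - int r * b^2) = coeff_A * coeff_C - coeff_B^2"
    using local_det[OF re(1), of n'] unfolding True by simp
  show ?thesis unfolding eps_eq[OF two_is_prime_nat nk(1) nk' re(1) re'] X using True by (simp only: if_True minus_diff_eq refl)
next
  case False
  then show ?thesis unfolding eps_eq[OF two_is_prime_nat nk(1) nk' re(1) re'] by (simp only: if_False)
qed

text \<open>With \<open>A = 2 \<alpha>\<close> and \<open>C = 2 \<gamma>\<close> one has \<open>\<epsilon>\<^sub>2 = B^2 - 4 \<alpha> \<gamma>\<close>, and \<open>B^2 = 1\<close> modulo \<open>8\<close>. So \<open>\<chi>\<^sub>2(\<epsilon>\<^sub>2)\<close> is decided by the parity of
  \<open>\<alpha> \<gamma>\<close>, as is the alternative between \<open>U\<close> and \<open>V\<close>.\<close>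
lemma even_local_form:
  assumes e: "e = 0" and ev: "even a" "even c" and k: "k \<ge> 1"
  shows "quad_isomorphic D2 (form_U k) \<and> chi 2 (eps L n (n * r) 2) = 1 \<and> card (isometry_group (torsion (2 ^ (k + e)) model)) = 2 ^ k \<or>
    quad_isomorphic D2 (form_V k) \<and> chi 2 (eps L n (n * r) 2) = - 1 \<and> card (isometry_group (torsion (2 ^ (k + e)) model)) = 3 * 2 ^ k"
proof -
  have "even coeff_A" "even coeff_C" using ev coeff_parity by blast+
  obtain \<alpha> where \<alpha>: "coeff_A = 2 * \<alpha>" using \<open>even coeff_A\<close> by (rule evenE)
  obtain \<gamma> where \<gamma>: "coeff_C = 2 * \<gamma>" using \<open>even coeff_C\<close> by (rule evenE)
  have "coprime (coeff_A * coeff_C - coeff_B^2) (2 ^ k)"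
    using local_nd unfolding nondegenerate_form_def e by simp
  then have odd_det: "odd (coeff_A * coeff_C - coeff_B^2)"
    using k by (simp only: coprime_commute coprime_power_left_iff coprime_left_2_iff_odd) simp
  have parity: "odd y" if "odd (x * z - y^2)" "even x" for x y z :: int using that by simp
  have B: "odd coeff_B" by (rule parity[OF odd_det \<open>even coeff_A\<close>])
  obtain t where t: "coeff_B^2 - 1 = 8 * t" using odd_square_cong_one[OF B] unfolding cong_iff_dvd_diff by (rule dvdE)
  have eps: "eps L n (n * r) 2 = 1 + 8 * t - 4 * (\<alpha> * \<gamma>)" using eps_two e t unfolding \<alpha> \<gamma> by simp
  have tors: "quad_isomorphic local_model (torsion (2 ^ (k + e)) model)"
    using torsion_model[OF two_is_prime_nat nk(1) nk' re(1) re'] by simp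
  have model: "local_model = binary_quad_group (2 ^ k) 1 (2 * \<alpha>) coeff_B (2 * \<gamma>)" unfolding \<alpha>[symmetric] \<gamma>[symmetric] e by simp
  show ?thesis
  proof (cases "even (\<alpha> * \<gamma>)")
    case True
    have iso: "quad_isomorphic (binary_quad_group (2 ^ k) 1 0 1 0) local_model"
      unfolding model by (rule hyperbolic_form[OF k B True])
    obtain s where "\<alpha> * \<gamma> = 2 * s" using True by (rule evenE)
    then have "eps L n (n * r) 2 mod 8 = 1" unfolding eps by presburger
    then have "chi 2 (eps L n (n * r) 2) = 1" by (simp add: chi_def)
    moreover have "quad_isomorphic D2 (form_U k)"
      unfolding D2_iso_iff form_U_eq by (rule quad_isomorphic_sym[OF group_binary iso])
    moreover have "card (isometry_group (torsion (2 ^ (k + e)) model)) = 2 ^ k"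
      using card_torsion_model[OF quad_isomorphic_trans[OF iso tors]] card_isometry_group_hyperbolic[OF k] by simp
    ultimately show ?thesis by blast
  next
    case False
    then have ag: "odd \<alpha>" "odd \<gamma>" by simp_all
    have iso: "quad_isomorphic (binary_quad_group (2 ^ k) 1 2 1 2) local_model"
      unfolding model by (rule eisenstein_form[OF k B ag])
    obtain s where "\<alpha> * \<gamma> = 2 * s + 1" using False by (rule oddE)
    then have "eps L n (n * r) 2 mod 8 = 5" unfolding eps by presburger
    then have "chi 2 (eps L n (n * r) 2) = - 1" by (simp add: chi_def)
    moreover have "quad_isomorphic D2 (form_V k)"
      unfolding D2_iso_iff form_V_eq by (rule quad_isomorphic_sym[OF group_binary iso])
    moreover have "card (isometry_group (torsion (2 ^ (k + e)) model)) = 3 * 2 ^ k"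
      using card_torsion_model[OF quad_isomorphic_trans[OF iso tors]] card_isometry_group_eisenstein[OF k] by simp
    ultimately show ?thesis by blast
  qed
qed

text \<open>The determinant \<open>u w\<close> is \<open>- \<epsilon>\<^sub>2\<close> modulo \<open>4\<close> if \<open>e = 0\<close>, and for odd numbers \<open>u w = 1\<close> modulo \<open>4\<close> means \<open>u = w\<close> modulo \<open>4\<close>.\<close>
lemma diagonal_local_form:
  assumes h: "e \<ge> 1 \<or> odd a \<or> odd c"
  obtains u w where "odd u" "odd w" "quad_isomorphic D2 (binary_quad_group (2 ^ k) (2 ^ e) u 0 w)"
    "card (isometry_group (torsion (2 ^ (k + e)) model)) = card (isometry_group (binary_quad_group (2 ^ k) (2 ^ e) u 0 w))"
    "e = 0 \<longrightarrow> [u = w] (mod 4) \<longleftrightarrow> [eps L n (n * r) 2 = - 1] (mod 4)"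
proof -
  have "e \<ge> 1 \<or> odd coeff_A \<or> odd coeff_C" using h coeff_parity by blast
  from diagonal_form_two[OF k_pos[OF h] local_nd this] obtain u w where uw: "odd u" "odd w"
    "quad_isomorphic (binary_quad_group (2 ^ k) (2 ^ e) u 0 w) local_model"
    "[u * w = coeff_A * coeff_C - 2 ^ e * coeff_B^2] (mod 4)" by blast
  have tors: "quad_isomorphic local_model (torsion (2 ^ (k + e)) model)"
    using torsion_model[OF two_is_prime_nat nk(1) nk' re(1) re'] by simp
  have "quad_isomorphic D2 (binary_quad_group (2 ^ k) (2 ^ e) u 0 w)"
    unfolding D2_iso_iff by (rule quad_isomorphic_sym[OF group_binary uw(3)])
  moreover have "card (isometry_group (torsion (2 ^ (k + e)) model)) = card (isometry_group (binary_quad_group (2 ^ k) (2 ^ e) u 0 w))"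
    by (rule card_torsion_model[OF quad_isomorphic_trans[OF uw(3) tors]])
  moreover have "[u = w] (mod 4) \<longleftrightarrow> [eps L n (n * r) 2 = - 1] (mod 4)" if e: "e = 0"
  proof -
    have "[u * w = - eps L n (n * r) 2] (mod 4)" using uw(4) eps_two e by simp
    then have "[u * w = 1] (mod 4) \<longleftrightarrow> [- eps L n (n * r) 2 = 1] (mod 4)" by (rule cong_replace_left)
    also have "\<dots> \<longleftrightarrow> [eps L n (n * r) 2 = - 1] (mod 4)"
      using cong_minus_minus_iff[of "eps L n (n * r) 2" "- 1" 4] by simp
    finally show ?thesis unfolding odd_product_cong_one_iff[OF uw(1,2)] .
  qed
  ultimately show ?thesis using that[OF uw(1,2)] by simp
qed

lemma local_model_orders:
  assumes "K > 0" "d > 0" "quad_isomorphic D2 (binary_quad_group K d A B C)"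
  shows "2 ^ k = K" "2 ^ e = d"
  using quad_isomorphic_binary_orders[OF _ _ assms(1,2), of "2 ^ k" "2 ^ e"] assms(3) unfolding D2_iso_iff by auto

lemma D2_trivial_iff: "carrier D2 = {\<one>\<^bsub>D2\<^esub>} \<longleftrightarrow> k = 0 \<and> e = 0"
proof -
  have fin: "finite (carrier D2)" and card: "card (carrier D2) = 2 ^ k * 2 ^ e * 2 ^ k"
  proof -
    obtain f where f: "bij_betw f (carrier D2) (carrier local_model)" using D2_iso unfolding quad_isomorphic_def iso_def by blast
    have "finite (carrier local_model)" by (rule finite_binary_quad_group) simp_all
    then show "finite (carrier D2)" using bij_betw_finite[OF f] by blast
    show "card (carrier D2) = 2 ^ k * 2 ^ e * 2 ^ k"
      using bij_betw_same_card[OF f] by (simp add: carrier_binary_quad_group nat_mult_distrib nat_power_eq)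
  qed
  interpret group D2 by (rule group_D2)
  show ?thesis
  proof
    assume "carrier D2 = {\<one>\<^bsub>D2\<^esub>}"
    then have "card (carrier D2) = 1" by (simp only: card.insert[OF finite.emptyI] card.empty) simp
    then show "k = 0 \<and> e = 0" using card by simp
  next
    assume "k = 0 \<and> e = 0"
    then have "card (carrier D2) = 1" using card by simp
    then obtain x where "carrier D2 = {x}" using card_1_singletonE by blast
    then show "carrier D2 = {\<one>\<^bsub>D2\<^esub>}" using one_closed by auto
  qed
qed

lemma parity_of_iso:
  assumes iso: "quad_isomorphic D2 (binary_quad_group (2 ^ k0) 1 A B C)" and k0: "k0 \<ge> 1"
  shows "k0 = k" "e = 0" "(even a \<and> even c) \<longleftrightarrow> even A \<and> even C"
proof -
  have "(2::nat) ^ k = 2 ^ k0" "(2::nat) ^ e = 1" using local_model_orders[OF _ _ iso] by simp_all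
  then show ke: "k0 = k" "e = 0" by simp_all
  have iso': "quad_isomorphic local_model (binary_quad_group (2 ^ k) (2 ^ e) A B C)"
    using iso unfolding D2_iso_iff ke by simp
  have wd: "well_defined_form (2 ^ k) (2 ^ e) A C" using k0 ke by (simp add: well_defined_form_def)
  have "even coeff_A \<and> even coeff_C \<longleftrightarrow> even A \<and> even C"
    using quad_isomorphic_parity[OF local_wd wd iso'] quad_isomorphic_parity[OF wd local_wd quad_isomorphic_sym[OF group_binary iso']]
    unfolding ke by auto
  then show "(even a \<and> even c) \<longleftrightarrow> even A \<and> even C" unfolding coeff_parity by blast
qed

lemma even_type_iff:
  "carrier D2 = {\<one>\<^bsub>D2\<^esub>} \<or> (\<exists>k0\<ge>1. quad_isomorphic D2 (form_U k0) \<or> quad_isomorphic D2 (form_V k0))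
    \<longleftrightarrow> odd r \<and> even a \<and> even c"
proof
  assume "carrier D2 = {\<one>\<^bsub>D2\<^esub>} \<or> (\<exists>k0\<ge>1. quad_isomorphic D2 (form_U k0) \<or> quad_isomorphic D2 (form_V k0))"
  then consider "carrier D2 = {\<one>\<^bsub>D2\<^esub>}" | k0 where "k0 \<ge> 1" "quad_isomorphic D2 (form_U k0)" | k0 where "k0 \<ge> 1" "quad_isomorphic D2 (form_V k0)"
    by blast
  then show "odd r \<and> even a \<and> even c"
  proof cases
    case 1
    then have "k = 0" "e = 0" unfolding D2_trivial_iff by blast+
    then show ?thesis using k_pos r_parity by auto
  next
    case 2
    then show ?thesis using parity_of_iso[of k0 0 1 0] r_parity unfolding form_U_eq by simp
  next
    case 3
    then show ?thesis using parity_of_iso[of k0 2 1 2] r_parity unfolding form_V_eq by simp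
  qed
next
  assume h: "odd r \<and> even a \<and> even c"
  then have e: "e = 0" using r_parity by simp
  show "carrier D2 = {\<one>\<^bsub>D2\<^esub>} \<or> (\<exists>k0\<ge>1. quad_isomorphic D2 (form_U k0) \<or> quad_isomorphic D2 (form_V k0))"
  proof (cases "k \<ge> 1")
    case True
    then show ?thesis using even_local_form[OF e] h by blast
  next
    case False
    then show ?thesis using e D2_trivial_iff by simp
  qed
qed

lemma odd_unimodular_type_iff:
  "(\<exists>k0\<ge>1. \<exists>\<theta> \<theta>'. odd \<theta> \<and> odd \<theta>' \<and> quad_isomorphic D2 (form_A k0 \<theta> \<theta>')) \<longleftrightarrow> odd r \<and> \<not> (even a \<and> even c)"
proof
  assume "\<exists>k0\<ge>1. \<exists>\<theta> \<theta>'. odd \<theta> \<and> odd \<theta>' \<and> quad_isomorphic D2 (form_A k0 \<theta> \<theta>')"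
  then obtain k0 \<theta> \<theta>' where h: "k0 \<ge> 1" "odd \<theta>" "odd \<theta>'" "quad_isomorphic D2 (form_A k0 \<theta> \<theta>')" by blast
  then show "odd r \<and> \<not> (even a \<and> even c)" using parity_of_iso[of k0 \<theta> 0 \<theta>'] r_parity unfolding form_A_eq by simp
next
  assume h: "odd r \<and> \<not> (even a \<and> even c)"
  then have e: "e = 0" and h': "e \<ge> 1 \<or> odd a \<or> odd c" using r_parity by auto
  obtain u w where uw: "odd u" "odd w" "quad_isomorphic D2 (binary_quad_group (2 ^ k) (2 ^ e) u 0 w)"
    using diagonal_local_form[OF h'] by blast
  have "quad_isomorphic D2 (form_A k u w)" using uw(3) unfolding form_A_eq e by simp
  then show "\<exists>k0\<ge>1. \<exists>\<theta> \<theta>'. odd \<theta> \<and> odd \<theta>' \<and> quad_isomorphic D2 (form_A k0 \<theta> \<theta>')"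
    using uw(1,2) k_pos[OF h'] by blast
qed

lemma odd_degenerate_orders:
  assumes "1 \<le> k0" "k0 < l0" "quad_isomorphic D2 (form_B l0 k0 \<theta> \<theta>')"
  shows "k0 = k" "l0 - k0 = e"
proof -
  have "quad_isomorphic D2 (binary_quad_group (2 ^ k0) (2 ^ (l0 - k0)) \<theta> 0 \<theta>')"
    using assms form_B_eq[of k0 l0 \<theta> \<theta>'] by simp
  from local_model_orders[OF _ _ this] show "k0 = k" "l0 - k0 = e" by simp_all
qed

lemma odd_degenerate_type_iff:
  "(\<exists>k0 l0. \<exists>\<theta> \<theta>'. 1 \<le> k0 \<and> k0 < l0 \<and> odd \<theta> \<and> odd \<theta>' \<and> quad_isomorphic D2 (form_B l0 k0 \<theta> \<theta>')) \<longleftrightarrow> even r"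
proof
  assume "\<exists>k0 l0. \<exists>\<theta> \<theta>'. 1 \<le> k0 \<and> k0 < l0 \<and> odd \<theta> \<and> odd \<theta>' \<and> quad_isomorphic D2 (form_B l0 k0 \<theta> \<theta>')"
  then obtain k0 l0 \<theta> \<theta>' where h: "1 \<le> k0" "k0 < l0" "quad_isomorphic D2 (form_B l0 k0 \<theta> \<theta>')" by blast
  then have "e \<ge> 1" using odd_degenerate_orders[OF h] by simp
  then show "even r" using r_parity by blast
next
  assume "even r"
  then have e: "e \<ge> 1" and h': "e \<ge> 1 \<or> odd a \<or> odd c" using r_parity by auto
  obtain u w where uw: "odd u" "odd w" "quad_isomorphic D2 (binary_quad_group (2 ^ k) (2 ^ e) u 0 w)"
    using diagonal_local_form[OF h'] by blast
  have "quad_isomorphic D2 (form_B (k + e) k u w)" using uw(3) form_B_eq[of k "k + e" u w] by simp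
  moreover have "k < k + e" using e by simp
  ultimately show "\<exists>k0 l0. \<exists>\<theta> \<theta>'. 1 \<le> k0 \<and> k0 < l0 \<and> odd \<theta> \<and> odd \<theta>' \<and> quad_isomorphic D2 (form_B l0 k0 \<theta> \<theta>')"
    using uw(1,2) k_pos[OF h'] by blast
qed

lemma local_factor_odd:
  assumes p: "p \<in> prime_factors (n * r)" "p \<noteq> 2"
  shows "real (card (isometry_group (torsion (p ^ multiplicity p (n * r)) model))) =
    2 ^ ((if p \<in> prime_factors n then 1 else 0) + (if p \<in> prime_factors r then 1 else 0)) *
      real p ^ multiplicity p n * (if p \<in> prime_factors n then 1 - chi p (eps L n (n * r) p) / p else 1)"
proof -
  have pp: "prime p" using p(1) by auto
  then have op: "odd p" using p(2) primes_dvd_imp_eq two_is_prime_nat by blast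
  have nz: "n \<noteq> 0" "r \<noteq> 0" "\<not> is_unit p" using n r pp not_prime_unit by auto
  from multiplicity_decompose'[OF nz(1,3)] obtain n1 where n1: "n = p ^ multiplicity p n * n1" "\<not> p dvd n1" by blast
  from multiplicity_decompose'[OF nz(2,3)] obtain r1 where r1: "r = p ^ multiplicity p r * r1" "\<not> p dvd r1" by blast
  have m: "multiplicity p (n * r) = multiplicity p n + multiplicity p r"
    using pp nz by (intro prime_elem_multiplicity_mult_distrib) auto
  have "multiplicity p (n * r) > 0" using p(1) unfolding prime_factors_multiplicity by blast
  then have "multiplicity p n + multiplicity p r \<ge> 1" using m by linarith
  from card_local_odd[OF pp op n1 r1 this] show ?thesis
    unfolding m using pp by (auto simp: prime_factors_multiplicity)
qed

text \<open>The factor at \<open>2\<close> is normalized to the shape of the other ones, with \<open>f\<close> in place of \<open>1 - \<chi>\<^sub>p(\<epsilon>\<^sub>p)/p\<close>, so that the product over all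
  primes can be assembled uniformly.\<close>
lemma order_formula:
  assumes h2: "k + e \<ge> 1 \<Longrightarrow> real (card (isometry_group (torsion (2 ^ (k + e)) model))) =
    2 ^ ((if k = 0 then 0 else 1) + (if e = 0 then 0 else 1)) * 2 ^ k * (if k = 0 then 1 else f)"
  shows "real (card (isometry_group (discriminant_form L))) = 2 ^ (tau n + tau r) * real n *
    (\<Prod>p\<in>prime_factors n. if p = 2 then f else 1 - chi p (eps L n (n * r) p) / p)"
proof -
  have "real (card (isometry_group (discriminant_form L))) =
    (\<Prod>p\<in>prime_factors (n * r). real (card (isometry_group (torsion (p ^ multiplicity p (n * r)) model))))"
    unfolding card_isometry_group_discriminant_form[OF even] by simp
  also have "\<dots> = (\<Prod>p\<in>prime_factors (n * r). 2 ^ ((if p \<in> prime_factors n then 1 else 0) + (if p \<in> prime_factors r then 1 else 0)) *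
      real p ^ multiplicity p n * (if p \<in> prime_factors n then (if p = 2 then f else 1 - chi p (eps L n (n * r) p) / p) else 1))"
  proof (rule prod.cong[OF refl])
    fix p assume p: "p \<in> prime_factors (n * r)"
    show "real (card (isometry_group (torsion (p ^ multiplicity p (n * r)) model))) =
      2 ^ ((if p \<in> prime_factors n then 1 else 0) + (if p \<in> prime_factors r then 1 else 0)) *
      real p ^ multiplicity p n * (if p \<in> prime_factors n then (if p = 2 then f else 1 - chi p (eps L n (n * r) p) / p) else 1)"
    proof (cases "p = 2")
      case False
      then show ?thesis using local_factor_odd[OF p] by simp
    next
      case True
      have "multiplicity 2 (n * r) > 0" using p unfolding True prime_factors_multiplicity by blast
      then have "k + e \<ge> 1" unfolding multiplicities by linarith
      from h2[OF this] show ?thesis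
        unfolding True multiplicities by (auto simp: prime_factors_multiplicity multiplicities)
    qed
  qed
  also have "\<dots> = 2 ^ (tau n + tau r) * real n * (\<Prod>p\<in>prime_factors n. if p = 2 then f else 1 - chi p (eps L n (n * r) p) / p)"
    by (rule assemble_local_factors[OF n r])
  finally show ?thesis .
qed

text \<open>Both \<open>2^k\<close> and \<open>3 * 2^k\<close> equal \<open>2 * 2^k * (1 - \<chi>\<^sub>2(\<epsilon>\<^sub>2)/2)\<close>.\<close>
lemma order_even_type:
  assumes h: "odd r" "even a" "even c"
  shows "real (card (isometry_group (discriminant_form L))) = 2 ^ (tau n + tau r) * real n *
    (\<Prod>p\<in>prime_factors n. 1 - chi p (eps L n (n * r) p) / p)"
proof -
  have e: "e = 0" using h r_parity by simp
  have "real (card (isometry_group (discriminant_form L))) = 2 ^ (tau n + tau r) * real n *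
    (\<Prod>p\<in>prime_factors n. if p = 2 then 1 - chi 2 (eps L n (n * r) 2) / 2 else 1 - chi p (eps L n (n * r) p) / p)"
  proof (rule order_formula)
    assume "k + e \<ge> 1"
    then have "k \<ge> 1" using e by simp
    from even_local_form[OF e h(2,3) this]
    show "real (card (isometry_group (torsion (2 ^ (k + e)) model))) =
      2 ^ ((if k = 0 then 0 else 1) + (if e = 0 then 0 else 1)) * 2 ^ k * (if k = 0 then 1 else 1 - chi 2 (eps L n (n * r) 2) / 2)"
      using e \<open>k \<ge> 1\<close> by auto
  qed
  moreover have "(\<Prod>p\<in>prime_factors n. if p = 2 then 1 - chi 2 (eps L n (n * r) 2) / 2 else 1 - chi p (eps L n (n * r) p) / p) =
    (\<Prod>p\<in>prime_factors n. 1 - chi p (eps L n (n * r) p) / p)"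
    by (rule prod.cong) auto
  ultimately show ?thesis by simp
qed

text \<open>The number of square roots of \<open>1\<close> at the prime \<open>2\<close>, which is \<open>1\<close> for \<open>k = 1\<close> and \<open>2\<close> for \<open>k > 1\<close>, turns \<open>\<tau>(n)\<close> into \<open>\<tau>(n/2)\<close>.\<close>
lemma order_odd_type:
  assumes k: "k \<ge> 1"
    and h2: "real (card (isometry_group (torsion (2 ^ (k + e)) model))) =
      2 ^ (if e = 0 then 0 else 1) * (if k = 1 then 1 else 2) * 2 ^ k * C"
  shows "real (card (isometry_group (discriminant_form L))) = C * 2 ^ (tau (n div 2) + tau r) * real n *
    (\<Prod>p\<in>prime_factors n - {2}. 1 - chi p (eps L n (n * r) p) / p)"
proof -
  \<comment> \<open>the shape of the local factor expected by the product formula has an extra factor 2\<close>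
  let ?f = "C * (if k = 1 then 1 else 2) / 2"
  let ?g = "\<lambda>p. 1 - chi p (eps L n (n * r) p) / p"
  have two: "2 \<in> prime_factors n" using k multiplicities by (simp add: prime_factors_multiplicity)
  have tau_n: "tau n = Suc (card (prime_factors n - {2}))" unfolding tau_def by (rule card.remove[OF _ two]) simp
  have "real (card (isometry_group (discriminant_form L))) = 2 ^ (tau n + tau r) * real n *
    (\<Prod>p\<in>prime_factors n. if p = 2 then ?f else ?g p)"
    by (rule order_formula) (use h2 k in \<open>auto simp: field_simps\<close>)
  also have "(\<Prod>p\<in>prime_factors n. if p = 2 then ?f else ?g p) = ?f * (\<Prod>p\<in>prime_factors n - {2}. if p = 2 then ?f else ?g p)"
    by (subst prod.remove[OF _ two]) simp_all
  also have "(\<Prod>p\<in>prime_factors n - {2}. if p = 2 then ?f else ?g p) = (\<Prod>p\<in>prime_factors n - {2}. ?g p)"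
    by (rule prod.cong) auto
  finally show ?thesis unfolding tau_half[OF nk k] tau_n by (simp add: power_add)
qed

lemma order_odd_unimodular_type:
  assumes h: "odd r" "\<not> (even a \<and> even c)"
  shows "real (card (isometry_group (discriminant_form L))) = (if [eps L n (n * r) 2 = - 1] (mod 4) then 1 else 1 / 2) *
    2 ^ (tau (n div 2) + tau r) * real n * (\<Prod>p\<in>prime_factors n - {2}. 1 - chi p (eps L n (n * r) p) / p)"
proof (rule order_odd_type)
  have e: "e = 0" and h': "e \<ge> 1 \<or> odd a \<or> odd c" using h r_parity by auto
  show k: "k \<ge> 1" by (rule k_pos[OF h'])
  obtain u w where uw: "odd u" "odd w"
    "card (isometry_group (torsion (2 ^ (k + e)) model)) = card (isometry_group (binary_quad_group (2 ^ k) (2 ^ e) u 0 w))"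
    "e = 0 \<longrightarrow> [u = w] (mod 4) \<longleftrightarrow> [eps L n (n * r) 2 = - 1] (mod 4)"
    by (rule diagonal_local_form[OF h']) (rule that)
  have "card (isometry_group (torsion (2 ^ (k + e)) model)) =
    (if k = 1 then 1 else 2) * (2 ^ (k - 1) * (if [eps L n (n * r) 2 = - 1] (mod 4) then 2 else 1))"
    unfolding uw(3) uw(4)[rule_format, OF e, symmetric] using card_isometry_group_diagonal_two(2)[OF uw(1,2) k] e by simp
  moreover obtain j where "k = Suc j" using k by (cases k) auto
  ultimately show "real (card (isometry_group (torsion (2 ^ (k + e)) model))) =
      2 ^ (if e = 0 then 0 else 1) * (if k = 1 then 1 else 2) * 2 ^ k * (if [eps L n (n * r) 2 = - 1] (mod 4) then 1 else 1 / 2)"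
    using e by simp
qed

lemma order_odd_degenerate_type:
  assumes h: "even r"
  shows "real (card (isometry_group (discriminant_form L))) = (if e \<ge> 3 then 1 else 1 / 2) *
    2 ^ (tau (n div 2) + tau r) * real n * (\<Prod>p\<in>prime_factors n - {2}. 1 - chi p (eps L n (n * r) p) / p)"
proof (rule order_odd_type)
  have e: "e \<ge> 1" and h': "e \<ge> 1 \<or> odd a \<or> odd c" using h r_parity by auto
  show k: "k \<ge> 1" by (rule k_pos[OF h'])
  obtain u w where uw: "odd u" "odd w"
    "card (isometry_group (torsion (2 ^ (k + e)) model)) = card (isometry_group (binary_quad_group (2 ^ k) (2 ^ e) u 0 w))"
    by (rule diagonal_local_form[OF h']) (rule that)
  have "card (isometry_group (torsion (2 ^ (k + e)) model)) = (if k = 1 then 1 else 2) * (if e \<ge> 3 then 2 * 2 ^ k else 2 ^ k)"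
    using uw(3) card_isometry_group_diagonal_two(1)[OF uw(1,2) k e] by simp
  then show "real (card (isometry_group (torsion (2 ^ (k + e)) model))) =
      2 ^ (if e = 0 then 0 else 1) * (if k = 1 then 1 else 2) * 2 ^ k * (if e \<ge> 3 then 1 else 1 / 2)"
    using e by simp
qed

end

theorem theorem6p7:
  fixes L :: "('v::ab_group_add) zlattice" and n m :: nat
  assumes "even_lattice L" and "lattice_rank L = 2" and "invariant_factor L n m"
  shows
    "(let D = discriminant_form L; D2 = p_component 2 D;
          ord = real (card (isometry_group D)) in
      (let cond1 = (carrier D2 = {\<one>\<^bsub>D2\<^esub>} \<or>
                    (\<exists>k\<ge>1. quad_isomorphic D2 (form_U k) \<or> quad_isomorphic D2 (form_V k)))
       in
       (cond1 \<longleftrightarrow> (\<exists>(M :: (rat^2) zlattice) e.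
          even_lattice M \<and> odd (lattice_det M) \<and> lattice_isometric L (rescale M (2 ^ e)))) \<and>
       (cond1 \<longrightarrow>
          ord = (2::real) ^ (tau n + tau (m div n)) * n *
            (\<Prod>p\<in>prime_factors n. 1 - chi p (eps L n m p) / p)))
      \<and>
      (let cond2 = (\<exists>k\<ge>1. \<exists>\<theta> \<theta>'. odd \<theta> \<and> odd \<theta>' \<and> quad_isomorphic D2 (form_A k \<theta> \<theta>'))
       in
       (cond2 \<longleftrightarrow> (\<exists>(M :: (rat^2) zlattice) e.
          odd_lattice M \<and> odd (lattice_det M) \<and> lattice_isometric L (rescale M (2 ^ e)))) \<and>
       (cond2 \<longrightarrow>
          ord = (if [eps L n m 2 = -1] (mod 4) then 1 else 1 / 2) *
            2 ^ (tau (n div 2) + tau (m div n)) * n *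
            (\<Prod>p\<in>prime_factors n - {2}. 1 - chi p (eps L n m p) / p)))
      \<and>
      (((\<exists>k l. \<exists>\<theta> \<theta>'. 1 \<le> k \<and> k < l \<and> odd \<theta> \<and> odd \<theta>' \<and>
            quad_isomorphic D2 (form_B l k \<theta> \<theta>')) \<longleftrightarrow>
          (\<exists>(M :: (rat^2) zlattice) e.
             odd_lattice M \<and> even (lattice_det M) \<and> lattice_isometric L (rescale M (2 ^ e)))) \<and>
       (\<forall>k l. \<forall>\<theta> \<theta>'. 1 \<le> k \<longrightarrow> k < l \<longrightarrow> odd \<theta> \<longrightarrow> odd \<theta>' \<longrightarrow>
            quad_isomorphic D2 (form_B l k \<theta> \<theta>') \<longrightarrow>
          ord = (if l - k \<ge> 3 then 1 else 1 / 2) *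
            2 ^ (tau (n div 2) + tau (m div n)) * n *
            (\<Prod>p\<in>prime_factors n - {2}. 1 - chi p (eps L n m p) / p))))"
proof -
  obtain u1 u2 r a b c where m: "m = n * r" and data: "discriminant_data L u1 u2 n r a b c"
    by (rule discriminant_data_exists[OF assms(1,3)]) (rule that)
  interpret discriminant_data L u1 u2 n r a b c by (rule data)
  have nz: "n \<noteq> 0" "r \<noteq> 0" "\<not> is_unit (2::nat)" using n r by simp_all
  from multiplicity_decompose'[OF nz(1,3)] obtain n' where n': "n = 2 ^ multiplicity 2 n * n'" "odd n'" by blast
  from multiplicity_decompose'[OF nz(2,3)] obtain r' where r': "r = 2 ^ multiplicity 2 r * r'" "odd r'" by blast
  interpret two_adic_data L u1 u2 n r a b c "multiplicity 2 n" n' "multiplicity 2 r" r'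
    by (intro two_adic_data.intro two_adic_data_axioms.intro data assms(1) n' r')
  have mn: "m div n = r" unfolding m using n by simp
  have order3: "real (card (isometry_group (discriminant_form L))) = (if l - k \<ge> 3 then 1 else 1 / 2) *
      2 ^ (tau (n div 2) + tau r) * real n * (\<Prod>p\<in>prime_factors n - {2}. 1 - chi p (eps L n (n * r) p) / p)"
    if B: "1 \<le> k" "k < l" "odd \<theta>" "odd \<theta>'" "quad_isomorphic D2 (form_B l k \<theta> \<theta>')" for k l \<theta> \<theta>'
  proof -
    have "even r" using odd_degenerate_type_iff B by blast
    from order_odd_degenerate_type[OF this] show ?thesis unfolding odd_degenerate_orders(2)[OF B(1,2,5)] .
  qed
  show ?thesis
    unfolding Let_def mn even_type_iff odd_unimodular_type_iff odd_degenerate_type_iff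
      even_model_iff odd_model_odd_iff odd_model_even_iff unfolding m
    by (intro conjI impI allI refl order_even_type order_odd_unimodular_type order3; (elim conjE)?; assumption)
qed

end
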